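(* Let $d\ge2$ and let $M,N$ be binary forms of orders $2d-2$, $2d-6$ respectively over $\mathbf{C}$, with $M\ne0$. Then the pair $(M,N)$ satisfies the following mutually equivalent conditions: (i) there exist linearly independent forms $A,B$ of order $d$ such that $M=(A,B)_1$ and $N=(A,B)_3$; (ii) there exist linearly independent forms $A,B$ of order $d$ such that $\mathcal{R}(A,B)=c_0\,M^{\mathfrak p}+c_1\,\omega^2\,N^{\mathfrak p}+O(\omega^4)$, where $O(\omega^4)$ denotes a polynomial divisible by $\omega^4$; (iii) the kernel of the linear map $\psi_{M,N}:S_d\to S_{3d-6}$, $\psi_{M,N}(F)=(M,F)_2-\frac{d-2}{4d-6}\,N\,F$, has dimension at least $2$ (and then it is exactly $2$); if and only if $$\Phi_r(M,N)=0\quad\text{for all } 0\le r\le d,$$ where $\Phi_0,\dots,\Phi_d$ are the joint covariants of $M,N$ defined in the context.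
   Context: All forms are over $\mathbf{C}$. A form of order $e$ is a homogeneous polynomial of degree $e$ in $\mathbf{x}=(x_0,x_1)$; $S_e$ is the space of such forms, viewed as an $SL_2(\mathbf{C})$-module, with $S_e=0$ for $e<0$ (so $N=0$ if $d=2$). Transvectants: for $E\in S_e$, $F\in S_f$, $0\le r\le\min\{e,f\}$, $$(E,F)_r=\frac{(e-r)!(f-r)!}{e!f!}\sum_{i=0}^r(-1)^i\binom{r}{i}\frac{\partial^rE}{\partial x_0^{r-i}\partial x_1^i}\,\frac{\partial^rF}{\partial x_0^i\partial x_1^{r-i}}\in S_{e+f-2r},$$ and $(E,F)_r=0$ for $r>\min\{e,f\}$. Bézoutiant: with $\mathbf{y}=(y_0,y_1)$ and $\omega=x_0y_1-x_1y_0$, $\mathcal{R}(A,B)=\big(A(\mathbf{x})B(\mathbf{y})-B(\mathbf{x})A(\mathbf{y})\big)/\omega$. For $E$ of even order $e$ and $m=e/2$, $E^{\mathfrak p}=\frac{(e-m)!}{e!}\big(y_0\frac{\partial}{\partial x_0}+y_1\frac{\partial}{\partial x_1}\big)^mE$. The constants are $c_r=2\binom{d}{2r+1}^2/\binom{2d-2r}{2r+1}$ for $0\le r\le\lfloor (d-1)/2\rfloor$ (for $d=2$ the $c_1$ term is absent). Wronskian: for $q\le p+1$, $\Theta:\wedge^qS_p\to S_{q(p-q+1)}$ is the $SL_2$-equivariant linear map sending $F_1\wedge\dots\wedge F_q$ to the $q\times q$ determinant with $(i,j)$ entry $\dfrac{\partial^{q-1}F_i}{\partial x_0^{q-j}\partial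 x_1^{j-1}}$. Definition of $\Phi_r$: the linear map $\wedge^d\psi_{M,N}:\wedge^dS_d\to\wedge^dS_{3d-6}$ is an element of $\wedge^dS_{3d-6}\otimes(\wedge^dS_d)^*$. Using an $SL_2$-isomorphism $(\wedge^dS_d)^*\simeq S_d$ (unique up to a nonzero scalar), view it as an element of $\wedge^dS_{3d-6}\otimes S_d$. Apply $\Theta\otimes\mathrm{id}$ (with $p=3d-6$, $q=d$) to obtain an element $\tau$ of $S_{d(2d-5)}\otimes S_d$. Then $\Phi_r(M,N)\in S_{d(2d-4)-2r}$ is the image of $\tau$ under the linear map $S_{d(2d-5)}\otimes S_d\to S_{d(2d-4)-2r}$ induced by the $r$-th transvectant $(G,H)\mapsto(G,H)_r$. Each $\Phi_r$ is defined up to a nonzero scalar independent of $M,N$ and has total degree $d$ in the coefficients of $M,N$. For $d=2$ all these targets involve $S_e$ with $e<0$ and $\Phi_r=0$ by convention. *)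

theory Defs
  imports Complex_Main "Jordan_Normal_Form.Determinant"
begin

section \<open>Binary forms\<close>

text \<open>
  A polynomial in \<open>x0, x1\<close> over the complex numbers is represented with \<open>x0\<close> as the inner and
  \<open>x1\<close> as the outer variable, so \<open>coeff (coeff F j) i\<close> is the coefficient of \<open>x0^i * x1^j\<close>.
\<close>

type_synonym form = "complex poly poly"

definition const :: "complex \<Rightarrow> form" where
  "const c = [:[:c:]:]"

definition scale :: "complex \<Rightarrow> form \<Rightarrow> form" where
  "scale c F = smult [:c:] F"

global_interpretation form: vector_space scale
  by unfold_locales (simp_all add: scale_def smult_add_right smult_add_left[symmetric] mult.commute
      pCons_one)

definition X0 :: form where "X0 = [:[:0, 1:]:]"
definition X1 :: form where "X1 = [:0, 1:]"

definition dx0 :: "form \<Rightarrow> form" where "dx0 = map_poly pderiv"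
definition dx1 :: "form \<Rightarrow> form" where "dx1 = pderiv"

text \<open>The order is an integer, so that \<open>forms e = {0}\<close> for negative \<open>e\<close>.\<close>

definition forms :: "int \<Rightarrow> form set" where
  "forms e = {F. \<forall>i j. coeff (coeff F j) i \<noteq> 0 \<longrightarrow> int i + int j = e}"

definition transvectant :: "nat \<Rightarrow> nat \<Rightarrow> nat \<Rightarrow> form \<Rightarrow> form \<Rightarrow> form" where
  "transvectant e f r E F =
     (if r \<le> min e f then
        scale ((fact (e - r) * fact (f - r)) / (fact e * fact f))
          (\<Sum>i\<le>r. scale ((-1) ^ i * of_nat (r choose i))
             ((dx0 ^^ (r - i)) ((dx1 ^^ i) E) * (dx0 ^^ i) ((dx1 ^^ (r - i)) F)))
      else 0)"


section \<open>The Bezoutiant\<close>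

text \<open>
  Polynomials in \<open>x0, x1, y0, y1\<close>: polynomials in \<open>y0\<close> (inner) and \<open>y1\<close> (outer) whose
  coefficients are polynomials in \<open>x0, x1\<close>. The maps \<open>in_x\<close> and \<open>in_y\<close> send \<open>F\<close> to
  \<open>F(x0, x1)\<close> and to \<open>F(y0, y1)\<close>.
\<close>

type_synonym biform = "form poly poly"

definition in_x :: "form \<Rightarrow> biform" where
  "in_x F = [:[:F:]:]"

definition in_y :: "form \<Rightarrow> biform" where
  "in_y F = map_poly (map_poly const) F"

definition omega :: biform where
  "omega = in_x X0 * in_y X1 - in_x X1 * in_y X0"

text \<open>
  Here \<open>div\<close> is the division of the integral domain \<^typ>\<open>biform\<close>. It is exact when \<open>A\<close> and \<open>B\<close> are
  forms of the same order.
\<close>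

definition bezoutiant :: "form \<Rightarrow> form \<Rightarrow> biform" where
  "bezoutiant A B = (in_x A * in_y B - in_x B * in_y A) div omega"

definition polar_op :: "biform \<Rightarrow> biform" where
  "polar_op P = in_y X0 * map_poly (map_poly dx0) P + in_y X1 * map_poly (map_poly dx1) P"

definition half_polar :: "nat \<Rightarrow> form \<Rightarrow> biform" where
  "half_polar e E =
     (let m = e div 2 in in_x (const (fact (e - m) / fact e)) * (polar_op ^^ m) (in_x E))"

text \<open>
  For \<open>d = 2\<close> and \<open>r = 1\<close> both binomials vanish, so \<open>bez_const 2 1 = 0\<close>.
\<close>

definition bez_const :: "nat \<Rightarrow> nat \<Rightarrow> complex" where
  "bez_const d r =
     2 * of_nat (d choose (2 * r + 1)) ^ 2 / of_nat ((2 * d - 2 * r) choose (2 * r + 1))"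


section \<open>The linear map \<open>\<psi>\<close>\<close>

definition psi :: "nat \<Rightarrow> form \<Rightarrow> form \<Rightarrow> form \<Rightarrow> form" where
  "psi d M N F = transvectant (2 * d - 2) d 2 M F
     - scale ((of_nat d - 2) / (4 * of_nat d - 6)) (N * F)"

definition ker_psi :: "nat \<Rightarrow> form \<Rightarrow> form \<Rightarrow> form set" where
  "ker_psi d M N = {F \<in> forms (int d). psi d M N F = 0}"


section \<open>The \<open>SL\<^sub>2\<close>-modules \<open>S\<^sub>d\<close> and \<open>(\<And>\<^sup>q S\<^sub>d)\<^sup>*\<close>\<close>

definition SL2 :: "complex mat set" where
  "SL2 = {g \<in> carrier_mat 2 2. det g = 1}"

definition subst :: "form \<Rightarrow> form \<Rightarrow> form \<Rightarrow> form" where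
  "subst F U V = poly (map_poly (\<lambda>p. poly (map_poly const p) U) F) V"

text \<open>
  The left action for which \<open>forms 1\<close>, with basis \<open>x0, x1\<close>, is the standard representation.
\<close>

definition act :: "complex mat \<Rightarrow> form \<Rightarrow> form" where
  "act g F = subst F (scale (g $$ (0,0)) X0 + scale (g $$ (1,0)) X1)
                     (scale (g $$ (0,1)) X0 + scale (g $$ (1,1)) X1)"

definition tuples :: "nat \<Rightarrow> form set \<Rightarrow> form list set" where
  "tuples q V = {Fs. length Fs = q \<and> set Fs \<subseteq> V}"

text \<open>
  The dual of the \<open>q\<close>-th exterior power of a subspace \<open>V\<close>: by the universal property of the exterior
  power, the space of alternating \<open>q\<close>-linear functionals on \<open>V\<close>. Functionals are
  extended by 0 to arguments outside \<open>V\<^sup>q\<close>, so that equality of functions is equality of functionals.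
\<close>

definition ext_dual :: "nat \<Rightarrow> form set \<Rightarrow> (form list \<Rightarrow> complex) set" where
  "ext_dual q V = {\<alpha>.
     (\<forall>Fs. Fs \<notin> tuples q V \<longrightarrow> \<alpha> Fs = 0) \<and>
     (\<forall>Fs \<in> tuples q V. \<forall>i<q. \<forall>F\<in>V. \<forall>G\<in>V. \<forall>c.
        \<alpha> (Fs[i := scale c F + G]) = c * \<alpha> (Fs[i := F]) + \<alpha> (Fs[i := G])) \<and>
     (\<forall>Fs \<in> tuples q V. \<forall>i<q. \<forall>j<q. i \<noteq> j \<longrightarrow> Fs ! i = Fs ! j \<longrightarrow> \<alpha> Fs = 0)}"

text \<open>The contragredient action; for \<open>g\<close> in \<open>SL\<^sub>2\<close> the inverse of \<open>g\<close> is \<open>adj_mat g\<close>.\<close>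

definition dual_act :: "complex mat \<Rightarrow> (form list \<Rightarrow> complex) \<Rightarrow> form list \<Rightarrow> complex" where
  "dual_act g \<alpha> = (\<lambda>Fs. \<alpha> (map (act (adj_mat g)) Fs))"

definition SL2_iso_ext_dual :: "nat \<Rightarrow> ((form list \<Rightarrow> complex) \<Rightarrow> form) \<Rightarrow> bool" where
  "SL2_iso_ext_dual d \<phi> \<longleftrightarrow>
     bij_betw \<phi> (ext_dual d (forms (int d))) (forms (int d)) \<and>
     (\<forall>\<alpha> \<in> ext_dual d (forms (int d)). \<forall>\<beta> \<in> ext_dual d (forms (int d)). \<forall>c.
        \<phi> (\<lambda>Fs. c * \<alpha> Fs + \<beta> Fs) = scale c (\<phi> \<alpha>) + \<phi> \<beta>) \<and>
     (\<forall>g \<in> SL2. \<forall>\<alpha> \<in> ext_dual d (forms (int d)). \<phi> (dual_act g \<alpha>) = act g (\<phi> \<alpha>))"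


section \<open>The covariants \<open>\<Phi>\<^sub>r\<close>\<close>

text \<open>
  \<open>wronskian [F\<^sub>1, \<dots>, F\<^sub>q]\<close> is \<open>\<Theta>(F\<^sub>1 \<and> \<dots> \<and> F\<^sub>q)\<close>; the indices below start from 0.
\<close>

definition wronskian :: "form list \<Rightarrow> form" where
  "wronskian Fs = (let q = length Fs in
     det (mat q q (\<lambda>(i, j). (dx0 ^^ (q - 1 - j)) ((dx1 ^^ j) (Fs ! i)))))"

text \<open>
  The space \<open>\<And>\<^sup>d S\<^sub>d\<close> has the basis \<open>b\<^sub>0, \<dots>, b\<^sub>d\<close>, where \<open>b\<^sub>k\<close> is the wedge product of the monomials
  \<open>x0^(d-l) * x1^l\<close> for \<open>l \<noteq> k\<close>, \<open>l\<close> increasing. The list \<open>wedge_basis d k\<close> consists of the factors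
  of \<open>b\<^sub>k\<close>, and \<open>wedge_dual_basis d k\<close> is the element \<open>b\<^sub>k\<^sup>*\<close> of the dual basis: the
  minor of the coefficient matrix that omits the coefficients of \<open>x0^(d-k) * x1^k\<close>. The \<open>j\<close>-th
  element of \<open>{0..d} - {k}\<close> is \<open>insert_index k j\<close>.
\<close>

definition wedge_basis :: "nat \<Rightarrow> nat \<Rightarrow> form list" where
  "wedge_basis d k = map (\<lambda>j. let l = insert_index k j in X0 ^ (d - l) * X1 ^ l) [0..<d]"

definition wedge_dual_basis :: "nat \<Rightarrow> nat \<Rightarrow> form list \<Rightarrow> complex" where
  "wedge_dual_basis d k Fs =
     (if Fs \<in> tuples d (forms (int d)) then
        det (mat d d (\<lambda>(i, j). let l = insert_index k j in coeff (coeff (Fs ! i) l) (d - l)))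
      else 0)"

text \<open>
  The linear map \<open>\<And>\<^sup>d\<psi>\<close> is the tensor \<open>\<Sum>\<^sub>k \<And>\<^sup>d\<psi>(b\<^sub>k) \<otimes> b\<^sub>k\<^sup>*\<close> of \<open>\<And>\<^sup>d S\<^bsub>3d-6\<^esub> \<otimes> (\<And>\<^sup>d S\<^sub>d)\<^sup>*\<close>, and
  \<open>\<Theta> \<otimes> \<phi>\<close> maps it to \<open>\<tau> = \<Sum>\<^sub>k G\<^sub>k \<otimes> H\<^sub>k\<close> in \<open>S\<^bsub>d(2d-5)\<^esub> \<otimes> S\<^sub>d\<close>, where \<open>G\<^sub>k = \<Theta>(\<And>\<^sup>d\<psi>(b\<^sub>k))\<close> and
  \<open>H\<^sub>k = \<phi>(b\<^sub>k\<^sup>*)\<close>. The list \<open>tau\<close> consists of the pairs \<open>(G\<^sub>k, H\<^sub>k)\<close>; the image of \<open>\<tau>\<close> under the map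
  induced by the \<open>r\<close>-th transvectant is the sum of the \<open>(G\<^sub>k, H\<^sub>k)\<^sub>r\<close>.
\<close>

definition tau :: "((form list \<Rightarrow> complex) \<Rightarrow> form) \<Rightarrow> nat \<Rightarrow> form \<Rightarrow> form \<Rightarrow> (form \<times> form) list" where
  "tau \<phi> d M N = map (\<lambda>k. (wronskian (map (psi d M N) (wedge_basis d k)),
                            \<phi> (wedge_dual_basis d k))) [0..<Suc d]"

definition Phi :: "((form list \<Rightarrow> complex) \<Rightarrow> form) \<Rightarrow> nat \<Rightarrow> nat \<Rightarrow> form \<Rightarrow> form \<Rightarrow> form" where
  "Phi \<phi> d r M N =
     (if d = 2 then 0
      else (\<Sum>(G, H) \<leftarrow> tau \<phi> d M N. transvectant (d * (2 * d - 5)) d r G H))"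


section \<open>The three conditions\<close>

definition lin_indep_pair :: "form \<Rightarrow> form \<Rightarrow> bool" where
  "lin_indep_pair A B \<longleftrightarrow> A \<noteq> B \<and> form.independent {A, B}"

definition transvectant_condition :: "nat \<Rightarrow> form \<Rightarrow> form \<Rightarrow> bool" where
  "transvectant_condition d M N \<longleftrightarrow>
     (\<exists>A \<in> forms (int d). \<exists>B \<in> forms (int d). lin_indep_pair A B \<and>
        M = transvectant d d 1 A B \<and> N = transvectant d d 3 A B)"

definition bezoutiant_condition :: "nat \<Rightarrow> form \<Rightarrow> form \<Rightarrow> bool" where
  "bezoutiant_condition d M N \<longleftrightarrow>
     (\<exists>A \<in> forms (int d). \<exists>B \<in> forms (int d). lin_indep_pair A B \<and>
        omega ^ 4 dvd bezoutiant A B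
          - (in_x (const (bez_const d 0)) * half_polar (2 * d - 2) M
             + in_x (const (bez_const d 1)) * omega ^ 2 * half_polar (2 * d - 6) N))"

definition kernel_condition :: "nat \<Rightarrow> form \<Rightarrow> form \<Rightarrow> bool" where
  "kernel_condition d M N \<longleftrightarrow> form.dim (ker_psi d M N) \<ge> 2"

end

theory Submission
  imports Defs
begin

text \<open>
  Put \<open>x0 = 1\<close>. A form of order \<open>e\<close> becomes a polynomial of degree at most \<open>e\<close> in one variable, the
  form is determined by it, and Euler's relation expresses \<open>\<partial>/\<partial>x0\<close> through the derivative. The
  transvectant \<open>(E, F)\<^sub>r\<close> becomes a combination of the products \<open>E\<^sup>(\<^sup>i\<^sup>) F\<^sup>(\<^sup>r\<^sup>-\<^sup>i\<^sup>)\<close> with constant coefficients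
  (\<open>dehom_transvectant\<close>). Lower case letters denote the polynomials that belong to forms.

  \<^bold>\<open>(i) and (iii).\<close> Up to a nonzero scalar, \<open>\<psi>\<close> is the second order operator
  \<open>f \<mapsto> m f'' - m' f' + (\<gamma> m'' - \<kappa> n) f\<close>. The order \<open>2d-2\<close> of \<open>M\<close> is the one for which the
  coefficients of \<open>m f''\<close> and \<open>-m' f'\<close> agree. Hence, by Abel's formula, the Wronskian \<open>w = a b' - a' b\<close>
  of two solutions satisfies \<open>m w' = m' w\<close>, so \<open>w = c m\<close> with a constant \<open>c\<close> (\<open>psi_ode_wronskian\<close>).
  As \<open>w\<close> is \<open>d (A, B)\<^sub>1\<close>, two independent elements \<open>A, B\<close> of the kernel have \<open>M = (A, B)\<^sub>1\<close> after a
  rescaling, and the kernel has dimension at most 2, because a third element \<open>H\<close> would give a combination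
  of \<open>B\<close> and \<open>H\<close> whose Wronskian with \<open>A\<close> vanishes. Conversely, for \<open>M = (A, B)\<^sub>1\<close> the operator maps \<open>a\<close> and \<open>b\<close> to
  their products with one and the same polynomial, which vanishes exactly if \<open>N = (A, B)\<^sub>3\<close>
  (\<open>psi_ode_pencil\<close>, \<open>psi_pencil\<close>).

  \<^bold>\<open>(i) and (ii).\<close> A polynomial that is homogeneous in \<open>y\<close> is divisible by \<open>\<omega>\<^sup>n\<close> if and only if its
  derivatives of order less than \<open>n\<close> with respect to \<open>y1\<close> vanish on the diagonal \<open>y = x\<close>
  (\<open>omega_power_dvd_iff\<close>). Multiplied by \<open>\<omega>\<close>, condition (ii) is a divisibility by \<open>\<omega>\<^sup>5\<close> and amounts to five
  equations between \<open>a, b, m, n\<close>. The first is trivial, the second says \<open>M = (A, B)\<^sub>1\<close>, the fourth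
  then says \<open>N = (A, B)\<^sub>3\<close>, and the two others follow by differentiation
  (\<open>gordan_iff_transvectants\<close>).

  \<^bold>\<open>The covariants.\<close> The tensor \<open>\<tau>\<close> is \<open>\<Sum>\<^sub>k G\<^sub>k \<otimes> H\<^sub>k\<close> with linearly independent \<open>H\<^sub>k\<close>. By
  the Clebsch-Gordan decomposition, all its transvectants vanish if and only if \<open>\<tau> = 0\<close>, that is, if all
  \<open>G\<^sub>k\<close> vanish (\<open>clebsch_gordan_injective\<close>). Now \<open>G\<^sub>k\<close> is the Wronskian of the images under \<open>\<psi>\<close> of all
  monomials except \<open>x0\<^sup>d\<^sup>-\<^sup>k x1\<^sup>k\<close>. A Wronskian vanishes exactly for dependent forms
  (\<open>wronskian_eq_0_iff\<close>), so \<open>G\<^sub>k = 0\<close> means that the kernel of \<open>\<psi>\<close> contains a nonzero form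
  without the monomial \<open>x0\<^sup>d\<^sup>-\<^sup>k x1\<^sup>k\<close>. This holds for all \<open>k\<close> if and only if the kernel has dimension at
  least 2. For \<open>d = 2\<close> the map \<open>\<psi>\<close> takes constant values, so the kernel has dimension at least 2 for
  every \<open>M\<close>, in agreement with \<open>\<Phi>\<^sub>r = 0\<close>.
\<close>


section \<open>Forms\<close>


lemma const_0: "const 0 = 0" and const_1: "const 1 = 1"
  and const_add: "const (a + b) = const a + const b"
  and const_mult: "const (a * b) = const a * const b"
  by (simp_all add: const_def one_pCons)

lemma const_power: "const (a ^ n) = const a ^ n"
  by (induction n) (simp_all add: const_1 const_mult)

lemma const_of_nat: "const (of_nat n) = of_nat n"
  by (induction n) (simp_all add: const_0 const_1 const_add)

lemma const_minus: "const (- a) = - const a"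
  by (simp add: const_def)

lemma scale_eq_const_mult: "scale c F = const c * F"
  by (simp add: scale_def const_def)

lemma forms_iff: "F \<in> forms e \<longleftrightarrow> (\<forall>i j. int i + int j \<noteq> e \<longrightarrow> coeff (coeff F j) i = 0)"
  unfolding forms_def by blast

lemma forms_0 [simp]: "0 \<in> forms e"
  by (simp add: forms_iff)

lemma forms_add: "F \<in> forms e \<Longrightarrow> G \<in> forms e \<Longrightarrow> F + G \<in> forms e"
  and forms_diff: "F \<in> forms e \<Longrightarrow> G \<in> forms e \<Longrightarrow> F - G \<in> forms e"
  and forms_minus: "F \<in> forms e \<Longrightarrow> - F \<in> forms e"
  by (simp_all add: forms_iff)

lemma forms_scale: "F \<in> forms e \<Longrightarrow> scale c F \<in> forms e"
  by (simp add: forms_iff scale_def)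

lemma forms_sum: "(\<And>i. i \<in> I \<Longrightarrow> F i \<in> forms e) \<Longrightarrow> sum F I \<in> forms e"
  by (induction I rule: infinite_finite_induct) (simp_all add: forms_add)

lemma forms_mult:
  assumes "F \<in> forms a" "G \<in> forms b" shows "F * G \<in> forms (a + b)"
  unfolding forms_iff
proof (intro allI impI)
  fix i j assume ij: "int i + int j \<noteq> a + b"
  have *: "coeff (coeff F l) k * coeff (coeff G (j - l)) (i - k) = 0" if "k \<le> i" "l \<le> j" for k l
  proof (cases "int k + int l = a")
    case True
    then have "int (i - k) + int (j - l) \<noteq> b" using ij that by auto
    then show ?thesis using assms(2) by (simp add: forms_iff)
  next
    case False
    then show ?thesis using assms(1) by (simp add: forms_iff)
  qed
  show "coeff (coeff (F * G) j) i = 0"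
    unfolding coeff_mult coeff_sum by (intro sum.neutral ballI *) auto
qed

lemma forms_1: "1 \<in> forms 0"
  by (auto simp: forms_iff one_pCons coeff_pCons split: nat.splits)

lemma forms_const: "const c \<in> forms 0"
  by (auto simp: forms_iff const_def coeff_pCons split: nat.splits)

lemma X0_forms: "X0 \<in> forms 1" and X1_forms: "X1 \<in> forms 1"
  by (auto simp: forms_iff X0_def X1_def one_pCons coeff_pCons split: nat.splits)

lemma forms_power: "F \<in> forms a \<Longrightarrow> F ^ n \<in> forms (int n * a)"
proof (induction n)
  case (Suc n)
  from forms_mult[OF Suc.prems Suc.IH[OF Suc.prems]] show ?case by (simp add: algebra_simps)
qed (simp add: forms_1)

lemma coeff_dx0: "coeff (dx0 F) j = pderiv (coeff F j)"
  by (simp add: dx0_def coeff_map_poly)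

lemma coeff_dx1: "coeff (dx1 F) j = of_nat (Suc j) * coeff F (Suc j)"
  by (simp add: dx1_def coeff_pderiv)

lemma coeff_of_nat_mult: "coeff (of_nat n * p) i = of_nat n * coeff p i"
  for p :: "'a :: comm_semiring_1 poly"
  by (induction n) (simp_all add: algebra_simps)

lemma forms_dx0: "F \<in> forms e \<Longrightarrow> dx0 F \<in> forms (e - 1)"
  by (auto simp: forms_iff coeff_dx0 coeff_pderiv)

lemma forms_dx1: "F \<in> forms e \<Longrightarrow> dx1 F \<in> forms (e - 1)"
  by (auto simp: forms_iff coeff_dx1 coeff_of_nat_mult simp del: of_nat_Suc)

lemma dx0_add: "dx0 (F + G) = dx0 F + dx0 G"
  and dx1_add: "dx1 (F + G) = dx1 F + dx1 G"
  and dx0_0 [simp]: "dx0 0 = 0" and dx1_0 [simp]: "dx1 0 = 0"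
  by (auto simp: poly_eq_iff coeff_dx0 pderiv_add dx1_def)

lemma dx0_dx1: "dx0 (dx1 F) = dx1 (dx0 F)"
  by (rule poly_eqI) (simp add: coeff_dx0 coeff_dx1 pderiv_mult pderiv_of_nat del: of_nat_Suc)

lemma forms_dx0_pow: "F \<in> forms e \<Longrightarrow> (dx0 ^^ k) F \<in> forms (e - int k)"
  by (induction k) (auto dest: forms_dx0 simp: algebra_simps)

lemma forms_dx1_pow: "F \<in> forms e \<Longrightarrow> (dx1 ^^ k) F \<in> forms (e - int k)"
  by (induction k) (auto dest: forms_dx1 simp: algebra_simps)


section \<open>Dehomogenization\<close>


definition dehom :: "form \<Rightarrow> complex poly" where
  "dehom = map_poly (\<lambda>p. poly p 1)"

lemma coeff_dehom: "coeff (dehom F) j = poly (coeff F j) 1"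
  by (simp add: dehom_def coeff_map_poly)

lemma dehom_0 [simp]: "dehom 0 = 0" and dehom_1 [simp]: "dehom 1 = 1"
  by (simp_all add: dehom_def)

lemma dehom_add: "dehom (F + G) = dehom F + dehom G"
  and dehom_diff: "dehom (F - G) = dehom F - dehom G"
  by (simp_all add: poly_eq_iff coeff_dehom)

lemma dehom_mult: "dehom (F * G) = dehom F * dehom G"
  by (simp add: poly_eq_iff coeff_dehom coeff_mult poly_sum)

lemma dehom_scale: "dehom (scale c F) = smult c (dehom F)"
  by (simp add: poly_eq_iff coeff_dehom scale_def)

lemma dehom_const: "dehom (const c) = [:c:]"
  by (simp add: dehom_def const_def map_poly_pCons)

lemma dehom_sum: "dehom (sum F I) = (\<Sum>i\<in>I. dehom (F i))"
  by (induction I rule: infinite_finite_induct) (simp_all add: dehom_add)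

lemma dehom_power: "dehom (F ^ n) = dehom F ^ n"
  by (induction n) (simp_all add: dehom_mult)

lemma dehom_of_nat: "dehom (of_nat n) = of_nat n"
  by (induction n) (simp_all add: dehom_add)

lemma dehom_X0: "dehom X0 = 1" and dehom_X1: "dehom X1 = [:0, 1:]"
  by (simp_all add: dehom_def X0_def X1_def map_poly_pCons one_pCons)

lemma comm_ring_hom_dehom: "comm_ring_hom dehom"
  by unfold_locales (simp_all add: dehom_add dehom_mult)

lemma forms_coeff_monom:
  assumes "F \<in> forms e"
  shows "coeff F j = (if int j \<le> e then monom (coeff (dehom F) j) (nat (e - int j)) else 0)"
proof -
  have *: "coeff F j = (if int j \<le> e then monom (coeff (coeff F j) (nat (e - int j))) (nat (e - int j)) else 0)"
    using assms by (intro poly_eqI) (auto simp: forms_iff)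
  have "coeff (dehom F) j = coeff (coeff F j) (nat (e - int j))" if "int j \<le> e"
    unfolding coeff_dehom using that by (subst *) (simp add: poly_monom)
  then show ?thesis by (subst *) simp
qed

lemma dehom_eq_0_iff: "F \<in> forms e \<Longrightarrow> dehom F = 0 \<longleftrightarrow> F = 0"
  using poly_eqI[of F 0] by (auto simp: forms_coeff_monom)

lemma dehom_eq_iff: "F \<in> forms e \<Longrightarrow> G \<in> forms e \<Longrightarrow> dehom F = dehom G \<longleftrightarrow> F = G"
  using dehom_eq_0_iff[OF forms_diff, of F e G] by (simp add: dehom_diff)

lemma degree_dehom_le:
  assumes "F \<in> forms (int e)" shows "degree (dehom F) \<le> e"
proof (rule degree_le, intro allI impI)
  fix j assume "j > e"
  then have "coeff F j = 0" using forms_coeff_monom[OF assms, of j] by simp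
  then show "coeff (dehom F) j = 0" by (simp add: coeff_dehom)
qed

lemma dehom_dx1: "dehom (dx1 F) = pderiv (dehom F)"
  by (rule poly_eqI) (simp add: coeff_dehom coeff_dx1 coeff_pderiv)

text \<open>
  Euler's relation \<open>x0 \<partial>\<^sub>0F + x1 \<partial>\<^sub>1F = e F\<close> on the line \<open>x0 = 1\<close>.
\<close>

lemma dehom_dx0:
  assumes "F \<in> forms e"
  shows "dehom (dx0 F) = of_int e * dehom F - [:0, 1:] * pderiv (dehom F)"
proof (rule poly_eqI)
  fix j
  have c: "coeff F j = (if int j \<le> e then monom (coeff (dehom F) j) (nat (e - int j)) else 0)"
    using forms_coeff_monom[OF assms] .
  have "coeff (dehom (dx0 F)) j = (of_int e - of_nat j) * coeff (dehom F) j"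
  proof (cases "int j \<le> e")
    case True
    then have "of_nat (nat (e - int j)) = (of_int e - of_nat j :: complex)"
      by (simp add: of_nat_nat)
    then show ?thesis using True c
      by (simp add: coeff_dehom[of "dx0 F"] coeff_dx0 pderiv_monom poly_monom)
  next
    case False
    then have "coeff F j = 0" using c by simp
    then show ?thesis by (simp add: coeff_dehom coeff_dx0)
  qed
  moreover have "coeff (of_int e * dehom F) j = of_int e * coeff (dehom F) j"
    by (simp add: of_int_poly)
  moreover have "coeff ([:0, 1:] * pderiv (dehom F)) j = of_nat j * coeff (dehom F) j"
    by (cases j) (simp_all add: coeff_pderiv)
  ultimately show "coeff (dehom (dx0 F)) j = coeff (of_int e * dehom F - [:0, 1:] * pderiv (dehom F)) j"
    by (simp add: algebra_simps)
qed

lemma higher_pderiv_of_nat_mult: "(pderiv ^^ k) (of_nat n * p) = of_nat n * (pderiv ^^ k) p"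
  for p :: "complex poly"
  by (simp add: of_nat_poly higher_pderiv_smult)

lemma higher_pderiv_X_mult:
  "(pderiv ^^ k) ([:0, 1:] * p) = [:0, 1:] * (pderiv ^^ k) p + of_nat k * (pderiv ^^ (k - 1)) p"
  for p :: "complex poly"
proof (induction k)
  case (Suc k)
  show ?case
  proof (cases k)
    case 0
    then show ?thesis by (simp add: pderiv_mult pderiv_pCons)
  next
    case (Suc l)
    with Suc.IH show ?thesis
      by (simp add: pderiv_add pderiv_mult pderiv_pCons pderiv_of_nat algebra_simps)
  qed
qed simp

lemma higher_pderiv_diff: "(pderiv ^^ k) (p - q) = (pderiv ^^ k) p - (pderiv ^^ k) q"
  for p :: "complex poly"
  by (induction k) (simp_all add: pderiv_diff)

lemma higher_pderiv_dehom_dx0: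
  assumes "F \<in> forms (int e)" "i < e"
  shows "(pderiv ^^ i) (dehom (dx0 F)) =
    of_nat (e - i) * (pderiv ^^ i) (dehom F) - [:0, 1:] * (pderiv ^^ Suc i) (dehom F)"
proof -
  have "(pderiv ^^ i) (dehom (dx0 F)) = (pderiv ^^ i) (of_nat e * dehom F - [:0,1:] * pderiv (dehom F))"
    using dehom_dx0[OF assms(1)] by simp
  also have "\<dots> = of_nat e * (pderiv ^^ i) (dehom F) -
     ([:0, 1:] * (pderiv ^^ i) (pderiv (dehom F)) + of_nat i * (pderiv ^^ (i - 1)) (pderiv (dehom F)))"
    by (simp only: higher_pderiv_diff higher_pderiv_of_nat_mult higher_pderiv_X_mult)
  also have "of_nat i * (pderiv ^^ (i - 1)) (pderiv (dehom F)) = of_nat i * (pderiv ^^ i) (dehom F)"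
    by (cases i) (simp_all add: funpow_swap1)
  also have "(pderiv ^^ i) (pderiv (dehom F)) = (pderiv ^^ Suc i) (dehom F)"
    by (simp add: funpow_swap1)
  finally show ?thesis
    using assms(2) by (simp add: of_nat_diff algebra_simps)
qed

section \<open>Transvectants\<close>


text \<open>
  A binomial sum of the terms \<open>g i - g (Suc i)\<close> is a binomial sum of the next order. The two
  explicit formulas below are proved by induction on the order, and this identity is the induction step of both.
\<close>

lemma alternating_pascal:
  fixes g :: "nat \<Rightarrow> 'a :: comm_ring_1"
  shows "(\<Sum>i\<le>Suc r. (-1) ^ i * of_nat (Suc r choose i) * g i) =
         (\<Sum>i\<le>r. (-1) ^ i * of_nat (r choose i) * (g i - g (Suc i)))"
proof -
  have "(\<Sum>i\<le>Suc r. (-1) ^ i * of_nat (Suc r choose i) * g i) =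
     g 0 + (\<Sum>i\<le>r. (-1) ^ Suc i * of_nat (Suc r choose Suc i) * g (Suc i))"
    by (subst sum.atMost_Suc_shift) simp
  also have "\<dots> = g 0 + (\<Sum>i\<le>r. (-1) ^ Suc i * of_nat (r choose Suc i) * g (Suc i))
     - (\<Sum>i\<le>r. (-1) ^ i * of_nat (r choose i) * g (Suc i))"
    by (simp add: algebra_simps sum.distrib sum_negf sum_subtractf)
  also have "g 0 + (\<Sum>i\<le>r. (-1) ^ Suc i * of_nat (r choose Suc i) * g (Suc i)) =
     (\<Sum>i\<le>Suc r. (-1) ^ i * of_nat (r choose i) * g i)"
    by (subst sum.atMost_Suc_shift) simp
  also have "\<dots> = (\<Sum>i\<le>r. (-1) ^ i * of_nat (r choose i) * g i)"
    by (simp add: binomial_eq_0)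
  finally show ?thesis
    by (simp add: algebra_simps sum_subtractf)
qed

text \<open>
  The transvectant without its normalizing factor: Cayley's operator
  \<open>(\<partial>/\<partial>x0 \<partial>/\<partial>y1 - \<partial>/\<partial>x1 \<partial>/\<partial>y0)\<^sup>r\<close> applied to \<open>E(x) F(y)\<close>, followed by \<open>y = x\<close>. The factors of
  this power can be applied one after the other, which gives the recursion \<open>omega_process_Suc\<close>.
\<close>

definition omega_process :: "nat \<Rightarrow> form \<Rightarrow> form \<Rightarrow> form" where
  "omega_process r E F = (\<Sum>i\<le>r. scale ((-1) ^ i * of_nat (r choose i))
     ((dx0 ^^ (r - i)) ((dx1 ^^ i) E) * (dx0 ^^ i) ((dx1 ^^ (r - i)) F)))"

lemma omega_process_ring:
  "omega_process r E F = (\<Sum>i\<le>r. (-1) ^ i * of_nat (r choose i) *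
     ((dx0 ^^ (r - i)) ((dx1 ^^ i) E) * (dx0 ^^ i) ((dx1 ^^ (r - i)) F)))"
  by (simp add: omega_process_def scale_eq_const_mult const_mult const_power const_minus const_1
      const_of_nat)

lemma omega_process_Suc:
  "omega_process (Suc r) E F = omega_process r (dx0 E) (dx1 F) - omega_process r (dx1 E) (dx0 F)"
proof -
  have "(dx0 ^^ (Suc r - i)) ((dx1 ^^ i) E) = (dx0 ^^ (r - i)) ((dx1 ^^ i) (dx0 E))"
    if "i \<le> r" for i E
  proof -
    have "(dx1 ^^ i) (dx0 E) = dx0 ((dx1 ^^ i) E)"
      by (induction i) (simp_all add: dx0_dx1)
    then show ?thesis using that by (simp add: Suc_diff_le funpow_swap1)
  qed
  moreover have "(dx1 ^^ (Suc r - i)) F = (dx1 ^^ (r - i)) (dx1 F)" if "i \<le> r" for i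
    using that by (simp add: Suc_diff_le funpow_swap1)
  moreover have "(dx1 ^^ i) (dx0 F) = dx0 ((dx1 ^^ i) F)" for i F
    by (induction i) (simp_all add: dx0_dx1)
  ultimately show ?thesis
    unfolding omega_process_ring alternating_pascal sum_subtractf[symmetric]
    by (intro sum.cong refl) (simp add: algebra_simps funpow_swap1)
qed

text \<open>
  In the recursion, \<open>\<partial>\<^sub>0\<close> is replaced by \<open>e - x1 d/dx1\<close>. The terms with the factor \<open>x1\<close> cancel in
  \<open>\<partial>\<^sub>0E \<partial>\<^sub>1F - \<partial>\<^sub>1E \<partial>\<^sub>0F\<close> already before the summation, so only constant coefficients remain.
\<close>

lemma dehom_omega_process:
  assumes "E \<in> forms (int e)" "F \<in> forms (int f)" "r \<le> e" "r \<le> f"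
  shows "fact (e - r) * fact (f - r) * dehom (omega_process r E F) =
    (\<Sum>i\<le>r. (-1) ^ i * of_nat (r choose i) * (fact (e - i) * fact (f - r + i) *
       ((pderiv ^^ i) (dehom E) * (pderiv ^^ (r - i)) (dehom F))))"
  using assms
proof (induction r arbitrary: e f E F)
  case 0
  then show ?case by (simp add: omega_process_ring dehom_mult)
next
  case (Suc r)
  obtain e' f' where ef: "e = Suc e'" "f = Suc f'"
    using Suc.prems by (metis Suc_le_D)
  have r: "r \<le> e'" "r \<le> f'" using Suc.prems ef by auto
  have m: "dx0 E \<in> forms (int e')" "dx1 E \<in> forms (int e')"
    "dx0 F \<in> forms (int f')" "dx1 F \<in> forms (int f')"
    using forms_dx0[OF Suc.prems(1)] forms_dx1[OF Suc.prems(1)]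
      forms_dx0[OF Suc.prems(2)] forms_dx1[OF Suc.prems(2)] ef by simp_all
  let ?D = "\<lambda>i p. (pderiv ^^ i) p :: complex poly"
  define g where "g i = fact (e - i) * fact (f - Suc r + i) * (?D i (dehom E) * ?D (Suc r - i) (dehom F))" for i
  have step: "fact (e' - i) * fact (f' - r + i) * (?D i (dehom (dx0 E)) * ?D (r - i) (dehom (dx1 F)))
      - fact (e' - i) * fact (f' - r + i) * (?D i (dehom (dx1 E)) * ?D (r - i) (dehom (dx0 F)))
      = g i - g (Suc i)" if "i \<le> r" for i
  proof -
    have 1: "?D i (dehom (dx0 E)) = of_nat (e - i) * ?D i (dehom E) - [:0, 1:] * ?D (Suc i) (dehom E)"
      using Suc.prems ef that by (intro higher_pderiv_dehom_dx0) auto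
    have 2: "?D (r - i) (dehom (dx0 F)) = of_nat (f - (r - i)) * ?D (r - i) (dehom F)
        - [:0, 1:] * ?D (Suc (r - i)) (dehom F)"
      using Suc.prems ef that by (intro higher_pderiv_dehom_dx0) auto
    have 3: "?D i (dehom (dx1 E)) = ?D (Suc i) (dehom E)" "?D (r - i) (dehom (dx1 F)) = ?D (Suc (r - i)) (dehom F)"
      by (simp_all add: dehom_dx1 funpow_swap1)
    have 4: "fact (e - i) = of_nat (e - i) * (fact (e' - i) :: complex poly)"
      using ef r that by (simp add: Suc_diff_le)
    have 5: "f - Suc r + Suc i = Suc (f' - r + i)" "f - (r - i) = Suc (f' - r + i)"
      "f - Suc r + i = f' - r + i" "e - Suc i = e' - i" "Suc r - i = Suc (r - i)"
      "Suc r - Suc i = r - i"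
      using ef r that by auto
    show ?thesis
      unfolding g_def 1 2 3 4 5 fact_Suc by (simp add: algebra_simps)
  qed
  have "fact (e - Suc r) * fact (f - Suc r) * dehom (omega_process (Suc r) E F)
     = fact (e' - r) * fact (f' - r) * dehom (omega_process r (dx0 E) (dx1 F))
     - fact (e' - r) * fact (f' - r) * dehom (omega_process r (dx1 E) (dx0 F))"
    using ef by (simp add: omega_process_Suc dehom_diff algebra_simps)
  also have "\<dots> = (\<Sum>i\<le>r. (-1) ^ i * of_nat (r choose i) * (g i - g (Suc i)))"
    unfolding Suc.IH[OF m(1,4) r] Suc.IH[OF m(2,3) r] sum_subtractf[symmetric]
  proof (intro sum.cong refl)
    fix i assume "i \<in> {..r}"
    then show "(-1) ^ i * of_nat (r choose i) * (fact (e' - i) * fact (f' - r + i) *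
        (?D i (dehom (dx0 E)) * ?D (r - i) (dehom (dx1 F)))) -
      (-1) ^ i * of_nat (r choose i) * (fact (e' - i) * fact (f' - r + i) *
        (?D i (dehom (dx1 E)) * ?D (r - i) (dehom (dx0 F)))) =
      (-1) ^ i * of_nat (r choose i) * (g i - g (Suc i))"
      using step[of i] by (simp only: right_diff_distrib[symmetric] atMost_iff)
  qed
  also have "\<dots> = (\<Sum>i\<le>Suc r. (-1) ^ i * of_nat (Suc r choose i) * g i)"
    by (rule alternating_pascal[symmetric])
  finally show ?case
    unfolding g_def .
qed

lemma smult_sum_right: "smult c (sum f I) = (\<Sum>i\<in>I. smult c (f i))"
  by (induction I rule: infinite_finite_induct) (simp_all add: smult_add_right)

lemma dehom_transvectant:
  assumes "E \<in> forms (int e)" "F \<in> forms (int f)" "r \<le> e" "r \<le> f"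
  shows "dehom (transvectant e f r E F) = (\<Sum>i\<le>r. smult
    ((-1) ^ i * of_nat (r choose i) * (fact (e - i) * fact (f - r + i) / (fact e * fact f)))
       ((pderiv ^^ i) (dehom E) * (pderiv ^^ (r - i)) (dehom F)))"
proof -
  have fp: "fact n = [:fact n:]" for n :: nat
    by (metis of_nat_fact of_nat_poly)
  have "transvectant e f r E F =
      scale ((fact (e - r) * fact (f - r)) / (fact e * fact f)) (omega_process r E F)"
    using assms(3,4) unfolding transvectant_def omega_process_def by simp
  then have "dehom (transvectant e f r E F) = smult (1 / (fact e * fact f))
      (fact (e - r) * fact (f - r) * dehom (omega_process r E F))"
    unfolding fp by (simp add: dehom_scale mult.commute)
  also have "\<dots> = (\<Sum>i\<le>r. smult
    ((-1) ^ i * of_nat (r choose i) * (fact (e - i) * fact (f - r + i) / (fact e * fact f)))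
       ((pderiv ^^ i) (dehom E) * (pderiv ^^ (r - i)) (dehom F)))"
    unfolding dehom_omega_process[OF assms] smult_sum_right
  proof (intro sum.cong refl)
    fix i
    have "(-1) ^ i * of_nat (r choose i) = [:(-1) ^ i * of_nat (r choose i) :: complex:]"
      by (cases "even i") (simp_all add: of_nat_poly)
    then show "smult (1 / (fact e * fact f)) ((- 1) ^ i * of_nat (r choose i) *
          (fact (e - i) * fact (f - r + i) * ((pderiv ^^ i) (dehom E) * (pderiv ^^ (r - i)) (dehom F)))) =
      smult ((- 1) ^ i * of_nat (r choose i) * (fact (e - i) * fact (f - r + i) / (fact e * fact f)))
           ((pderiv ^^ i) (dehom E) * (pderiv ^^ (r - i)) (dehom F))"
      unfolding fp by (simp add: field_simps)
  qed
  finally show ?thesis .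
qed

lemma forms_omega_process:
  assumes "E \<in> forms e" "F \<in> forms f"
  shows "omega_process r E F \<in> forms (e + f - 2 * int r)"
  using assms
proof (induction r arbitrary: e f E F)
  case 0
  then show ?case by (simp add: omega_process_ring forms_mult)
next
  case (Suc r)
  have "omega_process r (dx0 E) (dx1 F) \<in> forms ((e - 1) + (f - 1) - 2 * int r)"
       "omega_process r (dx1 E) (dx0 F) \<in> forms ((e - 1) + (f - 1) - 2 * int r)"
    using Suc.IH Suc.prems forms_dx0 forms_dx1 by blast+
  from forms_diff[OF this] show ?case by (simp add: omega_process_Suc algebra_simps)
qed

lemma forms_transvectant:
  assumes "E \<in> forms (int e)" "F \<in> forms (int f)"
  shows "transvectant e f r E F \<in> forms (int e + int f - 2 * int r)"
  using forms_omega_process[OF assms]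
  by (simp add: transvectant_def omega_process_def[symmetric] forms_scale)

section \<open>Wronskians\<close>


lemma det_eq_0_iff_column_relation:
  fixes a :: "nat \<Rightarrow> nat \<Rightarrow> 'a :: idom"
  shows "det (mat n n (\<lambda>(i, j). a i j)) = 0 \<longleftrightarrow>
    (\<exists>v. (\<exists>j<n. v j \<noteq> 0) \<and> (\<forall>i<n. (\<Sum>j<n. a i j * v j) = 0))"
proof -
  let ?A = "mat n n (\<lambda>(i, j). a i j)"
  have prod: "(?A *\<^sub>v v) $ i = (\<Sum>j<n. a i j * v $ j)" if "v \<in> carrier_vec n" "i < n" for v i
    using that by (simp add: scalar_prod_def lessThan_atLeast0)
  have "det ?A = 0 \<longleftrightarrow> (\<exists>v. v \<in> carrier_vec n \<and> v \<noteq> 0\<^sub>v n \<and> ?A *\<^sub>v v = 0\<^sub>v n)"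
    by (rule det_0_iff_vec_prod_zero) simp
  also have "\<dots> \<longleftrightarrow> (\<exists>v. (\<exists>j<n. v j \<noteq> 0) \<and> (\<forall>i<n. (\<Sum>j<n. a i j * v j) = 0))"
  proof safe
    fix v assume v: "v \<in> carrier_vec n" "v \<noteq> 0\<^sub>v n" "?A *\<^sub>v v = 0\<^sub>v n"
    have "\<exists>j<n. v $ j \<noteq> 0"
    proof (rule ccontr)
      assume "\<not> (\<exists>j<n. v $ j \<noteq> 0)"
      then have "v = 0\<^sub>v n" using v(1) by (intro eq_vecI) auto
      with v(2) show False ..
    qed
    moreover have "\<forall>i<n. (\<Sum>j<n. a i j * v $ j) = 0"
      using prod[OF v(1)] v(3) by simp
    ultimately show "\<exists>v. (\<exists>j<n. v j \<noteq> 0) \<and> (\<forall>i<n. (\<Sum>j<n. a i j * v j) = 0)"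
      by blast
  next
    fix v j assume v: "\<forall>i<n. (\<Sum>j<n. a i j * v j) = 0" and j: "j < n" "v j \<noteq> 0"
    have "vec n v \<noteq> 0\<^sub>v n" using j by (metis index_vec index_zero_vec(1))
    moreover have "?A *\<^sub>v vec n v = 0\<^sub>v n"
    proof (rule eq_vecI)
      fix i assume "i < dim_vec (0\<^sub>v n :: 'a vec)"
      then show "(?A *\<^sub>v vec n v) $ i = 0\<^sub>v n $ i"
        using prod[of "vec n v" i] v by simp
    qed simp
    ultimately show "\<exists>v. v \<in> carrier_vec n \<and> v \<noteq> 0\<^sub>v n \<and> ?A *\<^sub>v v = 0\<^sub>v n"
      by (intro exI[of _ "vec n v"]) simp
  qed
  finally show ?thesis .
qed

lemma det_eq_0_iff_row_relation:
  fixes a :: "nat \<Rightarrow> nat \<Rightarrow> 'a :: idom"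
  shows "det (mat n n (\<lambda>(i, j). a i j)) = 0 \<longleftrightarrow>
    (\<exists>v. (\<exists>i<n. v i \<noteq> 0) \<and> (\<forall>j<n. (\<Sum>i<n. v i * a i j) = 0))"
proof -
  have comm: "(\<Sum>i<n. a i j * v i) = (\<Sum>i<n. v i * a i j)" for v j
    by (intro sum.cong refl mult.commute)
  have "det (mat n n (\<lambda>(i, j). a i j)) = det (transpose_mat (mat n n (\<lambda>(i, j). a i j)))"
    by (rule det_transpose[symmetric, of _ n]) simp
  also have "transpose_mat (mat n n (\<lambda>(i, j). a i j)) = mat n n (\<lambda>(i, j). a j i)"
    by (rule eq_matI) auto
  finally show ?thesis
    by (simp only: det_eq_0_iff_column_relation[of n "\<lambda>i j. a j i"] comm)
qed

text \<open>
  Each differentiation of \<open>(z - a)\<^sup>k g\<close> lowers the exponent by one and multiplies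
  the value of the cofactor at \<open>a\<close> by a nonzero integer, as long as the exponent is positive.
\<close>

lemma higher_pderiv_root_power:
  fixes g :: "complex poly"
  assumes "s \<le> k"
  shows "\<exists>r. (pderiv ^^ s) ([:- a, 1:] ^ k * g) = [:- a, 1:] ^ (k - s) * r \<and>
           (poly g a \<noteq> 0 \<longrightarrow> poly r a \<noteq> 0)"
  using assms
proof (induction s)
  case (Suc s)
  then obtain r where r: "(pderiv ^^ s) ([:- a, 1:] ^ k * g) = [:- a, 1:] ^ (k - s) * r"
    "poly g a \<noteq> 0 \<longrightarrow> poly r a \<noteq> 0" by auto
  obtain m where m: "k - s = Suc m" "k - Suc s = m"
    using Suc.prems by (metis Suc_diff_Suc Suc_le_lessD)
  have "(pderiv ^^ Suc s) ([:- a, 1:] ^ k * g) = pderiv ([:- a, 1:] ^ Suc m * r)"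
    using r(1) m(1) by simp
  also have "\<dots> = [:- a, 1:] ^ m * (of_nat (Suc m) * r + [:- a, 1:] * pderiv r)"
  proof -
    have 1: "pderiv [:- a, 1:] = 1" by (simp add: pderiv_pCons)
    show ?thesis
      unfolding pderiv_mult pderiv_power_Suc 1 by (simp add: of_nat_poly algebra_simps)
  qed
  finally have "(pderiv ^^ Suc s) ([:- a, 1:] ^ k * g) =
      [:- a, 1:] ^ m * (of_nat (Suc m) * r + [:- a, 1:] * pderiv r)" .
  moreover have "poly (of_nat (Suc m) * r + [:- a, 1:] * pderiv r) a = of_nat (Suc m) * poly r a"
    by (simp add: of_nat_poly)
  ultimately show ?case
    using r(2) by (metis m(2) mult_eq_0_iff of_nat_eq_0_iff Zero_not_Suc)
qed auto

text \<open>
  A solution of a linear differential equation that has zero initial data at a point where the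
  leading coefficient does not vanish is zero: in \<open>\<Sum>\<^sub>j v\<^sub>j f\<^sup>(\<^sup>j\<^sup>)\<close> only the term with \<open>j = n\<close> has the
  smallest possible order of vanishing at \<open>a\<close>, so it cannot be cancelled.
\<close>

lemma differential_operator_zero_initial_data:
  fixes f :: "complex poly" and v :: "nat \<Rightarrow> complex poly"
  assumes "n < q" and "\<And>j. n < j \<Longrightarrow> j < q \<Longrightarrow> v j = 0" and "poly (v n) a \<noteq> 0"
    and "(\<Sum>j<q. (pderiv ^^ j) f * v j) = 0"
    and "\<And>j. j < q \<Longrightarrow> poly ((pderiv ^^ j) f) a = 0"
  shows "f = 0"
proof (rule ccontr)
  assume "f \<noteq> 0"
  \<comment> \<open>the initial data force \<open>k \<ge> q > n\<close>\<close>
  define k where "k = order a f"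
  obtain g where g: "f = [:- a, 1:] ^ k * g" "\<not> [:- a, 1:] dvd g"
    using order_decomp[OF \<open>f \<noteq> 0\<close>] k_def by blast
  then have ga: "poly g a \<noteq> 0" by (simp add: poly_eq_0_iff_dvd)
  have "\<not> k < q"
  proof
    assume "k < q"
    obtain r where "(pderiv ^^ k) f = [:- a, 1:] ^ (k - k) * r" "poly r a \<noteq> 0"
      using higher_pderiv_root_power[of k k a g] g(1) ga by auto
    then show False using assms(5)[OF \<open>k < q\<close>] by simp
  qed
  have "\<forall>j. \<exists>r. j \<le> n \<longrightarrow> (pderiv ^^ j) f = [:- a, 1:] ^ (k - j) * r \<and> poly r a \<noteq> 0"
    using higher_pderiv_root_power[of _ k a g] g(1) ga \<open>\<not> k < q\<close> assms(1)
    by (metis le_trans less_imp_le not_le_imp_less)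
  then obtain r where r: "\<And>j. j \<le> n \<Longrightarrow> (pderiv ^^ j) f = [:- a, 1:] ^ (k - j) * r j"
    "\<And>j. j \<le> n \<Longrightarrow> poly (r j) a \<noteq> 0" by metis
  have "(\<Sum>j<q. (pderiv ^^ j) f * v j) = (\<Sum>j\<le>n. (pderiv ^^ j) f * v j)"
    using assms(1,2) by (intro sum.mono_neutral_right) auto
  also have "\<dots> = (\<Sum>j\<le>n. [:- a, 1:] ^ (k - n) * ([:- a, 1:] ^ (n - j) * r j * v j))"
  proof (intro sum.cong refl)
    fix j assume "j \<in> {..n}"
    then have j: "k - j = (k - n) + (n - j)" "j \<le> n" using \<open>\<not> k < q\<close> assms(1) by auto
    show "(pderiv ^^ j) f * v j = [:- a, 1:] ^ (k - n) * ([:- a, 1:] ^ (n - j) * r j * v j)"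
      unfolding r(1)[OF j(2)] j(1) power_add by (simp only: mult.assoc)
  qed
  also have "\<dots> = [:- a, 1:] ^ (k - n) * (\<Sum>j\<le>n. [:- a, 1:] ^ (n - j) * r j * v j)"
    by (simp add: sum_distrib_left)
  finally have "(\<Sum>j\<le>n. [:- a, 1:] ^ (n - j) * r j * v j) = 0"
    using assms(4) by simp
  then have "poly (\<Sum>j\<le>n. [:- a, 1:] ^ (n - j) * r j * v j) a = 0" by simp
  moreover have "poly (\<Sum>j\<le>n. [:- a, 1:] ^ (n - j) * r j * v j) a =
      (\<Sum>j\<in>{n}. 0 ^ (n - j) * poly (r j) a * poly (v j) a)"
    unfolding poly_sum by (intro sum.mono_neutral_cong_right) auto
  ultimately show False using r(2)[of n] assms(3) by simp
qed

lemma comm_ring_hom_poly_eval: "comm_ring_hom (\<lambda>p :: complex poly. poly p a)"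
  by unfold_locales simp_all

lemma higher_pderiv_linear_combination:
  "(pderiv ^^ k) (\<Sum>i<q. smult (c i) (f i)) = (\<Sum>i<q. smult (c i) ((pderiv ^^ k) (f i)))"
  for f :: "nat \<Rightarrow> complex poly"
  by (simp add: higher_pderiv_sum higher_pderiv_smult)

text \<open>
  If the determinant vanishes, a relation between its columns is a differential equation of order
  less than \<open>q\<close> that all \<open>f\<^sub>i\<close> satisfy, and at a point \<open>a\<close> where its leading coefficient does not
  vanish, a relation between the rows of the evaluated matrix gives a combination of the \<open>f\<^sub>i\<close>
  with zero initial data. By uniqueness this combination is zero.
\<close>

theorem wronskian_poly_eq_0_imp_dependent:
  fixes f :: "nat \<Rightarrow> complex poly"
  assumes "det (mat q q (\<lambda>(i, j). (pderiv ^^ j) (f i))) = 0"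
  shows "\<exists>c. (\<exists>i<q. c i \<noteq> 0) \<and> (\<Sum>i<q. smult (c i) (f i)) = 0"
proof -
  obtain v where v: "\<exists>j<q. v j \<noteq> 0" "\<And>i. i < q \<Longrightarrow> (\<Sum>j<q. (pderiv ^^ j) (f i) * v j) = 0"
    using assms det_eq_0_iff_column_relation[of q "\<lambda>i j. (pderiv ^^ j) (f i)"] by blast
  \<comment> \<open>the order of the differential equation with the coefficients \<open>v j\<close>\<close>
  define n where "n = Max {j. j < q \<and> v j \<noteq> 0}"
  have fin: "finite {j. j < q \<and> v j \<noteq> 0}" by simp
  have n: "n < q" "v n \<noteq> 0" using Max_in[OF fin] v(1) n_def by auto
  have top: "v j = 0" if "n < j" "j < q" for j
  proof (rule ccontr)
    assume "v j \<noteq> 0"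
    then have "j \<le> n" unfolding n_def using that by (intro Max_ge[OF fin]) simp
    then show False using that by simp
  qed
  obtain a where a: "poly (v n) a \<noteq> 0" using n(2) poly_all_0_iff_0 by blast
  interpret ev: comm_ring_hom "\<lambda>p :: complex poly. poly p a" by (rule comm_ring_hom_poly_eval)
  have "det (mat q q (\<lambda>(i, j). poly ((pderiv ^^ j) (f i)) a)) =
      det (map_mat (\<lambda>p. poly p a) (mat q q (\<lambda>(i, j). (pderiv ^^ j) (f i))))"
    by (rule arg_cong[of _ _ det], rule eq_matI) auto
  also have "\<dots> = 0" using assms by simp
  finally obtain c where c: "\<exists>i<q. c i \<noteq> 0"
    "\<And>j. j < q \<Longrightarrow> (\<Sum>i<q. c i * poly ((pderiv ^^ j) (f i)) a) = 0"
    unfolding det_eq_0_iff_row_relation by blast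
  have "(\<Sum>i<q. smult (c i) (f i)) = 0"
  proof (rule differential_operator_zero_initial_data[where v = v and n = n and q = q and a = a, OF n(1) _ a])
    have "(\<Sum>j<q. (pderiv ^^ j) (\<Sum>i<q. smult (c i) (f i)) * v j) =
        (\<Sum>i<q. smult (c i) (\<Sum>j<q. (pderiv ^^ j) (f i) * v j))"
      unfolding higher_pderiv_linear_combination smult_sum_right sum_distrib_right
      by (subst sum.swap) simp
    then show "(\<Sum>j<q. (pderiv ^^ j) (\<Sum>i<q. smult (c i) (f i)) * v j) = 0"
      using v(2) by simp
  next
    fix j assume "n < j" "j < q"
    then show "v j = 0" by (rule top)
  next
    fix j assume "j < q"
    then show "poly ((pderiv ^^ j) (\<Sum>i<q. smult (c i) (f i))) a = 0"
      using c(2) by (simp add: higher_pderiv_linear_combination poly_sum)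
  qed
  with c(1) show ?thesis by blast
qed

lemma wronskian_poly_eq_0_iff:
  fixes f :: "nat \<Rightarrow> complex poly"
  shows "det (mat q q (\<lambda>(i, j). (pderiv ^^ j) (f i))) = 0 \<longleftrightarrow>
     (\<exists>c. (\<exists>i<q. c i \<noteq> 0) \<and> (\<Sum>i<q. smult (c i) (f i)) = 0)"
proof
  assume "\<exists>c. (\<exists>i<q. c i \<noteq> 0) \<and> (\<Sum>i<q. smult (c i) (f i)) = 0"
  then obtain c where c: "\<exists>i<q. c i \<noteq> 0" "(\<Sum>i<q. smult (c i) (f i)) = 0" by blast
  have "(\<Sum>i<q. [:c i:] * (pderiv ^^ j) (f i)) = 0" for j
    using higher_pderiv_linear_combination[of j c f q] c(2) by simp
  then show "det (mat q q (\<lambda>(i, j). (pderiv ^^ j) (f i))) = 0"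
    unfolding det_eq_0_iff_row_relation using c(1) by (intro exI[of _ "\<lambda>i. [:c i:]"]) auto
qed (rule wronskian_poly_eq_0_imp_dependent)

text \<open>
  Iterated Euler relation. It shows that \<open>\<partial>\<^sub>0\<^sup>k G\<close> involves the derivatives of order \<open>0, \<dots>, k\<close> of the
  polynomial of \<open>G\<close>, the one of order 0 with a nonzero constant.
\<close>

lemma dehom_dx0_pow:
  assumes "G \<in> forms (int g)" "k \<le> g"
  shows "fact (g - k) * dehom ((dx0 ^^ k) G) = (\<Sum>l\<le>k. (-1) ^ l * of_nat (k choose l) *
     ([:0, 1:] ^ l * (fact (g - l) * (pderiv ^^ l) (dehom G))))"
  using assms
proof (induction k arbitrary: g G)
  case (Suc k)
  obtain g' where g: "g = Suc g'" using Suc.prems by (metis Suc_le_D)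
  have m: "dx0 G \<in> forms (int g')" using forms_dx0[OF Suc.prems(1)] g by simp
  define h where "h l = [:0, 1:] ^ l * (fact (g - l) * (pderiv ^^ l) (dehom G))" for l
  have step: "[:0, 1:] ^ l * (fact (g' - l) * (pderiv ^^ l) (dehom (dx0 G))) = h l - h (Suc l)"
    if "l \<le> k" for l
  proof -
    have 1: "(pderiv ^^ l) (dehom (dx0 G)) =
       of_nat (g - l) * (pderiv ^^ l) (dehom G) - [:0, 1:] * (pderiv ^^ Suc l) (dehom G)"
      using Suc.prems g that by (intro higher_pderiv_dehom_dx0) auto
    have 2: "fact (g - l) = of_nat (g - l) * (fact (g' - l) :: complex poly)" "g - Suc l = g' - l"
      using g that Suc.prems by (simp_all add: Suc_diff_le)
    show ?thesis unfolding h_def 1 2 power_Suc by (simp only: algebra_simps)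
  qed
  have "fact (g - Suc k) * dehom ((dx0 ^^ Suc k) G) = fact (g' - k) * dehom ((dx0 ^^ k) (dx0 G))"
    using g by (simp add: funpow_swap1)
  also have "\<dots> = (\<Sum>l\<le>k. (-1) ^ l * of_nat (k choose l) * (h l - h (Suc l)))"
    using Suc.prems g by (subst Suc.IH[OF m]) (auto intro!: sum.cong simp only: step atMost_iff)
  also have "\<dots> = (\<Sum>l\<le>Suc k. (-1) ^ l * of_nat (Suc k choose l) * h l)"
    by (rule alternating_pascal[symmetric])
  finally show ?case unfolding h_def .
qed simp

lemma prod_list_neq_0: "(\<And>x. x \<in> set xs \<Longrightarrow> x \<noteq> 0) \<Longrightarrow> prod_list xs \<noteq> (0 :: 'a :: idom)"
  by (induction xs) auto

lemma forms_prod: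
  "finite I \<Longrightarrow> (\<And>i. i \<in> I \<Longrightarrow> F i \<in> forms e) \<Longrightarrow> prod F I \<in> forms (int (card I) * e)"
proof (induction I rule: finite_induct)
  case (insert x I)
  then have "F x * prod F I \<in> forms (e + int (card I) * e)"
    by (intro forms_mult) auto
  with insert.hyps show ?case by (simp add: algebra_simps)
qed (simp add: forms_1)

lemma forms_wronskian:
  assumes "length Fs = q" "\<And>i. i < q \<Longrightarrow> Fs ! i \<in> forms (int p)"
  shows "wronskian Fs \<in> forms (int q * (int p - int q + 1))"
proof -
  let ?a = "\<lambda>i j. (dx0 ^^ (q - 1 - j)) ((dx1 ^^ j) (Fs ! i))"
  have e: "?a i j \<in> forms (int p - int q + 1)" if "i < q" "j < q" for i j
  proof -
    have "?a i j \<in> forms (int p - int j - int (q - 1 - j))"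
      using assms(2) that by (intro forms_dx0_pow forms_dx1_pow) auto
    then show ?thesis using that by (simp add: of_nat_diff algebra_simps)
  qed
  have "wronskian Fs = (\<Sum>\<pi> \<in> {\<pi>. \<pi> permutes {0..<q}}. signof \<pi> *
      (\<Prod>i = 0..<q. mat q q (\<lambda>(i, j). ?a i j) $$ (i, \<pi> i)))"
    unfolding wronskian_def using assms(1) by (simp add: Let_def det_def'[of _ q])
  also have "\<dots> \<in> forms (int q * (int p - int q + 1))"
  proof (rule forms_sum)
    fix \<pi> assume \<pi>: "\<pi> \<in> {\<pi>. \<pi> permutes {0..<q}}"
    have "(\<Prod>i = 0..<q. mat q q (\<lambda>(i, j). ?a i j) $$ (i, \<pi> i)) \<in>
        forms (int (card {0..<q}) * (int p - int q + 1))"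
    proof (rule forms_prod)
      fix i assume "i \<in> {0..<q}"
      moreover from this \<pi> have "\<pi> i < q" using permutes_in_image by fastforce
      ultimately show "mat q q (\<lambda>(i, j). ?a i j) $$ (i, \<pi> i) \<in> forms (int p - int q + 1)"
        using e by simp
    qed simp
    then show "signof \<pi> * (\<Prod>i = 0..<q. mat q q (\<lambda>(i, j). ?a i j) $$ (i, \<pi> i)) \<in>
        forms (int q * (int p - int q + 1))"
      by (auto simp: sign_def forms_minus)
  qed
  finally show ?thesis .
qed

text \<open>
  By Euler's relation, the matrix of the mixed partial derivatives is, on \<open>x0 = 1\<close>, the usual Wronskian
  matrix times a triangular matrix whose diagonal entries are nonzero constants.
\<close>

lemma wronskian_eq_0_iff_dehom:
  assumes "length Fs = q" "\<And>i. i < q \<Longrightarrow> Fs ! i \<in> forms (int p)" "q \<le> p + 1"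
  shows "wronskian Fs = 0 \<longleftrightarrow> det (mat q q (\<lambda>(i, j). (pderiv ^^ j) (dehom (Fs ! i)))) = 0"
proof -
  let ?W = "mat q q (\<lambda>(i, j). (pderiv ^^ j) (dehom (Fs ! i)))"
  \<comment> \<open>the coefficient of the \<open>s\<close>-th derivative in the \<open>j\<close>-th column, by \<open>dehom_dx0_pow\<close>\<close>
  define c where "c s j = (if s < j then 0 else
    smult (1 / fact (p + 1 - q)) ((-1) ^ (s - j) * of_nat (q - 1 - j choose (s - j)) *
      ([:0, 1:] ^ (s - j) * fact (p - s))) :: complex poly)" for s j
  let ?C = "mat q q (\<lambda>(s, j). c s j)"
  have fp: "fact n = [:fact n :: complex:]" for n :: nat
    by (metis of_nat_fact of_nat_poly)
  have entry: "dehom ((dx0 ^^ (q - 1 - j)) ((dx1 ^^ j) (Fs ! i))) =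
      (\<Sum>s<q. (pderiv ^^ s) (dehom (Fs ! i)) * c s j)" if ij: "i < q" "j < q" for i j
  proof -
    let ?k = "q - 1 - j" and ?f = "dehom (Fs ! i)"
    have G: "(dx1 ^^ j) (Fs ! i) \<in> forms (int (p - j))"
      using forms_dx1_pow[OF assms(2)[OF ij(1)], of j] ij assms(3) by (simp add: of_nat_diff)
    have aG: "dehom ((dx1 ^^ j) (Fs ! i)) = (pderiv ^^ j) ?f"
      by (induction j) (simp_all add: dehom_dx1)
    have "p - j - ?k = p + 1 - q" using ij assms(3) by auto
    moreover have "?k \<le> p - j" using ij assms(3) by auto
    ultimately have "fact (p + 1 - q) * dehom ((dx0 ^^ ?k) ((dx1 ^^ j) (Fs ! i))) =
        (\<Sum>l\<le>?k. (-1) ^ l * of_nat (?k choose l) *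
     ([:0, 1:] ^ l * (fact (p - j - l) * (pderiv ^^ l) ((pderiv ^^ j) ?f))))"
      using dehom_dx0_pow[OF G, of ?k] by (simp only: aG)
    then have eq: "[:fact (p + 1 - q):] * dehom ((dx0 ^^ ?k) ((dx1 ^^ j) (Fs ! i))) =
        (\<Sum>l\<le>?k. (-1) ^ l * of_nat (?k choose l) *
     ([:0, 1:] ^ l * (fact (p - j - l) * (pderiv ^^ l) ((pderiv ^^ j) ?f))))"
      unfolding fp[of "p + 1 - q"] .
    have inv: "X = smult (1 / c) S" if "[:c:] * X = S" "c \<noteq> 0" for c :: complex and X S
      using that by auto
    have "dehom ((dx0 ^^ ?k) ((dx1 ^^ j) (Fs ! i))) = smult (1 / fact (p + 1 - q))
       (\<Sum>l\<le>?k. (-1) ^ l * of_nat (?k choose l) *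
     ([:0, 1:] ^ l * (fact (p - j - l) * (pderiv ^^ l) ((pderiv ^^ j) ?f))))"
      by (rule inv[OF eq fact_nonzero])
    also have "\<dots> = (\<Sum>l\<le>?k. (pderiv ^^ (l + j)) ?f * c (l + j) j)"
      unfolding smult_sum_right c_def
      by (intro sum.cong refl) (simp add: funpow_add algebra_simps)
    also have "\<dots> = (\<Sum>s\<in>{j..<q}. (pderiv ^^ s) ?f * c s j)"
      using ij by (intro sum.reindex_bij_witness[of _ "\<lambda>s. s - j" "\<lambda>l. l + j"]) auto
    also have "\<dots> = (\<Sum>s<q. (pderiv ^^ s) ?f * c s j)"
      by (intro sum.mono_neutral_left) (auto simp: c_def)
    finally show ?thesis .
  qed
  interpret dehom: comm_ring_hom dehom by (rule comm_ring_hom_dehom)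
  have "dehom (wronskian Fs) = det (map_mat dehom (mat q q (\<lambda>(i, j). (dx0 ^^ (q - 1 - j)) ((dx1 ^^ j) (Fs ! i)))))"
    unfolding wronskian_def using assms(1) by (simp add: Let_def)
  also have "map_mat dehom (mat q q (\<lambda>(i, j). (dx0 ^^ (q - 1 - j)) ((dx1 ^^ j) (Fs ! i)))) = ?W * ?C"
    by (rule eq_matI) (simp_all add: entry[unfolded diff_diff_left plus_1_eq_Suc] scalar_prod_def
        lessThan_atLeast0)
  also have "det (?W * ?C) = det ?W * det ?C"
    by (rule det_mult) auto
  finally have *: "dehom (wronskian Fs) = det ?W * det ?C" .
  have "det ?C = prod_list (diag_mat ?C)"
    by (rule det_lower_triangular[of q]) (auto simp: c_def)
  also have "\<dots> \<noteq> 0"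
    by (rule prod_list_neq_0) (auto simp: diag_mat_def c_def)
  finally have "dehom (wronskian Fs) = 0 \<longleftrightarrow> det ?W = 0" using * by simp
  then show ?thesis
    using dehom_eq_0_iff[OF forms_wronskian[OF assms(1,2)]] by simp
qed

lemma dehom_linear_combination: "dehom (\<Sum>i<q. scale (c i) (F i)) = (\<Sum>i<q. smult (c i) (dehom (F i)))"
  by (simp add: dehom_sum dehom_scale)

theorem wronskian_eq_0_iff:
  assumes "length Fs = q" "\<And>i. i < q \<Longrightarrow> Fs ! i \<in> forms (int p)" "q \<le> p + 1"
  shows "wronskian Fs = 0 \<longleftrightarrow> (\<exists>c. (\<exists>i<q. c i \<noteq> 0) \<and> (\<Sum>i<q. scale (c i) (Fs ! i)) = 0)"
proof -
  have *: "(\<Sum>i<q. scale (c i) (Fs ! i)) = 0 \<longleftrightarrow> (\<Sum>i<q. smult (c i) (dehom (Fs ! i))) = 0" for c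
    unfolding dehom_linear_combination[symmetric]
    by (subst dehom_eq_0_iff) (auto intro!: forms_sum forms_scale assms(2))
  have "wronskian Fs = 0 \<longleftrightarrow> det (mat q q (\<lambda>(i, j). (pderiv ^^ j) (dehom (Fs ! i)))) = 0"
    by (rule wronskian_eq_0_iff_dehom) (use assms in auto)
  then show ?thesis
    by (simp only: wronskian_poly_eq_0_iff *)
qed

section \<open>The map \<open>\<psi>\<close> as a differential operator\<close>


lemma complex_nat_diff_nonzero: "k < d \<Longrightarrow> complex_of_nat d - of_nat k \<noteq> 0"
  by simp

lemma double_minus_3_nonzero: "2 * complex_of_nat d - 3 \<noteq> 0"
proof
  assume "2 * complex_of_nat d - 3 = 0"
  then have "complex_of_nat (2 * d) = complex_of_nat 3" by simp
  then have "2 * d = 3" by (simp only: of_nat_eq_iff)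
  then show False by presburger
qed

lemma smult_eq_iff: "c \<noteq> 0 \<Longrightarrow> smult c p = q \<longleftrightarrow> p = smult (1 / c) q" for c :: complex
  by auto

lemma smult_cancel_iff: "c \<noteq> 0 \<Longrightarrow> smult c p = smult c q \<longleftrightarrow> p = q" for c :: complex
  using smult_eq_0_iff[of c "p - q"] by (auto simp: smult_diff_right)

lemma dehom_transvectant_1:
  assumes "A \<in> forms (int d)" "B \<in> forms (int d)" "1 \<le> d"
  shows "dehom (transvectant d d 1 A B) =
    smult (1 / of_nat d) (dehom A * pderiv (dehom B) - pderiv (dehom A) * dehom B)"
proof -
  obtain k where d: "d = Suc k" using assms(3) by (metis One_nat_def Suc_le_D)
  have f: "(fact (Suc k) :: complex) = of_nat (Suc k) * fact k" by simp
  have "(fact (Suc k) * fact k / (fact (Suc k) * fact (Suc k)) :: complex) = 1 / of_nat (Suc k)"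
    "(fact k * fact (Suc k) / (fact (Suc k) * fact (Suc k)) :: complex) = 1 / of_nat (Suc k)"
    unfolding f by (simp_all del: of_nat_Suc fact_Suc)
  then show ?thesis
    using dehom_transvectant[OF assms(1,2), of 1] d
    by (simp add: smult_diff_right del: fact_Suc)
qed

text \<open>
  The operator that \<open>d (d-1) \<psi>\<close> induces on the polynomials of the forms, where \<open>m\<close> and \<open>n\<close> are the
  polynomials of \<open>M\<close> and \<open>N\<close>.
\<close>

definition psi_ode :: "nat \<Rightarrow> complex poly \<Rightarrow> complex poly \<Rightarrow> complex poly \<Rightarrow> complex poly" where
  "psi_ode d m n f = m * pderiv (pderiv f) - pderiv m * pderiv f
     + smult (of_nat d / (2 * (2 * of_nat d - 3))) (pderiv (pderiv m) * f)
     - smult (of_nat d * (of_nat d - 1) * (of_nat d - 2) / (2 * (2 * of_nat d - 3))) (n * f)"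

lemma psi_ode_add: "psi_ode d m n (f + g) = psi_ode d m n f + psi_ode d m n g"
  by (simp add: psi_ode_def pderiv_add algebra_simps smult_add_right)

lemma psi_ode_smult: "psi_ode d m n (smult c f) = smult c (psi_ode d m n f)"
  by (simp add: psi_ode_def pderiv_smult smult_add_right smult_diff_right mult.commute)

lemma psi_ode_sum: "psi_ode d m n (sum f I) = (\<Sum>i\<in>I. psi_ode d m n (f i))"
proof (induction I rule: infinite_finite_induct)
  case (insert x I)
  then show ?case by (simp add: psi_ode_add)
qed (simp_all add: psi_ode_def)

text \<open>
  In the second transvectant the terms \<open>m f''\<close> and \<open>m' f'\<close> have the coefficients \<open>1 / (d (d-1))\<close> and
  \<open>-2 / ((2d-2) d)\<close>, which are opposite to each other.
\<close>

lemma dehom_psi: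
  assumes "2 \<le> d" "M \<in> forms (2 * int d - 2)" "F \<in> forms (int d)"
  shows "dehom (psi d M N F) =
    smult (1 / (of_nat d * (of_nat d - 1))) (psi_ode d (dehom M) (dehom N) (dehom F))"
proof -
  obtain k where "d = 2 + k" using assms(1) le_Suc_ex by blast
  then have d: "d = Suc (Suc k)" by simp
  define \<delta> where "\<delta> = complex_of_nat d"
  have nz: "\<delta> \<noteq> 0" "\<delta> - 1 \<noteq> 0" "2 * \<delta> - 3 \<noteq> 0"
    using complex_nat_diff_nonzero[of 0 d] complex_nat_diff_nonzero[of 1 d]
      double_minus_3_nonzero[of d] assms(1)
    unfolding \<delta>_def by simp_all
  have "4 * \<delta> - 6 = 2 * (2 * \<delta> - 3)" "2 * \<delta> - 2 = 2 * (\<delta> - 1)" by simp_all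
  then have nz': "4 * \<delta> - 6 \<noteq> 0" "2 * \<delta> - 2 \<noteq> 0" using nz by (simp_all only: mult_eq_0_iff) simp_all
  have M: "M \<in> forms (int (2 * d - 2))" using assms(1,2) by (simp add: of_nat_diff)
  have e: "2 * d - 2 = Suc (Suc (2 * k))" "2 * d - 2 - 1 = Suc (2 * k)" "2 * d - 2 - 2 = 2 * k"
    "d - 2 = k" "d - 2 + 1 = Suc k" "d - 2 + 2 = Suc (Suc k)"
    using d by auto
  have ke: "of_nat k = \<delta> - 2" unfolding \<delta>_def d by simp
  have fd: "(fact (Suc (Suc k)) :: complex) = \<delta> * (\<delta> - 1) * fact k"
    "(fact (Suc k) :: complex) = (\<delta> - 1) * fact k"
    by (simp_all add: ke algebra_simps)
  have fe: "(fact (Suc (Suc (2 * k))) :: complex) = (2 * \<delta> - 2) * (2 * \<delta> - 3) * fact (2 * k)"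
    "(fact (Suc (2 * k)) :: complex) = (2 * \<delta> - 3) * fact (2 * k)"
    by (simp_all add: ke algebra_simps)
  have f: "(fact (2 * d - 2) :: complex) = (2 * \<delta> - 2) * (2 * \<delta> - 3) * fact (2 * k)"
    "(fact (2 * d - 2 - 1) :: complex) = (2 * \<delta> - 3) * fact (2 * k)"
    "(fact (2 * d - 2 - 2) :: complex) = fact (2 * k)"
    "(fact d :: complex) = \<delta> * (\<delta> - 1) * fact k"
    "(fact (d - 2) :: complex) = fact k"
    "(fact (d - 2 + 1) :: complex) = (\<delta> - 1) * fact k"
    "(fact (d - 2 + 2) :: complex) = \<delta> * (\<delta> - 1) * fact k"
    unfolding e(2) e(3) e(5) e(6) unfolding e(1) e(4) fe fd(2) by (simp_all only: d fd)
  have c0: "(fact (2 * d - 2) * fact (d - 2) / (fact (2 * d - 2) * fact d) :: complex) =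
      1 / (\<delta> * (\<delta> - 1))"
    unfolding f using nz nz' by simp
  have c1: "(fact (2 * d - 2 - 1) * fact (d - 2 + 1) / (fact (2 * d - 2) * fact d) :: complex) =
      1 / (2 * (\<delta> * (\<delta> - 1)))"
    unfolding f using nz nz' by (simp add: divide_simps)
  have c2: "(fact (2 * d - 2 - 2) * fact (d - 2 + 2) / (fact (2 * d - 2) * fact d) :: complex) =
      1 / ((2 * \<delta> - 2) * (2 * \<delta> - 3))"
    unfolding f using nz nz' by simp
  have "dehom (transvectant (2 * d - 2) d 2 M F) =
      smult (1 / (\<delta> * (\<delta> - 1))) (dehom M * pderiv (pderiv (dehom F)))
      - smult (1 / (\<delta> * (\<delta> - 1))) (pderiv (dehom M) * pderiv (dehom F))
      + smult (1 / ((2 * \<delta> - 2) * (2 * \<delta> - 3))) (pderiv (pderiv (dehom M)) * dehom F)"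
  proof -
    have s: "(\<Sum>i\<le>2::nat. g i) = g 0 + g 1 + g 2" for g :: "nat \<Rightarrow> complex poly"
      by (simp add: numeral_2_eq_2)
    have h: "2 \<le> 2 * d - 2" "2 \<le> d" using assms(1) by auto
    show ?thesis
      unfolding dehom_transvectant[OF M assms(3) h] s
      by (simp only: diff_zero add_0_right c0 c1 c2) (simp add: numeral_2_eq_2)
  qed
  moreover have "dehom (scale ((of_nat d - 2) / (4 * of_nat d - 6)) (N * F)) =
      smult ((\<delta> - 2) / (4 * \<delta> - 6)) (dehom N * dehom F)"
    by (simp add: dehom_scale dehom_mult \<delta>_def)
  moreover have "1 / ((2 * \<delta> - 2) * (2 * \<delta> - 3)) = 1 / (\<delta> * (\<delta> - 1)) * (\<delta> / (2 * (2 * \<delta> - 3)))"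
    using nz nz' by (simp add: divide_simps) (simp add: algebra_simps)
  moreover have "(\<delta> - 2) / (4 * \<delta> - 6) =
      1 / (\<delta> * (\<delta> - 1)) * (\<delta> * (\<delta> - 1) * (\<delta> - 2) / (2 * (2 * \<delta> - 3)))"
    using nz nz' by (simp add: divide_simps)
  ultimately show ?thesis
    unfolding psi_def psi_ode_def dehom_diff \<delta>_def[symmetric]
    by (simp only: smult_diff_right smult_add_right smult_smult)
qed

lemma forms_psi:
  assumes "2 \<le> d" "M \<in> forms (2 * int d - 2)" "N \<in> forms (2 * int d - 6)" "F \<in> forms (int d)"
  shows "psi d M N F \<in> forms (3 * int d - 6)"
proof -
  have "M \<in> forms (int (2 * d - 2))" using assms(1,2) by (simp add: of_nat_diff)
  from forms_transvectant[OF this assms(4), of 2]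
  have "transvectant (2 * d - 2) d 2 M F \<in> forms (3 * int d - 6)"
    using assms(1) by (simp add: of_nat_diff algebra_simps)
  moreover have "N * F \<in> forms (3 * int d - 6)"
    using forms_mult[OF assms(3,4)] by (simp add: algebra_simps)
  ultimately show ?thesis unfolding psi_def by (intro forms_diff forms_scale)
qed

lemma psi_eq_0_iff:
  assumes "2 \<le> d" "M \<in> forms (2 * int d - 2)" "N \<in> forms (2 * int d - 6)" "F \<in> forms (int d)"
  shows "psi d M N F = 0 \<longleftrightarrow> psi_ode d (dehom M) (dehom N) (dehom F) = 0"
  unfolding dehom_eq_0_iff[OF forms_psi[OF assms], symmetric] dehom_psi[OF assms(1,2,4)]
  using complex_nat_diff_nonzero[of 0 d] complex_nat_diff_nonzero[of 1 d] assms(1)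
  by simp

text \<open>
  The scalar on the left is the one with which \<open>N\<close> enters \<open>psi_ode_pencil\<close>. It vanishes for \<open>d = 2\<close>,
  and so does the right-hand side, since third derivatives of quadratic polynomials are zero and the
  coefficient of the first summand is 0.
\<close>

lemma dehom_transvectant_3:
  assumes "2 \<le> d" "A \<in> forms (int d)" "B \<in> forms (int d)"
  shows "smult (of_nat d * (of_nat d * (of_nat d - 1) * (of_nat d - 2) / (2 * (2 * of_nat d - 3))))
      (dehom (transvectant d d 3 A B)) =
    smult (of_nat d / (2 * (2 * of_nat d - 3)) - 1)
      (pderiv (dehom A) * pderiv (pderiv (dehom B)) - pderiv (pderiv (dehom A)) * pderiv (dehom B)) +
    smult (of_nat d / (2 * (2 * of_nat d - 3)))
      (dehom A * pderiv (pderiv (pderiv (dehom B))) - pderiv (pderiv (pderiv (dehom A))) * dehom B)"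
proof (cases "d = 2")
  case True
  have "pderiv (pderiv (pderiv (dehom F))) = 0" if "F \<in> forms (int d)" for F
  proof -
    have "degree (pderiv (pderiv (dehom F))) = 0"
      using degree_dehom_le[OF that] True by (simp add: degree_pderiv)
    then show ?thesis by (simp add: pderiv_eq_0_iff)
  qed
  then show ?thesis using True assms by simp
next
  case False
  define \<delta> where "\<delta> = complex_of_nat d"
  have d3: "3 \<le> d" using False assms(1) by simp
  then obtain k where "d = 3 + k" using le_Suc_ex by blast
  then have d: "d = Suc (Suc (Suc k))" by simp
  have nz: "\<delta> \<noteq> 0" "\<delta> - 1 \<noteq> 0" "\<delta> - 2 \<noteq> 0" "2 * \<delta> - 3 \<noteq> 0"
    using complex_nat_diff_nonzero[of 0 d] complex_nat_diff_nonzero[of 1 d]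
      complex_nat_diff_nonzero[of 2 d] double_minus_3_nonzero[of d] d3
    unfolding \<delta>_def by simp_all
  have ke: "of_nat k = \<delta> - 3" unfolding \<delta>_def d by simp
  have fd: "(fact (Suc (Suc (Suc k))) :: complex) = \<delta> * (\<delta> - 1) * (\<delta> - 2) * fact k"
    "(fact (Suc (Suc k)) :: complex) = (\<delta> - 1) * (\<delta> - 2) * fact k"
    "(fact (Suc k) :: complex) = (\<delta> - 2) * fact k"
    by (simp_all add: ke algebra_simps)
  have e: "d - 1 = Suc (Suc k)" "d - 2 = Suc k" "d - 3 = k" "d - 3 + 1 = Suc k"
    "d - 3 + 2 = Suc (Suc k)" using d by auto
  have f: "(fact d :: complex) = \<delta> * (\<delta> - 1) * (\<delta> - 2) * fact k"
    "(fact (d - 1) :: complex) = (\<delta> - 1) * (\<delta> - 2) * fact k"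
    "(fact (d - 2) :: complex) = (\<delta> - 2) * fact k"
    "(fact (d - 3) :: complex) = fact k"
    "(fact (d - 3 + 1) :: complex) = (\<delta> - 2) * fact k"
    "(fact (d - 3 + 2) :: complex) = (\<delta> - 1) * (\<delta> - 2) * fact k"
    unfolding e(4) e(5) unfolding e(1-3) fd(2,3) by (simp_all only: d fd)
  have c0: "(fact d * fact (d - 3) / (fact d * fact d) :: complex) = 1 / (\<delta> * (\<delta> - 1) * (\<delta> - 2))"
    "(fact (d - 3) * fact d / (fact d * fact d) :: complex) = 1 / (\<delta> * (\<delta> - 1) * (\<delta> - 2))"
    unfolding f using nz by simp_all
  have c1: "(fact (d - 1) * fact (d - 3 + 1) / (fact d * fact d) :: complex) = 1 / (\<delta> * \<delta> * (\<delta> - 1))"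
    "(fact (d - 2) * fact (d - 3 + 2) / (fact d * fact d) :: complex) = 1 / (\<delta> * \<delta> * (\<delta> - 1))"
    unfolding f using nz by simp_all
  have s: "(\<Sum>i\<le>3::nat. g i) = g 0 + g 1 + g 2 + g 3" for g :: "nat \<Rightarrow> complex poly"
    by (simp add: numeral_3_eq_3 numeral_2_eq_2)
  let ?a = "dehom A" and ?b = "dehom B"
  have D: "(pderiv ^^ 2) f = pderiv (pderiv f)" "(pderiv ^^ 3) f = pderiv (pderiv (pderiv f))"
    for f :: "complex poly" by (simp_all add: numeral_eq_Suc)
  have b: "3 choose 2 = (3::nat)" by (simp add: numeral_eq_Suc)
  have "dehom (transvectant d d 3 A B) =
      smult (1 / (\<delta> * (\<delta> - 1) * (\<delta> - 2))) (?a * pderiv (pderiv (pderiv ?b)))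
      - smult (3 * (1 / (\<delta> * \<delta> * (\<delta> - 1)))) (pderiv ?a * pderiv (pderiv ?b))
      + smult (3 * (1 / (\<delta> * \<delta> * (\<delta> - 1)))) (pderiv (pderiv ?a) * pderiv ?b)
      - smult (1 / (\<delta> * (\<delta> - 1) * (\<delta> - 2))) (pderiv (pderiv (pderiv ?a)) * ?b)"
    unfolding dehom_transvectant[OF assms(2,3) d3 d3] s
    using c0 c1 d3 by (simp add: D b)
  moreover have "\<delta> * (\<delta> * (\<delta> - 1) * (\<delta> - 2) / (2 * (2 * \<delta> - 3))) * (1 / (\<delta> * (\<delta> - 1) * (\<delta> - 2))) =
      \<delta> / (2 * (2 * \<delta> - 3))"
    using nz by (simp add: divide_simps)
  moreover have "\<delta> * (\<delta> * (\<delta> - 1) * (\<delta> - 2) / (2 * (2 * \<delta> - 3))) * (3 * (1 / (\<delta> * \<delta> * (\<delta> - 1)))) =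
      - (\<delta> / (2 * (2 * \<delta> - 3)) - 1)"
    using nz by (simp add: divide_simps)
  ultimately show ?thesis
    unfolding \<delta>_def[symmetric]
    by (simp only: smult_diff_right smult_add_right smult_smult)
       (simp add: smult_diff_left algebra_simps)
qed

text \<open>
  For \<open>m = w = a b' - a' b\<close> the terms \<open>m a'' - m' a'\<close> collapse to \<open>-a q\<close>, and \<open>m'' = p + q\<close>, so that
  the operator maps \<open>a\<close> to a multiple of \<open>a\<close>. The operator is linear in the pair \<open>(m, n)\<close>, and an exchange of
  \<open>a\<close> and \<open>b\<close> changes the signs of \<open>w\<close>, \<open>p\<close> and \<open>q\<close>, so the factor for \<open>b\<close> is the same.
\<close>

lemma psi_ode_pencil:
  fixes a b n :: "complex poly" and d :: nat
  defines "\<gamma> \<equiv> of_nat d / (2 * (2 * of_nat d - 3))"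
    and "\<kappa> \<equiv> of_nat d * (of_nat d - 1) * (of_nat d - 2) / (2 * (2 * of_nat d - 3))"
    and "p \<equiv> a * pderiv (pderiv (pderiv b)) - pderiv (pderiv (pderiv a)) * b"
    and "q \<equiv> pderiv a * pderiv (pderiv b) - pderiv (pderiv a) * pderiv b"
    and "w \<equiv> a * pderiv b - pderiv a * b"
  shows "psi_ode d w n a = a * (smult (\<gamma> - 1) q + smult \<gamma> p - smult \<kappa> n)"
    and "psi_ode d w n b = b * (smult (\<gamma> - 1) q + smult \<gamma> p - smult \<kappa> n)"
proof -
  have w': "pderiv w = a * pderiv (pderiv b) - pderiv (pderiv a) * b"
    unfolding w_def by (simp add: pderiv_diff pderiv_mult algebra_simps)
  have w'': "pderiv (pderiv w) = p + q"
    unfolding w' p_def q_def by (simp add: pderiv_diff pderiv_mult algebra_simps)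
  have "w * pderiv (pderiv a) - pderiv w * pderiv a = - (a * q)"
       "w * pderiv (pderiv b) - pderiv w * pderiv b = - (b * q)"
    unfolding w' unfolding w_def q_def by (simp_all add: algebra_simps)
  then show "psi_ode d w n a = a * (smult (\<gamma> - 1) q + smult \<gamma> p - smult \<kappa> n)"
    "psi_ode d w n b = b * (smult (\<gamma> - 1) q + smult \<gamma> p - smult \<kappa> n)"
    unfolding psi_ode_def w'' \<gamma>_def[symmetric] \<kappa>_def[symmetric]
    by (simp_all add: algebra_simps smult_add_right smult_diff_left)
qed

lemma wronskian_pair_eq_0_imp_dependent:
  fixes f g :: "complex poly"
  assumes "f * pderiv g = pderiv f * g"
  shows "\<exists>\<alpha> \<beta>. (\<alpha> \<noteq> 0 \<or> \<beta> \<noteq> 0) \<and> smult \<alpha> f + smult \<beta> g = 0"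
proof (cases "f = 0")
  case True
  then show ?thesis by (intro exI[of _ 1] exI[of _ 0]) simp
next
  case False
  define h where "h i = (if i = 0 then f else g)" for i :: nat
  have two: "(\<Sum>j<2. r j) = r 0 + r 1" for r :: "nat \<Rightarrow> complex poly"
    by (simp add: numeral_2_eq_2)
  have "det (mat 2 2 (\<lambda>(i, j). (pderiv ^^ j) (h i))) = 0"
    unfolding det_eq_0_iff_column_relation two
    using False assms
    by (intro exI[of _ "\<lambda>j. if j = 0 then - pderiv f else f"]) (auto simp: h_def algebra_simps)
  from wronskian_poly_eq_0_imp_dependent[OF this] obtain c :: "nat \<Rightarrow> complex"
    where c: "\<exists>i<2. c i \<noteq> 0" "smult (c 0) f + smult (c 1) g = 0"
    unfolding two by (auto simp: h_def)
  have "c 0 \<noteq> 0 \<or> c 1 \<noteq> 0" using c(1) less_2_cases by fastforce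
  with c(2) show ?thesis by blast
qed

text \<open>
  Abel's formula: the equation gives \<open>m w' = m' w\<close> for the Wronskian \<open>w\<close> of two solutions, that is,
  the Wronskian of \<open>m\<close> and \<open>w\<close> vanishes.
\<close>

lemma psi_ode_wronskian:
  assumes "m \<noteq> 0" "psi_ode d m n f = 0" "psi_ode d m n g = 0"
  shows "\<exists>c. f * pderiv g - pderiv f * g = smult c m"
proof -
  let ?w = "f * pderiv g - pderiv f * g"
  have w': "pderiv ?w = f * pderiv (pderiv g) - pderiv (pderiv f) * g"
    by (simp add: pderiv_diff pderiv_mult algebra_simps)
  have "m * pderiv ?w - pderiv m * ?w = f * psi_ode d m n g - g * psi_ode d m n f"
    unfolding w' psi_ode_def by (simp add: algebra_simps)
  then have "m * pderiv ?w = pderiv m * ?w" using assms(2,3) by simp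
  from wronskian_pair_eq_0_imp_dependent[OF this] obtain \<alpha> \<beta>
    where ab: "\<alpha> \<noteq> 0 \<or> \<beta> \<noteq> 0" "smult \<alpha> m + smult \<beta> ?w = 0" by blast
  have "\<beta> \<noteq> 0" using ab assms(1) by auto
  have "smult \<beta> ?w = smult (- \<alpha>) m"
    using ab(2) by (simp add: eq_neg_iff_add_eq_0 add.commute)
  then have "smult (1 / \<beta>) (smult \<beta> ?w) = smult (1 / \<beta>) (smult (- \<alpha>) m)" by simp
  then have "?w = smult (- \<alpha> / \<beta>) m" using \<open>\<beta> \<noteq> 0\<close> by simp
  then show ?thesis by blast
qed

section \<open>Pencils and kernels\<close>


lemma lin_indep_pair_iff:
  "lin_indep_pair A B \<longleftrightarrow> (\<forall>\<alpha> \<beta>. scale \<alpha> A + scale \<beta> B = 0 \<longrightarrow> \<alpha> = 0 \<and> \<beta> = 0)"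
proof
  assume l: "lin_indep_pair A B"
  show "\<forall>\<alpha> \<beta>. scale \<alpha> A + scale \<beta> B = 0 \<longrightarrow> \<alpha> = 0 \<and> \<beta> = 0"
  proof (intro allI impI)
    fix \<alpha> \<beta> assume ab: "scale \<alpha> A + scale \<beta> B = 0"
    define u where "u X = (if X = A then \<alpha> else \<beta>)" for X
    have "(\<Sum>v\<in>{A, B}. scale (u v) v) = 0"
      using l ab by (auto simp: lin_indep_pair_def u_def)
    from form.independentD[OF _ _ _ this, of "{A, B}"]
    have "u A = 0" "u B = 0" using l by (auto simp: lin_indep_pair_def)
    then show "\<alpha> = 0 \<and> \<beta> = 0" using l by (auto simp: u_def lin_indep_pair_def)
  qed
next
  assume r: "\<forall>\<alpha> \<beta>. scale \<alpha> A + scale \<beta> B = 0 \<longrightarrow> \<alpha> = 0 \<and> \<beta> = 0"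
  have "A \<noteq> B" using r[rule_format, of 1 "-1"] by (auto simp: form.scale_minus_left)
  moreover have "form.independent {A, B}"
    unfolding form.independent_explicit_finite_subsets
  proof (intro allI impI ballI)
    fix S u v
    assume S: "S \<subseteq> {A, B}" "finite S" "(\<Sum>v\<in>S. scale (u v) v) = 0" "v \<in> S"
    define u' where "u' X = (if X \<in> S then u X else 0)" for X
    have "(\<Sum>v\<in>{A, B}. scale (u' v) v) = (\<Sum>v\<in>S. scale (u v) v)"
      using S(1) by (intro sum.mono_neutral_cong_right) (auto simp: u'_def scale_def)
    then have "scale (u' A) A + scale (u' B) B = 0" using S(3) \<open>A \<noteq> B\<close> by simp
    then have "u' A = 0" "u' B = 0" using r by auto
    then show "u v = 0" using S(1,4) by (auto simp: u'_def split: if_splits)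
  qed
  ultimately show "lin_indep_pair A B" by (simp add: lin_indep_pair_def)
qed

lemma lin_indep_pair_wronskian:
  assumes "A \<in> forms e" "B \<in> forms e" "lin_indep_pair A B"
  shows "dehom A * pderiv (dehom B) - pderiv (dehom A) * dehom B \<noteq> 0"
proof
  assume "dehom A * pderiv (dehom B) - pderiv (dehom A) * dehom B = 0"
  then obtain \<alpha> \<beta> where ab: "\<alpha> \<noteq> 0 \<or> \<beta> \<noteq> 0" "smult \<alpha> (dehom A) + smult \<beta> (dehom B) = 0"
    using wronskian_pair_eq_0_imp_dependent[of "dehom A" "dehom B"] by auto
  then have "dehom (scale \<alpha> A + scale \<beta> B) = 0" by (simp add: dehom_add dehom_scale)
  then have "scale \<alpha> A + scale \<beta> B = 0"
    by (subst (asm) dehom_eq_0_iff) (auto intro: forms_add forms_scale assms)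
  with ab(1) assms(3) show False unfolding lin_indep_pair_iff by blast
qed

locale form_pair =
  fixes d :: nat and M N :: form
  assumes d: "2 \<le> d" and M: "M \<in> forms (2 * int d - 2)" and N: "N \<in> forms (2 * int d - 6)"
    and M_nz: "M \<noteq> 0"
begin

lemma ker_psi_iff: "F \<in> ker_psi d M N \<longleftrightarrow>
    F \<in> forms (int d) \<and> psi_ode d (dehom M) (dehom N) (dehom F) = 0"
  unfolding ker_psi_def using psi_eq_0_iff[OF d M N] by auto

lemma dehom_M_nz: "dehom M \<noteq> 0"
  using dehom_eq_0_iff[OF M] M_nz by simp

text \<open>
  If \<open>w(a, b) = c m\<close> and \<open>w(a, h) = c' m\<close>, then \<open>c h - c' b\<close> has Wronskian 0 with \<open>a\<close>, so it is a multiple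
  of \<open>a\<close>; and \<open>c\<close> is nonzero because \<open>A\<close> and \<open>B\<close> are independent.
\<close>

lemma ker_psi_subset_span:
  assumes "A \<in> ker_psi d M N" "B \<in> ker_psi d M N" "lin_indep_pair A B"
  shows "ker_psi d M N \<subseteq> form.span {A, B}"
proof
  fix H assume H: "H \<in> ker_psi d M N"
  have fm: "A \<in> forms (int d)" "B \<in> forms (int d)" "H \<in> forms (int d)"
    using assms H by (auto simp: ker_psi_iff)
  let ?a = "dehom A" and ?b = "dehom B" and ?h = "dehom H"
  obtain c where c: "?a * pderiv ?b - pderiv ?a * ?b = smult c (dehom M)"
    using psi_ode_wronskian[OF dehom_M_nz] assms by (metis ker_psi_iff)
  obtain c' where c': "?a * pderiv ?h - pderiv ?a * ?h = smult c' (dehom M)"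
    using psi_ode_wronskian[OF dehom_M_nz] assms H by (metis ker_psi_iff)
  have "c \<noteq> 0" using lin_indep_pair_wronskian[OF fm(1,2) assms(3)] c by auto
  let ?g = "scale c H - scale c' B"
  have "?a * pderiv (dehom ?g) - pderiv ?a * dehom ?g = smult c (?a * pderiv ?h - pderiv ?a * ?h)
      - smult c' (?a * pderiv ?b - pderiv ?a * ?b)"
    by (simp add: dehom_diff dehom_scale pderiv_diff pderiv_smult smult_diff_right algebra_simps)
  also have "\<dots> = 0" unfolding c c' by (simp add: mult.commute)
  finally have "\<not> lin_indep_pair A ?g"
    using lin_indep_pair_wronskian[of A "int d" ?g] fm by (auto intro: forms_diff forms_scale)
  then obtain \<alpha> \<beta> where ab: "\<alpha> \<noteq> 0 \<or> \<beta> \<noteq> 0" "scale \<alpha> A + scale \<beta> ?g = 0"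
    unfolding lin_indep_pair_iff by blast
  have "\<beta> \<noteq> 0"
  proof
    assume "\<beta> = 0"
    with ab have "\<alpha> \<noteq> 0" "scale \<alpha> A + scale 0 B = 0" by (auto simp: scale_def)
    with assms(3) show False unfolding lin_indep_pair_iff by blast
  qed
  have "scale (\<beta> * c) H = scale (\<beta> * c') B - scale \<alpha> A"
    using ab(2) by (simp add: form.scale_right_diff_distrib algebra_simps eq_diff_eq)
  also have "\<dots> \<in> form.span {A, B}"
    by (intro form.span_diff form.span_scale form.span_base) auto
  finally have "scale (1 / (\<beta> * c)) (scale (\<beta> * c) H) \<in> form.span {A, B}"
    by (rule form.span_scale)
  then show "H \<in> form.span {A, B}" using \<open>\<beta> \<noteq> 0\<close> \<open>c \<noteq> 0\<close> by simp
qed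

lemma dim_ker_psi:
  assumes "A \<in> ker_psi d M N" "B \<in> ker_psi d M N" "lin_indep_pair A B"
  shows "form.dim (ker_psi d M N) = 2"
proof (rule form.dim_unique[of "{A, B}"])
  show "ker_psi d M N \<subseteq> form.span {A, B}" by (rule ker_psi_subset_span[OF assms])
qed (use assms in \<open>auto simp: lin_indep_pair_def\<close>)

lemma kernel_condition_iff:
  "kernel_condition d M N \<longleftrightarrow>
     (\<exists>A\<in>ker_psi d M N. \<exists>B\<in>ker_psi d M N. lin_indep_pair A B)"
proof
  assume "kernel_condition d M N"
  obtain S where S: "S \<subseteq> ker_psi d M N" "form.independent S" "card S = form.dim (ker_psi d M N)"
    by (rule form.basis_exists)
  have "2 \<le> card S" using \<open>kernel_condition d M N\<close> S(3) by (simp add: kernel_condition_def)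
  then obtain T where "T \<subseteq> S" "card T = 2" by (meson obtain_subset_with_card_n)
  then obtain A B where "{A, B} \<subseteq> S" "A \<noteq> B" by (metis card_2_iff)
  then show "\<exists>A\<in>ker_psi d M N. \<exists>B\<in>ker_psi d M N. lin_indep_pair A B"
    using S(1) form.independent_mono[OF S(2), of "{A, B}"] unfolding lin_indep_pair_def by blast
next
  assume "\<exists>A\<in>ker_psi d M N. \<exists>B\<in>ker_psi d M N. lin_indep_pair A B"
  then show "kernel_condition d M N" using dim_ker_psi by (auto simp: kernel_condition_def)
qed

lemma kernel_condition_dim: "kernel_condition d M N \<Longrightarrow> form.dim (ker_psi d M N) = 2"
  using dim_ker_psi by (auto simp: kernel_condition_iff)

lemma transvectant_1_eq_iff:
  assumes "A \<in> forms (int d)" "B \<in> forms (int d)"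
  shows "M = transvectant d d 1 A B \<longleftrightarrow>
    smult (of_nat d) (dehom M) = dehom A * pderiv (dehom B) - pderiv (dehom A) * dehom B"
proof -
  have t: "transvectant d d 1 A B \<in> forms (2 * int d - 2)"
    using forms_transvectant[OF assms, of 1] by (simp add: algebra_simps)
  have "d \<ge> 1" using d by simp
  have "M = transvectant d d 1 A B \<longleftrightarrow>
      dehom M = smult (1 / of_nat d) (dehom A * pderiv (dehom B) - pderiv (dehom A) * dehom B)"
    unfolding dehom_eq_iff[OF M t, symmetric] dehom_transvectant_1[OF assms \<open>d \<ge> 1\<close>] ..
  also have "\<dots> \<longleftrightarrow> smult (of_nat d) (dehom M) = dehom A * pderiv (dehom B) - pderiv (dehom A) * dehom B"
    using \<open>d \<ge> 1\<close> smult_eq_iff[of "of_nat d"] by simp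
  finally show ?thesis .
qed

text \<open>
  The factor of \<open>N\<close> can be cancelled: for \<open>d > 2\<close> it is nonzero, and for \<open>d = 2\<close> both
  \<open>N\<close> and \<open>(A, B)\<^sub>3\<close> have order \<open>-2\<close> and vanish.
\<close>

lemma transvectant_3_eq_iff:
  assumes "A \<in> forms (int d)" "B \<in> forms (int d)"
  shows "N = transvectant d d 3 A B \<longleftrightarrow>
    smult (of_nat d * (of_nat d * (of_nat d - 1) * (of_nat d - 2) / (2 * (2 * of_nat d - 3)))) (dehom N) =
    smult (of_nat d / (2 * (2 * of_nat d - 3)) - 1)
      (pderiv (dehom A) * pderiv (pderiv (dehom B)) - pderiv (pderiv (dehom A)) * pderiv (dehom B)) +
    smult (of_nat d / (2 * (2 * of_nat d - 3)))
      (dehom A * pderiv (pderiv (pderiv (dehom B))) - pderiv (pderiv (pderiv (dehom A))) * dehom B)"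
proof -
  have t: "transvectant d d 3 A B \<in> forms (2 * int d - 6)"
    using forms_transvectant[OF assms, of 3] by (simp add: algebra_simps)
  have "N = transvectant d d 3 A B \<longleftrightarrow>
    smult (of_nat d * (of_nat d * (of_nat d - 1) * (of_nat d - 2) / (2 * (2 * of_nat d - 3)))) (dehom N) =
    smult (of_nat d * (of_nat d * (of_nat d - 1) * (of_nat d - 2) / (2 * (2 * of_nat d - 3))))
      (dehom (transvectant d d 3 A B))"
  proof (cases "d = 2")
    case True
    then have "F = 0" if "F \<in> forms (2 * int d - 6)" for F
      using that by (auto simp: forms_iff intro!: poly_eqI)
    then have "N = 0" "transvectant d d 3 A B = 0" using N t by blast+
    then show ?thesis by simp
  next
    case False
    then have nz: "complex_of_nat d \<noteq> 0" "complex_of_nat d - 1 \<noteq> 0" "complex_of_nat d - 2 \<noteq> 0"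
      "2 * complex_of_nat d - 3 \<noteq> 0" using double_minus_3_nonzero[of d] complex_nat_diff_nonzero[of 0 d] complex_nat_diff_nonzero[of 1 d]
        complex_nat_diff_nonzero[of 2 d] d by auto
    have "of_nat d * (of_nat d * (of_nat d - 1) * (of_nat d - 2) / (2 * (2 * of_nat d - 3))) \<noteq> (0 :: complex)"
      using nz by (simp only: mult_eq_0_iff divide_eq_0_iff) simp
    from smult_cancel_iff[OF this] show ?thesis
      unfolding dehom_eq_iff[OF N t, symmetric] by blast
  qed
  then show ?thesis unfolding dehom_transvectant_3[OF d assms] .
qed

text \<open>
  With \<open>M = (A, B)\<^sub>1\<close>, the operator multiplies \<open>a\<close> and \<open>b\<close> by a factor which is zero if and only if
  \<open>N = (A, B)\<^sub>3\<close>. The equivalence for \<open>A\<close> also recovers \<open>N\<close> from the kernel.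
\<close>

lemma psi_pencil:
  assumes "A \<in> forms (int d)" "B \<in> forms (int d)" "M = transvectant d d 1 A B" "A \<noteq> 0"
  shows "A \<in> ker_psi d M N \<longleftrightarrow> N = transvectant d d 3 A B"
    and "N = transvectant d d 3 A B \<Longrightarrow> B \<in> ker_psi d M N"
proof -
  let ?a = "dehom A" and ?b = "dehom B"
  define \<gamma> \<kappa> where "\<gamma> = complex_of_nat d / (2 * (2 * of_nat d - 3))"
    and "\<kappa> = complex_of_nat d * (of_nat d - 1) * (of_nat d - 2) / (2 * (2 * of_nat d - 3))"
  let ?p = "?a * pderiv (pderiv (pderiv ?b)) - pderiv (pderiv (pderiv ?a)) * ?b"
  let ?q = "pderiv ?a * pderiv (pderiv ?b) - pderiv (pderiv ?a) * pderiv ?b"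
  let ?R = "smult (\<gamma> - 1) ?q + smult \<gamma> ?p - smult \<kappa> (smult (of_nat d) (dehom N))"
  have w: "smult (of_nat d) (dehom M) = ?a * pderiv ?b - pderiv ?a * ?b"
    using transvectant_1_eq_iff[OF assms(1,2)] assms(3) by blast
  have sc: "smult (of_nat d) (psi_ode d (dehom M) (dehom N) f) =
      psi_ode d (smult (of_nat d) (dehom M)) (smult (of_nat d) (dehom N)) f" for f
    unfolding psi_ode_def by (simp add: pderiv_smult smult_add_right smult_diff_right mult.commute)
  have "of_nat d \<noteq> (0 :: complex)" using d by simp
  then have z: "psi_ode d (dehom M) (dehom N) f = 0 \<longleftrightarrow>
      psi_ode d (?a * pderiv ?b - pderiv ?a * ?b) (smult (of_nat d) (dehom N)) f = 0" for f
    unfolding w[symmetric] sc[symmetric] by simp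
  have a: "?a \<noteq> 0" using dehom_eq_0_iff[OF assms(1)] assms(4) by simp
  have R: "?R = 0 \<longleftrightarrow> N = transvectant d d 3 A B"
    unfolding transvectant_3_eq_iff[OF assms(1,2)] \<gamma>_def[symmetric] \<kappa>_def[symmetric]
    by (auto simp: mult.commute)
  show "A \<in> ker_psi d M N \<longleftrightarrow> N = transvectant d d 3 A B"
    unfolding ker_psi_iff z psi_ode_pencil \<gamma>_def[symmetric] \<kappa>_def[symmetric] R[symmetric]
    using a assms(1) by simp
  show "B \<in> ker_psi d M N" if "N = transvectant d d 3 A B"
    unfolding ker_psi_iff z psi_ode_pencil \<gamma>_def[symmetric] \<kappa>_def[symmetric]
    using R that assms(2) by simp
qed

theorem transvectant_iff_kernel: "transvectant_condition d M N \<longleftrightarrow> kernel_condition d M N"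
proof
  assume "transvectant_condition d M N"
  then obtain A B where AB: "A \<in> forms (int d)" "B \<in> forms (int d)" "lin_indep_pair A B"
    "M = transvectant d d 1 A B" "N = transvectant d d 3 A B"
    unfolding transvectant_condition_def by blast
  have "A \<noteq> 0" using AB(3) form.dependent_zero[of "{A, B}"] by (auto simp: lin_indep_pair_def)
  then show "kernel_condition d M N"
    unfolding kernel_condition_iff using psi_pencil[OF AB(1,2,4)] AB(3,5) by blast
next
  assume "kernel_condition d M N"
  then obtain A B where AB: "A \<in> ker_psi d M N" "B \<in> ker_psi d M N" "lin_indep_pair A B"
    unfolding kernel_condition_iff by blast
  then have fm: "A \<in> forms (int d)" "B \<in> forms (int d)" by (auto simp: ker_psi_iff)
  obtain c where c: "dehom A * pderiv (dehom B) - pderiv (dehom A) * dehom B = smult c (dehom M)"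
    using psi_ode_wronskian[OF dehom_M_nz] AB by (metis ker_psi_iff)
  have "c \<noteq> 0" using lin_indep_pair_wronskian[OF fm AB(3)] c by auto
  \<comment> \<open>the factor that turns \<open>w = c m\<close> into \<open>w = d m\<close>, which means \<open>M = (A, B)\<^sub>1\<close>\<close>
  let ?t = "of_nat d / c"
  have "?t \<noteq> 0" using \<open>c \<noteq> 0\<close> d by simp
  define A' where "A' = scale ?t A"
  have A': "A' \<in> forms (int d)" using fm by (simp add: A'_def forms_scale)
  have "dehom A' * pderiv (dehom B) - pderiv (dehom A') * dehom B =
      smult ?t (dehom A * pderiv (dehom B) - pderiv (dehom A) * dehom B)"
    by (simp add: A'_def dehom_scale pderiv_smult smult_diff_right)
  also have "\<dots> = smult (of_nat d) (dehom M)" unfolding c using \<open>c \<noteq> 0\<close> by simp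
  finally have M1: "M = transvectant d d 1 A' B"
    using transvectant_1_eq_iff[OF A' fm(2)] by simp
  have ind: "lin_indep_pair A' B"
    unfolding lin_indep_pair_iff
  proof (intro allI impI)
    fix \<alpha> \<beta> assume "scale \<alpha> A' + scale \<beta> B = 0"
    then have "scale (\<alpha> * ?t) A + scale \<beta> B = 0" by (simp add: A'_def)
    then have "\<alpha> * ?t = 0 \<and> \<beta> = 0" using AB(3) unfolding lin_indep_pair_iff by blast
    then show "\<alpha> = 0 \<and> \<beta> = 0" using \<open>?t \<noteq> 0\<close> by simp
  qed
  then have "A' \<noteq> 0" using form.dependent_zero[of "{A', B}"] by (auto simp: lin_indep_pair_def)
  have "A' \<in> ker_psi d M N"
    using AB(1) A' by (simp add: ker_psi_iff A'_def dehom_scale psi_ode_smult)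
  then have "N = transvectant d d 3 A' B" using psi_pencil(1)[OF A' fm(2) M1 \<open>A' \<noteq> 0\<close>] by simp
  then show "transvectant_condition d M N"
    unfolding transvectant_condition_def using A' fm(2) ind M1 by blast
qed

end

section \<open>Divisibility by powers of \<open>\<omega>\<close>\<close>


text \<open>
  The substitution \<open>y = x\<close>.
\<close>

definition diag :: "biform \<Rightarrow> form" where
  "diag P = poly (poly P [:X1:]) X0"

lemma diag_add: "diag (P + Q) = diag P + diag Q"
  and diag_diff: "diag (P - Q) = diag P - diag Q"
  and diag_mult: "diag (P * Q) = diag P * diag Q"
  and diag_0 [simp]: "diag 0 = 0" and diag_1 [simp]: "diag 1 = 1"
  by (simp_all add: diag_def)

lemma diag_power: "diag (P ^ n) = diag P ^ n"
  by (induction n) (simp_all add: diag_mult)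

lemma diag_of_nat: "diag (of_nat n) = of_nat n"
  by (induction n) (simp_all add: diag_add)

lemma diag_sum: "diag (sum f I) = (\<Sum>i\<in>I. diag (f i))"
  by (induction I rule: infinite_finite_induct) (simp_all add: diag_add)

lemma diag_in_x: "diag (in_x F) = F"
  by (simp add: diag_def in_x_def)

lemma poly_map_const_X0: "poly (map_poly const p) X0 = [:p:]"
  by (induction p) (simp_all add: map_poly_pCons const_0, simp add: const_def X0_def)

lemma in_y_pCons: "in_y (pCons p F) = pCons (map_poly const p) (in_y F)"
  by (simp add: in_y_def map_poly_pCons)

lemma diag_in_y: "diag (in_y F) = F"
proof (induction F)
  case 0
  then show ?case by (simp add: in_y_def)
next
  case (pCons p F)
  have "diag (in_y (pCons p F)) = [:p:] + X1 * diag (in_y F)"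
    by (simp add: in_y_pCons diag_def poly_map_const_X0)
  then show ?case unfolding pCons.IH by (simp add: X1_def)
qed

lemma in_x_add: "in_x (F + G) = in_x F + in_x G"
  and in_x_mult: "in_x (F * G) = in_x F * in_x G"
  and in_x_0 [simp]: "in_x 0 = 0" and in_x_1: "in_x 1 = 1"
  by (simp_all add: in_x_def one_pCons)

lemma in_x_power: "in_x (F ^ n) = in_x F ^ n"
  by (induction n) (simp_all add: in_x_mult in_x_1)

lemma in_x_of_nat: "in_x (of_nat n) = of_nat n"
  by (induction n) (simp_all add: in_x_add in_x_1)

lemma in_x_sum: "in_x (sum f I) = (\<Sum>i\<in>I. in_x (f i))"
  by (induction I rule: infinite_finite_induct) (simp_all add: in_x_add)

lemma pderiv_in_x: "pderiv (in_x F) = 0"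
  by (simp add: in_x_def pderiv_pCons)

lemma coeff_in_y: "coeff (in_y F) j = map_poly const (coeff F j)"
  by (simp add: in_y_def coeff_map_poly)

lemma pderiv_in_y: "pderiv (in_y F) = in_y (dx1 F)"
proof (rule poly_eqI)
  fix j
  have "of_nat n * map_poly const p = map_poly const (of_nat n * p)" for n :: nat and p
    by (rule poly_eqI) (simp add: coeff_map_poly const_0 coeff_of_nat_mult const_mult const_of_nat)
  then show "coeff (pderiv (in_y F)) j = coeff (in_y (dx1 F)) j"
    by (simp add: coeff_pderiv coeff_in_y coeff_dx1 del: of_nat_Suc)
qed

lemma higher_pderiv_in_y: "(pderiv ^^ k) (in_y F) = in_y ((dx1 ^^ k) F)"
  by (induction k) (simp_all add: pderiv_in_y)

lemma in_y_X0: "in_y X0 = [:[:0, 1:]:]"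
  by (simp add: in_y_def X0_def map_poly_pCons const_0 const_1)

lemma in_y_X1: "in_y X1 = [:0, 1:]"
  by (simp add: in_y_def X1_def map_poly_pCons const_0 const_1)

lemma pderiv_in_y_X0: "pderiv (in_y X0) = 0" and pderiv_in_y_X1: "pderiv (in_y X1) = 1"
  by (simp_all add: in_y_X0 in_y_X1 pderiv_pCons)

lemma pderiv_omega: "pderiv omega = in_x X0"
  by (simp add: omega_def pderiv_diff pderiv_mult pderiv_in_x pderiv_in_y_X0 pderiv_in_y_X1)

lemma diag_omega: "diag omega = 0"
  by (simp add: omega_def diag_diff diag_mult diag_in_x diag_in_y)

lemma X0_nz: "X0 \<noteq> 0"
  by (simp add: X0_def)

lemma omega_nz: "omega \<noteq> 0"
proof
  assume "omega = 0"
  then have "in_x X0 = 0" using pderiv_omega by simp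
  then show False using X0_nz by (simp add: in_x_def)
qed

definition y_homogeneous :: "nat \<Rightarrow> biform \<Rightarrow> bool" where
  "y_homogeneous b T \<longleftrightarrow> (\<forall>i j. i + j \<noteq> b \<longrightarrow> coeff (coeff T j) i = 0)"

lemma y_homogeneous_0: "y_homogeneous b 0"
  and y_homogeneous_add: "y_homogeneous b P \<Longrightarrow> y_homogeneous b Q \<Longrightarrow> y_homogeneous b (P + Q)"
  and y_homogeneous_diff: "y_homogeneous b P \<Longrightarrow> y_homogeneous b Q \<Longrightarrow> y_homogeneous b (P - Q)"
  by (simp_all add: y_homogeneous_def)

lemma y_homogeneous_in_x: "y_homogeneous 0 (in_x F)"
  by (auto simp: y_homogeneous_def in_x_def coeff_pCons split: nat.splits)

lemma y_homogeneous_in_y: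
  assumes "F \<in> forms (int b)" shows "y_homogeneous b (in_y F)"
proof -
  have "coeff (coeff F j) i = 0" if "i + j \<noteq> b" for i j
    using assms that unfolding forms_iff by (metis of_nat_add of_nat_eq_iff)
  then show ?thesis by (simp add: y_homogeneous_def coeff_in_y coeff_map_poly const_0)
qed

lemma y_homogeneous_mult:
  assumes "y_homogeneous a P" "y_homogeneous b Q" shows "y_homogeneous (a + b) (P * Q)"
  unfolding y_homogeneous_def
proof (intro allI impI)
  fix i j assume ij: "i + j \<noteq> a + b"
  have *: "coeff (coeff P l) k * coeff (coeff Q (j - l)) (i - k) = 0" if "k \<le> i" "l \<le> j" for k l
  proof (cases "k + l = a")
    case True
    then have "(i - k) + (j - l) \<noteq> b" using ij that by auto
    then show ?thesis using assms(2) by (simp add: y_homogeneous_def)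
  next
    case False
    then show ?thesis using assms(1) by (simp add: y_homogeneous_def)
  qed
  show "coeff (coeff (P * Q) j) i = 0"
    unfolding coeff_mult coeff_sum by (intro sum.neutral ballI *) auto
qed

lemma y_homogeneous_omega: "y_homogeneous 1 omega"
proof -
  have "y_homogeneous 1 (in_y X0)" "y_homogeneous 1 (in_y X1)"
    using X0_forms X1_forms by (auto intro!: y_homogeneous_in_y)
  then show ?thesis
    unfolding omega_def using y_homogeneous_mult[OF y_homogeneous_in_x] by (auto intro!: y_homogeneous_diff)
qed

lemma y_homogeneous_expand:
  assumes "y_homogeneous b T"
  shows "T = (\<Sum>j\<le>b. in_x (coeff (coeff T j) (b - j)) * in_y X0 ^ (b - j) * in_y X1 ^ j)"
proof -
  have y: "in_y X0 = [:monom 1 1:]" "in_y X1 = monom 1 1"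
    by (simp_all add: in_y_X0 in_y_X1 monom_Suc monom_0)
  have "in_y X0 ^ n = [:monom 1 n:]" for n
    unfolding y by (induction n) (simp_all add: mult_monom monom_0 pCons_one)
  moreover have "in_y X1 ^ n = monom 1 n" for n
    unfolding y by (induction n) (simp_all add: mult_monom)
  ultimately have *: "in_x t * in_y X0 ^ i * in_y X1 ^ j = monom (monom t i) j" for t i j
    by (simp add: in_x_def smult_monom mult.commute)
  show ?thesis
    unfolding *
  proof (rule poly_eqI, rule poly_eqI)
    fix j i
    have "coeff (coeff (\<Sum>j\<le>b. monom (monom (coeff (coeff T j) (b - j)) (b - j)) j) j) i =
        (\<Sum>l\<le>b. if l = j then coeff (monom (coeff (coeff T l) (b - l)) (b - l)) i else 0)"
      unfolding coeff_sum by (intro sum.cong refl) simp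
    also have "\<dots> = (if j \<le> b then coeff (monom (coeff (coeff T j) (b - j)) (b - j)) i else 0)"
      by (simp add: sum.delta del: coeff_monom)
    also have "\<dots> = coeff (coeff T j) i"
      using assms by (cases "i + j = b") (auto simp: y_homogeneous_def)
    finally show "coeff (coeff T j) i =
        coeff (coeff (\<Sum>j\<le>b. monom (monom (coeff (coeff T j) (b - j)) (b - j)) j) j) i" ..
  qed
qed

lemma higher_pderiv_power_X1:
  "(pderiv ^^ k) (in_x t * in_y X0 ^ i * in_y X1 ^ j) =
    of_nat (fact k * (j choose k)) * (in_x t * in_y X0 ^ i * in_y X1 ^ (j - k))"
proof (induction k)
  case (Suc k)
  have d0: "pderiv (in_y X0 ^ i) = 0"
    by (induction i) (simp_all add: pderiv_mult pderiv_in_y_X0)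
  have d1: "pderiv (in_y X1 ^ n) = of_nat n * in_y X1 ^ (n - 1)" for n
  proof (induction n)
    case (Suc n)
    then show ?case by (cases n) (simp_all add: pderiv_mult pderiv_in_y_X1 algebra_simps)
  qed simp
  have "Suc k * (j choose Suc k) = (j choose k) * (j - k)"
    using binomial_absorption[of k j] binomial_absorb_comp[of j k] by (simp add: mult.commute)
  moreover have "fact (Suc k) * (j choose Suc k) = fact k * (Suc k * (j choose Suc k))"
    by (simp add: algebra_simps)
  ultimately have f: "fact (Suc k) * (j choose Suc k) = fact k * (j choose k) * (j - k)"
    by (simp only: mult.assoc)
  have "(pderiv ^^ Suc k) (in_x t * in_y X0 ^ i * in_y X1 ^ j) =
      pderiv (of_nat (fact k * (j choose k)) * (in_x t * in_y X0 ^ i * in_y X1 ^ (j - k)))"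
    using Suc.IH by simp
  also have "\<dots> = of_nat (fact k * (j choose k)) *
      (in_x t * in_y X0 ^ i * (of_nat (j - k) * in_y X1 ^ (j - k - 1)))"
    by (simp add: pderiv_mult pderiv_of_nat pderiv_in_x d0 d1 del: of_nat_mult)
  also have "\<dots> = of_nat (fact (Suc k) * (j choose Suc k)) *
      (in_x t * in_y X0 ^ i * in_y X1 ^ (j - Suc k))"
    unfolding f by (simp add: mult_ac)
  finally show ?case .
qed simp

lemma higher_pderiv_omega_power: "k \<le> n \<Longrightarrow> \<exists>R. (pderiv ^^ k) (omega ^ n * Q) = omega ^ (n - k) * R"
proof (induction k)
  case (Suc k)
  then obtain R where R: "(pderiv ^^ k) (omega ^ n * Q) = omega ^ (n - k) * R" by auto
  obtain m where m: "n - k = Suc m" "n - Suc k = m"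
    using Suc.prems by (metis Suc_diff_Suc Suc_le_lessD)
  have "(pderiv ^^ Suc k) (omega ^ n * Q) = pderiv (omega ^ Suc m * R)" using R m by simp
  also have "\<dots> = omega ^ m * (of_nat (Suc m) * in_x X0 * R + omega * pderiv R)"
    unfolding pderiv_mult pderiv_power_Suc pderiv_omega by (simp add: of_nat_poly algebra_simps)
  finally show ?case unfolding m(2) by blast
qed auto

text \<open>
  This removes the power of \<open>x0\<close> by which \<open>y_homogeneous_taylor\<close> multiplies a polynomial.
\<close>

lemma prime_power_cancel_dvd:
  fixes p w :: "'a :: idom"
  assumes p: "prime_elem p" and w: "\<not> p dvd w"
  shows "w ^ n dvd p ^ b * T \<Longrightarrow> w ^ n dvd T"
proof (induction b)
  case (Suc b)
  then obtain Q where Q: "p * (p ^ b * T) = w ^ n * Q" by (auto simp: mult.assoc)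
  then have "p dvd w ^ n * Q" by (metis dvd_triv_left)
  then have "p dvd Q"
    using prime_elem_dvd_mult_iff[OF p] prime_elem_dvd_power[OF p] w by blast
  then obtain Q' where "Q = p * Q'" by blast
  then have "p * (p ^ b * T) = p * (w ^ n * Q')" using Q by (simp add: mult.left_commute)
  then have "p ^ b * T = w ^ n * Q'" using p by (simp add: prime_elem_def)
  then show ?case using Suc.IH by simp
qed simp

lemma prime_elem_in_x_X0: "prime_elem (in_x X0)"
proof -
  have "prime_elem [:0, 1 :: complex:]"
    by (rule prime_elem_linear_field_poly) simp
  then show ?thesis unfolding in_x_def X0_def by (simp add: prime_elem_const_poly_iff)
qed

lemma X0_not_dvd_omega: "\<not> in_x X0 dvd omega"
proof
  assume "in_x X0 dvd omega"
  then have "in_x X0 dvd in_x X0 * in_y X1 - omega" by (intro dvd_diff) auto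
  then have "in_x X0 dvd in_x X1 * in_y X0" by (simp add: omega_def)
  then have "in_x X0 dvd in_x X1 \<or> in_x X0 dvd in_y X0"
    using prime_elem_dvd_mult_iff[OF prime_elem_in_x_X0] by blast
  moreover have n: "\<not> [:0, 1 :: complex:] dvd 1"
    by (rule prime_elem_not_unit[OF prime_elem_linear_field_poly]) simp
  have nu: "\<not> X0 dvd 1"
  proof
    assume "X0 dvd 1"
    then have "[:0, 1:] dvd coeff (1 :: form) 0" unfolding X0_def const_poly_dvd_iff by blast
    with n show False by simp
  qed
  have "\<not> in_x X0 dvd in_x X1"
  proof
    assume "in_x X0 dvd in_x X1"
    then have "X0 dvd X1" by (simp add: in_x_def const_poly_dvd_const_poly_iff)
    then have "[:0, 1:] dvd coeff X1 1" unfolding X0_def const_poly_dvd_iff by blast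
    with n show False by (simp add: X1_def)
  qed
  moreover have "\<not> in_x X0 dvd in_y X0"
  proof
    assume "in_x X0 dvd in_y X0"
    then have "[:X0:] dvd [:0, 1:]" by (simp add: in_x_def in_y_X0 const_poly_dvd_const_poly_iff)
    then have "X0 dvd coeff [:0, 1:] 1" unfolding const_poly_dvd_iff by blast
    with nu show False by simp
  qed
  ultimately show False by blast
qed

text \<open>
  Taylor expansion along the diagonal. Multiplication by \<open>x0\<^sup>b\<close> turns each \<open>y0\<^sup>b\<^sup>-\<^sup>j y1\<^sup>j\<close> into
  \<open>(x0 y0)\<^sup>b\<^sup>-\<^sup>j (x0 y1)\<^sup>j\<close>, and \<open>x0 y1 = \<omega> + x1 y0\<close> can be expanded binomially. The coefficient of
  \<open>\<omega>\<^sup>k\<close> is, up to a power of \<open>y0\<close> and to \<open>k!\<close>, the \<open>k\<close>-th derivative at \<open>y = x\<close>.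
\<close>

lemma y_homogeneous_taylor:
  assumes "y_homogeneous b T"
  shows "\<exists>h. (\<forall>k. diag ((pderiv ^^ k) T) = of_nat (fact k) * h k) \<and>
    in_x X0 ^ b * T = (\<Sum>k\<le>b. omega ^ k * in_y X0 ^ (b - k) * in_x (h k))"
proof -
  define t where "t j = coeff (coeff T j) (b - j)" for j
  have T: "T = (\<Sum>j\<le>b. in_x (t j) * in_y X0 ^ (b - j) * in_y X1 ^ j)"
    unfolding t_def by (rule y_homogeneous_expand[OF assms])
  \<comment> \<open>the derivative of order \<open>k\<close> on the diagonal, divided by \<open>k!\<close>\<close>
  define h where "h k = (\<Sum>j\<le>b. of_nat (j choose k) * (t j * X0 ^ (b - j) * X1 ^ (j - k)))" for k
  have "diag ((pderiv ^^ k) T) = of_nat (fact k) * h k" for k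
    unfolding h_def
    by (subst T, unfold higher_pderiv_sum higher_pderiv_power_X1 diag_sum sum_distrib_left)
       (simp add: diag_mult diag_in_x diag_in_y diag_power diag_of_nat mult.assoc del: of_nat_fact)
  moreover have "in_x X0 ^ b * T = (\<Sum>k\<le>b. omega ^ k * in_y X0 ^ (b - k) * in_x (h k))"
  proof -
    have w: "in_x X0 * in_y X1 = omega + in_x X1 * in_y X0" by (simp add: omega_def)
    have "in_x X0 ^ b * (in_x (t j) * in_y X0 ^ (b - j) * in_y X1 ^ j) =
        (\<Sum>k\<le>b. omega ^ k * in_y X0 ^ (b - k) *
          in_x (of_nat (j choose k) * (t j * X0 ^ (b - j) * X1 ^ (j - k))))" if j: "j \<le> b" for j
    proof -
      have "in_x X0 ^ b = in_x X0 ^ (b - j) * in_x X0 ^ j"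
        using j by (simp flip: power_add)
      then have "in_x X0 ^ b * (in_x (t j) * in_y X0 ^ (b - j) * in_y X1 ^ j) =
          in_x (t j) * (in_x X0 ^ (b - j) * in_y X0 ^ (b - j)) * (in_x X0 * in_y X1) ^ j"
        by (simp add: power_mult_distrib mult_ac)
      also have "\<dots> = in_x (t j) * (in_x X0 ^ (b - j) * in_y X0 ^ (b - j)) *
          (\<Sum>k\<le>j. of_nat (j choose k) * omega ^ k * (in_x X1 * in_y X0) ^ (j - k))"
        unfolding w binomial_ring ..
      also have "\<dots> = (\<Sum>k\<le>j. omega ^ k * in_y X0 ^ (b - k) *
          in_x (of_nat (j choose k) * (t j * X0 ^ (b - j) * X1 ^ (j - k))))"
        unfolding sum_distrib_left
      proof (intro sum.cong refl)
        fix k assume "k \<in> {..j}"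
        then have "in_y X0 ^ (b - k) = in_y X0 ^ (b - j) * in_y X0 ^ (j - k)"
          using j by (simp flip: power_add)
        then show "in_x (t j) * (in_x X0 ^ (b - j) * in_y X0 ^ (b - j)) *
            (of_nat (j choose k) * omega ^ k * (in_x X1 * in_y X0) ^ (j - k)) =
          omega ^ k * in_y X0 ^ (b - k) *
            in_x (of_nat (j choose k) * (t j * X0 ^ (b - j) * X1 ^ (j - k)))"
          by (simp add: power_mult_distrib in_x_mult in_x_power in_x_of_nat mult_ac)
      qed
      also have "\<dots> = (\<Sum>k\<le>b. omega ^ k * in_y X0 ^ (b - k) *
          in_x (of_nat (j choose k) * (t j * X0 ^ (b - j) * X1 ^ (j - k))))"
        using j by (intro sum.mono_neutral_left) (auto simp: binomial_eq_0)
      finally show ?thesis .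
    qed
    then have "in_x X0 ^ b * T = (\<Sum>j\<le>b. \<Sum>k\<le>b. omega ^ k * in_y X0 ^ (b - k) *
          in_x (of_nat (j choose k) * (t j * X0 ^ (b - j) * X1 ^ (j - k))))"
      by (subst T) (simp add: sum_distrib_left)
    also have "\<dots> = (\<Sum>k\<le>b. omega ^ k * in_y X0 ^ (b - k) * in_x (h k))"
      unfolding h_def in_x_sum sum_distrib_left by (rule sum.swap)
    finally show ?thesis .
  qed
  ultimately show ?thesis by blast
qed

theorem omega_power_dvd_iff:
  assumes "y_homogeneous b T"
  shows "omega ^ n dvd T \<longleftrightarrow> (\<forall>k<n. diag ((pderiv ^^ k) T) = 0)"
proof
  assume "omega ^ n dvd T"
  then obtain Q where Q: "T = omega ^ n * Q" by blast
  show "\<forall>k<n. diag ((pderiv ^^ k) T) = 0"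
  proof (intro allI impI)
    fix k assume "k < n"
    then obtain R where "(pderiv ^^ k) T = omega ^ (n - k) * R"
      unfolding Q using higher_pderiv_omega_power[of k n Q] by auto
    then show "diag ((pderiv ^^ k) T) = 0"
      using \<open>k < n\<close> by (simp add: diag_mult diag_power diag_omega)
  qed
next
  assume z: "\<forall>k<n. diag ((pderiv ^^ k) T) = 0"
  obtain h where h: "\<And>k. diag ((pderiv ^^ k) T) = of_nat (fact k) * h k"
    and T: "in_x X0 ^ b * T = (\<Sum>k\<le>b. omega ^ k * in_y X0 ^ (b - k) * in_x (h k))"
    using y_homogeneous_taylor[OF assms] by blast
  have "h k = 0" if "k < n" for k
    using z h[of k] that by simp
  then have "omega ^ n dvd omega ^ k * in_y X0 ^ (b - k) * in_x (h k)" for k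
    by (cases "k < n") (simp_all add: dvd_mult2 le_imp_power_dvd)
  then have "omega ^ n dvd in_x X0 ^ b * T" unfolding T by (intro dvd_sum)
  then show "omega ^ n dvd T"
    by (rule prime_power_cancel_dvd[OF prime_elem_in_x_X0 X0_not_dvd_omega])
qed

section \<open>Polarization\<close>


lemma coeff2_map_poly: "f 0 = 0 \<Longrightarrow> coeff (coeff (map_poly (map_poly f) P) j) i = f (coeff (coeff P j) i)"
  by (simp add: coeff_map_poly)

lemma biform_eqI: "(\<And>i j. coeff (coeff P j) i = coeff (coeff Q j) i) \<Longrightarrow> P = Q" for P Q :: biform
  by (rule poly_eqI, rule poly_eqI) simp

lemma in_y_X0_mult: "in_y X0 * P = map_poly (pCons 0) P"
  by (rule poly_eqI) (simp add: in_y_X0 coeff_map_poly)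

lemma in_y_X1_mult: "in_y X1 * P = pCons 0 P"
  by (simp add: in_y_X1)

lemma polar_op_add: "polar_op (P + Q) = polar_op P + polar_op Q"
proof -
  have "map_poly (map_poly dx0) (P + Q) = map_poly (map_poly dx0) P + map_poly (map_poly dx0) Q"
    "map_poly (map_poly dx1) (P + Q) = map_poly (map_poly dx1) P + map_poly (map_poly dx1) Q"
    by (rule biform_eqI; simp add: coeff2_map_poly dx0_add dx1_add)+
  then show ?thesis by (simp add: polar_op_def algebra_simps)
qed

lemma polar_op_mult_X0: "polar_op (in_y X0 * P) = in_y X0 * polar_op P"
proof -
  have "map_poly (map_poly f) (in_y X0 * P) = in_y X0 * map_poly (map_poly f) P" if "f 0 = 0" for f
    unfolding in_y_X0_mult
    by (rule biform_eqI) (simp add: coeff_map_poly coeff_pCons that split: nat.splits)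
  then show ?thesis by (simp add: polar_op_def algebra_simps)
qed

lemma polar_op_mult_X1: "polar_op (in_y X1 * P) = in_y X1 * polar_op P"
proof -
  have "map_poly (map_poly f) (in_y X1 * P) = in_y X1 * map_poly (map_poly f) P" if "f 0 = 0" for f
    unfolding in_y_X1_mult
    by (rule biform_eqI) (simp add: coeff_map_poly coeff_pCons that split: nat.splits)
  then show ?thesis by (simp add: polar_op_def algebra_simps)
qed

lemma polar_op_in_x: "polar_op (in_x E) = in_y X0 * in_x (dx0 E) + in_y X1 * in_x (dx1 E)"
  by (simp add: polar_op_def in_x_def map_poly_pCons)

text \<open>
  The polarization operator commutes with multiplication by \<open>y0\<close> and \<open>y1\<close>, so its first
  application can be pulled out. The properties of iterated polars below are inductions along this recursion.
\<close>

lemma polar_pow_Suc: "(polar_op ^^ Suc m) (in_x E) =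
    in_y X0 * (polar_op ^^ m) (in_x (dx0 E)) + in_y X1 * (polar_op ^^ m) (in_x (dx1 E))"
  by (induction m) (simp_all add: polar_op_in_x polar_op_add polar_op_mult_X0 polar_op_mult_X1)

lemma y_homogeneous_polar_pow: "y_homogeneous m ((polar_op ^^ m) (in_x E))"
proof (induction m arbitrary: E)
  case 0
  then show ?case by (simp add: y_homogeneous_in_x)
next
  case (Suc m)
  have "y_homogeneous 1 (in_y X0)" "y_homogeneous 1 (in_y X1)"
    using X0_forms X1_forms by (auto intro!: y_homogeneous_in_y)
  then show ?case
    unfolding polar_pow_Suc using Suc.IH y_homogeneous_mult[of 1 _ m] by (auto intro!: y_homogeneous_add)
qed

lemma pderiv_polar_pow: "pderiv ((polar_op ^^ m) (in_x E)) = of_nat m * (polar_op ^^ (m - 1)) (in_x (dx1 E))"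
proof (induction m arbitrary: E)
  case 0
  then show ?case by (simp add: pderiv_in_x)
next
  case (Suc m)
  let ?P = "\<lambda>m F. (polar_op ^^ m) (in_x F)"
  have "pderiv (?P (Suc m) E) = of_nat m * (in_y X0 * ?P (m - 1) (dx0 (dx1 E)) +
      in_y X1 * ?P (m - 1) (dx1 (dx1 E))) + ?P m (dx1 E)"
    unfolding polar_pow_Suc
    by (simp add: pderiv_add pderiv_mult pderiv_in_y_X0 pderiv_in_y_X1 Suc.IH dx0_dx1 algebra_simps)
  also have "of_nat m * (in_y X0 * ?P (m - 1) (dx0 (dx1 E)) + in_y X1 * ?P (m - 1) (dx1 (dx1 E))) =
      of_nat m * ?P m (dx1 E)"
    by (cases m) (simp_all only: polar_pow_Suc diff_Suc_1 of_nat_0 mult_zero_left)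
  finally show ?case by (simp add: algebra_simps)
qed

lemma higher_pderiv_polar_pow: "(pderiv ^^ j) ((polar_op ^^ m) (in_x E)) =
    of_nat (\<Prod>i<j. m - i) * (polar_op ^^ (m - j)) (in_x ((dx1 ^^ j) E))"
proof (induction j)
  case (Suc j)
  then show ?case
    by (simp add: pderiv_mult pderiv_of_nat pderiv_polar_pow mult_ac del: of_nat_prod)
qed simp

lemma euler_form:
  assumes "F \<in> forms e"
  shows "X0 * dx0 F + X1 * dx1 F = of_int e * F"
proof -
  have "X0 * dx0 F \<in> forms (1 + (e - 1))" "X1 * dx1 F \<in> forms (1 + (e - 1))"
    using assms by (intro forms_mult X0_forms X1_forms forms_dx0 forms_dx1; assumption)+
  then have l: "X0 * dx0 F + X1 * dx1 F \<in> forms e" by (simp add: forms_add)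
  have "of_int e * F = scale (of_int e) F"
    by (simp add: scale_def of_int_poly)
  then have r: "of_int e * F \<in> forms e" "dehom (of_int e * F) = of_int e * dehom F"
    using assms by (simp_all add: forms_scale dehom_scale of_int_poly)
  show ?thesis
    unfolding dehom_eq_iff[OF l r(1), symmetric] r(2)
    by (simp add: dehom_add dehom_mult dehom_X0 dehom_X1 dehom_dx0[OF assms] dehom_dx1)
qed

lemma diag_polar_pow:
  assumes "E \<in> forms (int e)" "m \<le> e"
  shows "of_nat (fact (e - m)) * diag ((polar_op ^^ m) (in_x E)) = of_nat (fact e) * E"
  using assms
proof (induction m arbitrary: e E)
  case 0
  then show ?case by (simp add: diag_in_x)
next
  case (Suc m)
  obtain e' where e: "e = Suc e'" using Suc.prems by (metis Suc_le_D)
  have m: "dx0 E \<in> forms (int e')" "dx1 E \<in> forms (int e')"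
    using forms_dx0[OF Suc.prems(1)] forms_dx1[OF Suc.prems(1)] e by simp_all
  have le: "m \<le> e'" using Suc.prems e by simp
  let ?f = "of_nat (fact (e' - m)) :: form"
  have "of_nat (fact (e - Suc m)) * diag ((polar_op ^^ Suc m) (in_x E)) =
      X0 * (?f * diag ((polar_op ^^ m) (in_x (dx0 E)))) + X1 * (?f * diag ((polar_op ^^ m) (in_x (dx1 E))))"
    unfolding polar_pow_Suc using e by (simp add: diag_add diag_mult diag_in_y algebra_simps del: of_nat_fact)
  also have "\<dots> = of_nat (fact e') * (X0 * dx0 E + X1 * dx1 E)"
    unfolding Suc.IH[OF m(1) le] Suc.IH[OF m(2) le] by (simp add: algebra_simps del: of_nat_fact)
  also have "\<dots> = of_nat (fact e) * E"
    unfolding euler_form[OF Suc.prems(1)] using e by (simp add: algebra_simps)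
  finally show ?case .
qed

lemma scale_of_nat: "scale (of_nat n) F = of_nat n * F"
  by (simp add: scale_eq_const_mult const_of_nat)

lemma higher_pderiv_in_x_mult: "(pderiv ^^ j) (in_x F * P) = in_x F * (pderiv ^^ j) P"
  by (induction j) (simp_all add: pderiv_mult pderiv_in_x)

text \<open>
  The scalar by which the \<open>j\<close>-th derivative of the half polar of \<open>E\<close> with respect to \<open>y1\<close>, restricted to
  \<open>y = x\<close>, differs from \<open>\<partial>\<^sub>1\<^sup>j E\<close>. The subtractions are truncated: for \<open>j > m\<close> the product
  contains the factor \<open>m - m = 0\<close>, as it should, because the half polar has degree \<open>m\<close> in \<open>y\<close>.
\<close>

definition half_polar_jet :: "nat \<Rightarrow> nat \<Rightarrow> complex" where
  "half_polar_jet m j = of_nat (\<Prod>i<j. m - i) * fact (2 * m - j) / fact (2 * m)"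

lemma diag_higher_pderiv_half_polar:
  assumes "E \<in> forms (int (2 * m))"
  shows "diag ((pderiv ^^ j) (half_polar (2 * m) E)) = scale (half_polar_jet m j) ((dx1 ^^ j) E)"
proof -
  let ?P = "(polar_op ^^ m) (in_x E)" and ?c = "fact m / fact (2 * m) :: complex"
  have D: "diag ((pderiv ^^ j) (half_polar (2 * m) E)) = scale ?c (diag ((pderiv ^^ j) ?P))"
    by (simp add: half_polar_def Let_def higher_pderiv_in_x_mult diag_mult diag_in_x
        scale_eq_const_mult)
  show ?thesis
  proof (cases "j \<le> m")
    case True
    have E: "(dx1 ^^ j) E \<in> forms (int (2 * m - j))"
      using forms_dx1_pow[OF assms, of j] True by (simp add: of_nat_diff)
    let ?d = "diag ((polar_op ^^ (m - j)) (in_x ((dx1 ^^ j) E)))"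
    have "2 * m - j - (m - j) = m" using True by simp
    then have "of_nat (fact m) * ?d = of_nat (fact (2 * m - j)) * (dx1 ^^ j) E"
      using diag_polar_pow[OF E, of "m - j"] True by simp
    then have s: "scale (fact m) ?d = scale (fact (2 * m - j)) ((dx1 ^^ j) E)"
      using scale_of_nat[of "fact m" ?d] scale_of_nat[of "fact (2 * m - j)" "(dx1 ^^ j) E"] by simp
    have "scale ?c (diag ((pderiv ^^ j) ?P)) =
        scale (of_nat (\<Prod>i<j. m - i) / fact (2 * m)) (scale (fact m) ?d)"
      by (simp add: higher_pderiv_polar_pow diag_mult diag_of_nat scale_of_nat[symmetric]
          mult_ac del: of_nat_prod)
    also have "\<dots> = scale (half_polar_jet m j) ((dx1 ^^ j) E)"
      unfolding s by (simp add: half_polar_jet_def mult_ac del: of_nat_prod)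
    finally show ?thesis using D by simp
  next
    case False
    then have z: "(\<Prod>i<j. m - i) = 0" by (intro prod_zero) (auto intro!: bexI[of _ m])
    show ?thesis
      unfolding D higher_pderiv_polar_pow half_polar_jet_def z by simp
  qed
qed

lemma y_homogeneous_half_polar: "y_homogeneous m (half_polar (2 * m) E)"
  using y_homogeneous_mult[OF y_homogeneous_in_x y_homogeneous_polar_pow[of m E]] by (simp add: half_polar_def Let_def)

lemma higher_pderiv_mult_omega: "(pderiv ^^ k) (omega * P) =
    omega * (pderiv ^^ k) P + of_nat k * in_x X0 * (pderiv ^^ (k - 1)) P"
proof (induction k)
  case (Suc k)
  show ?case
  proof (cases k)
    case 0
    then show ?thesis by (simp add: pderiv_mult pderiv_omega)
  next
    case (Suc l)
    with Suc.IH show ?thesis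
      by (simp add: pderiv_add pderiv_mult pderiv_omega pderiv_in_x pderiv_of_nat algebra_simps)
  qed
qed simp

lemma diag_higher_pderiv_mult_omega: "diag ((pderiv ^^ k) (omega * P)) =
    of_nat k * X0 * diag ((pderiv ^^ (k - 1)) P)"
  by (simp add: higher_pderiv_mult_omega diag_add diag_mult diag_omega diag_of_nat diag_in_x)

lemma biform_higher_pderiv_diff: "(pderiv ^^ k) (P - Q) = (pderiv ^^ k) P - (pderiv ^^ k) Q" for P :: biform
  by (induction k) (simp_all add: pderiv_diff)

lemma omega_mult_bezoutiant:
  assumes "A \<in> forms (int d)" "B \<in> forms (int d)"
  shows "omega * bezoutiant A B = in_x A * in_y B - in_x B * in_y A"
proof -
  have "y_homogeneous d (in_x A * in_y B - in_x B * in_y A)"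
    using y_homogeneous_mult[OF y_homogeneous_in_x y_homogeneous_in_y] assms by (fastforce intro!: y_homogeneous_diff)
  from omega_power_dvd_iff[OF this, of 1] have "omega dvd in_x A * in_y B - in_x B * in_y A"
    by (simp add: diag_diff diag_mult diag_in_x diag_in_y)
  then show ?thesis unfolding bezoutiant_def using omega_nz by simp
qed

lemma half_polar_0: "half_polar e 0 = 0"
proof -
  have "(polar_op ^^ m) 0 = 0" for m
    by (induction m) (simp_all add: polar_op_def)
  then show ?thesis by (simp add: half_polar_def Let_def)
qed

lemma half_polar_jet_0: "half_polar_jet m 0 = 1"
  by (simp add: half_polar_jet_def)

lemma bez_const_0: "1 \<le> d \<Longrightarrow> bez_const d 0 = of_nat d"
  by (simp add: bez_const_def power2_eq_square)

lemma of_nat_choose_3: "complex_of_nat (n choose 3) = of_nat n * (of_nat n - 1) * (of_nat n - 2) / 6"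
  by (simp add: binomial_gbinomial gbinomial_prod_rev numeral_3_eq_3)

text \<open>
  The constant \<open>c\<^sub>1\<close> matches the factor of \<open>N\<close> in \<open>dehom_transvectant_3\<close>.
\<close>

lemma bez_const_1:
  assumes "2 \<le> d"
  shows "6 * bez_const d 1 =
    of_nat d * (of_nat d * (of_nat d - 1) * (of_nat d - 2) / (2 * (2 * of_nat d - 3)))"
proof (cases "d = 2")
  case True
  then show ?thesis by (simp add: bez_const_def)
next
  case False
  define \<delta> where "\<delta> = complex_of_nat d"
  have d3: "3 \<le> d" using False assms by simp
  have nz: "\<delta> \<noteq> 0" "\<delta> - 1 \<noteq> 0" "\<delta> - 2 \<noteq> 0" "2 * \<delta> - 3 \<noteq> 0"
    using complex_nat_diff_nonzero[of 0 d] complex_nat_diff_nonzero[of 1 d]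
      complex_nat_diff_nonzero[of 2 d] double_minus_3_nonzero[of d] d3
    unfolding \<delta>_def by simp_all
  have e: "complex_of_nat (2 * d - 2) = 2 * \<delta> - 2"
    unfolding \<delta>_def using assms by (simp add: of_nat_diff)
  have b: "bez_const d 1 = 2 * of_nat (d choose 3) ^ 2 / of_nat ((2 * d - 2) choose 3)"
    by (simp add: bez_const_def numeral_3_eq_3)
  have b: "bez_const d 1 = 2 * (\<delta> * (\<delta> - 1) * (\<delta> - 2) / 6) ^ 2 /
      ((2 * \<delta> - 2) * (2 * \<delta> - 2 - 1) * (2 * \<delta> - 2 - 2) / 6)"
    unfolding b of_nat_choose_3 e \<delta>_def ..
  have calc: "6 * (2 * (x * u * v / 6) ^ 2 / (4 * u * t * v / 6)) = x * (x * u * v / (2 * t))"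
    if "x \<noteq> 0" "u \<noteq> 0" "v \<noteq> 0" "t \<noteq> 0" for x u v t :: complex
    using that by (simp add: field_simps power2_eq_square)
  note b
  also have "(2 * \<delta> - 2) * (2 * \<delta> - 2 - 1) * (2 * \<delta> - 2 - 2) / 6 =
      4 * (\<delta> - 1) * (2 * \<delta> - 3) * (\<delta> - 2) / 6" by (simp add: algebra_simps)
  finally show ?thesis
    unfolding \<delta>_def[symmetric] using calc[OF nz] by (simp only:)
qed

section \<open>The Bezoutiant modulo \<open>\<omega>\<^sup>4\<close>\<close>


lemma half_polar_jet_1: "1 \<le> m \<Longrightarrow> half_polar_jet m 1 = 1 / 2"
proof -
  assume "1 \<le> m"
  then obtain k where m: "m = Suc k" by (metis One_nat_def Suc_le_D)
  have f: "(fact (Suc (Suc (2 * k))) :: complex) = of_nat (Suc (Suc (2 * k))) * fact (Suc (2 * k))"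
    by simp
  have e: "2 * m = Suc (Suc (2 * k))" "2 * m - 1 = Suc (2 * k)" using m by simp_all
  have "half_polar_jet m 1 = of_nat m * fact (2 * m - 1) / fact (2 * m)"
    by (simp add: half_polar_jet_def)
  also have "\<dots> = of_nat (Suc k) / of_nat (Suc (Suc (2 * k)))"
    unfolding e(2) unfolding e(1) unfolding f m by (simp del: fact_Suc of_nat_Suc)
  also have "of_nat (Suc (Suc (2 * k))) = (2 * of_nat (Suc k) :: complex)" by simp
  finally show ?thesis by (simp del: of_nat_Suc)
qed

lemma half_polar_jet_2:
  "1 \<le> m \<Longrightarrow> half_polar_jet m 2 = (of_nat m - 1) / (2 * (2 * of_nat m - 1))"
proof -
  assume "1 \<le> m"
  then obtain k where m: "m = Suc k" by (metis One_nat_def Suc_le_D)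
  have f: "(fact (Suc (Suc (2 * k))) :: complex) = 2 * of_nat (Suc k) * of_nat (Suc (2 * k)) * fact (2 * k)"
    by (simp add: algebra_simps)
  have e: "2 * m = Suc (Suc (2 * k))" "2 * m - 2 = 2 * k" using m by simp_all
  have "half_polar_jet m 2 = of_nat (Suc k) * of_nat k * fact (2 * m - 2) / fact (2 * m)"
    by (simp add: half_polar_jet_def numeral_2_eq_2 m algebra_simps)
  also have "\<dots> = of_nat k / (2 * of_nat (Suc (2 * k)))"
    unfolding e(2) unfolding e(1) f by (simp del: fact_Suc of_nat_Suc)
  finally show ?thesis unfolding m by simp
qed

lemma half_polar_jet_3:
  "2 \<le> m \<Longrightarrow> half_polar_jet m 3 = (of_nat m - 2) / (4 * (2 * of_nat m - 1))"
proof -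
  assume "2 \<le> m"
  then obtain k where "m = 2 + k" using le_Suc_ex by blast
  then have m: "m = Suc (Suc k)" by simp
  have f: "(fact (2 * m) :: complex) =
      4 * of_nat (Suc (Suc k)) * of_nat (Suc k) * of_nat (2 * k + 3) * fact (2 * m - 3)"
  proof -
    have e: "2 * m = Suc (Suc (Suc (Suc (2 * k))))" "2 * m - 3 = Suc (2 * k)" using m by simp_all
    show ?thesis unfolding e(2) unfolding e(1) by (simp add: algebra_simps)
  qed
  have "half_polar_jet m 3 = of_nat (Suc (Suc k)) * of_nat (Suc k) * of_nat k * fact (2 * m - 3) / fact (2 * m)"
    by (simp add: half_polar_jet_def numeral_3_eq_3 m algebra_simps del: fact_Suc)
  also have "\<dots> = of_nat k / (4 * of_nat (2 * k + 3))"
    unfolding f by (simp del: fact_Suc of_nat_Suc of_nat_add)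
  finally show ?thesis unfolding m by (simp add: algebra_simps)
qed

lemma higher_pderiv_eq_0: "degree p < k \<Longrightarrow> (pderiv ^^ k) p = 0" for p :: "complex poly"
  by (rule poly_eqI) (simp add: coeff_higher_pderiv coeff_eq_0)

text \<open>
  For \<open>w = a b' - b a'\<close> and \<open>p = a b''' - b a'''\<close> the fourth expression is \<open>2 p' - w'''\<close>, so the equation of
  order 4 along the diagonal follows from those of order 1 and 3.
\<close>

lemma fourth_jet:
  fixes a b :: "complex poly"
  assumes "a * D b - b * D a = smult x m"
    and "a * D (D (D b)) - b * D (D (D a)) = smult y (D (D m)) + smult z n"
    and "D = pderiv"
  shows "a * D (D (D (D b))) - b * D (D (D (D a))) = smult (2 * y - x) (D (D (D m))) + smult (2 * z) (D n)"
proof -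
  have 1: "D (D (D (a * D b - b * D a))) = smult x (D (D (D m)))"
    unfolding assms(1) by (simp add: assms(3) pderiv_smult)
  have 2: "D (a * D (D (D b)) - b * D (D (D a))) = smult y (D (D (D m))) + smult z (D n)"
    unfolding assms(2) by (simp add: assms(3) pderiv_smult pderiv_add)
  have "a * D (D (D (D b))) - b * D (D (D (D a))) =
      2 * D (a * D (D (D b)) - b * D (D (D a))) - D (D (D (a * D b - b * D a)))"
    by (simp add: assms(3) pderiv_diff pderiv_mult pderiv_add algebra_simps)
  also have "\<dots> = smult (2 * y - x) (D (D (D m))) + smult (2 * z) (D n)"
    unfolding 1 2 by (simp add: smult_diff_left smult_add_right numeral_poly mult.commute)
  finally show ?thesis .
qed

context form_pair
begin

text \<open>
  The sum of the first two terms of the Gordan series, with \<open>M\<close> and \<open>N\<close> in the place of \<open>(A, B)\<^sub>1\<close> and \<open>(A, B)\<^sub>3\<close>.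
\<close>

definition gordan_approximation :: biform where
  "gordan_approximation = in_x (const (bez_const d 0)) * half_polar (2 * d - 2) M
     + in_x (const (bez_const d 1)) * omega ^ 2 * half_polar (2 * d - 6) N"

lemma N_eq_0: "d = 2 \<Longrightarrow> N = 0"
  using N by (auto simp: forms_iff intro!: poly_eqI)

lemma half_orders: "2 * d - 2 = 2 * (d - 1)" "2 * d - 6 = 2 * (d - 3)"
  by simp_all

lemma jet_M: "diag ((pderiv ^^ j) (half_polar (2 * d - 2) M)) =
    scale (half_polar_jet (d - 1) j) ((dx1 ^^ j) M)"
proof -
  have "M \<in> forms (int (2 * (d - 1)))" using M d by (simp add: of_nat_diff)
  from diag_higher_pderiv_half_polar[OF this] show ?thesis by (simp add: half_orders)
qed

lemma jet_N: "diag ((pderiv ^^ j) (half_polar (2 * d - 6) N)) =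
    scale (half_polar_jet (d - 3) j) ((dx1 ^^ j) N)"
proof (cases "d = 2")
  case True
  have "(dx1 ^^ j) 0 = 0" by (induction j) simp_all
  then show ?thesis using N_eq_0[OF True] by (simp add: half_polar_0)
next
  case False
  then have "N \<in> forms (int (2 * (d - 3)))" using N d by (simp add: of_nat_diff)
  from diag_higher_pderiv_half_polar[OF this] show ?thesis by (simp add: half_orders)
qed

lemma y_homogeneous_omega_gordan: "y_homogeneous d (omega * gordan_approximation)"
proof -
  have c: "y_homogeneous b (in_x F * P)" if "y_homogeneous b P" for b F P
    using y_homogeneous_mult[OF y_homogeneous_in_x that] by simp
  have "y_homogeneous (d - 1) (half_polar (2 * d - 2) M)"
    unfolding half_orders by (rule y_homogeneous_half_polar)
  then have "y_homogeneous (d - 1) (in_x (const (bez_const d 0)) * half_polar (2 * d - 2) M)" by (rule c)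
  moreover have "y_homogeneous (d - 1) (in_x (const (bez_const d 1)) * omega ^ 2 * half_polar (2 * d - 6) N)"
  proof (cases "d = 2")
    case True
    then show ?thesis using N_eq_0[OF True] by (simp add: half_polar_0 y_homogeneous_0)
  next
    case False
    have "y_homogeneous (1 + (1 + (d - 3))) (omega * (omega * half_polar (2 * d - 6) N))"
      unfolding half_orders by (intro y_homogeneous_mult y_homogeneous_omega y_homogeneous_half_polar)
    moreover have "1 + (1 + (d - 3)) = d - 1" using False d by simp
    ultimately show ?thesis using c by (simp add: power2_eq_square mult.assoc)
  qed
  ultimately have "y_homogeneous (1 + (d - 1)) (omega * gordan_approximation)"
    unfolding gordan_approximation_def by (intro y_homogeneous_mult y_homogeneous_omega y_homogeneous_add)
  then show ?thesis using d by simp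
qed

text \<open>
  A factor \<open>\<omega>\<close> lowers the order of the derivatives along the diagonal by one, since
  \<open>\<omega>\<close> vanishes there and \<open>\<partial>\<omega>/\<partial>y1 = x0\<close>. For \<open>k < 3\<close> the truncated differences \<open>k - 3\<close> are harmless,
  because the factor \<open>k (k-1) (k-2)\<close> vanishes.
\<close>

lemma jet_omega_gordan:
  "diag ((pderiv ^^ k) (omega * gordan_approximation)) =
    of_nat k * X0 * (scale (bez_const d 0 * half_polar_jet (d - 1) (k - 1)) ((dx1 ^^ (k - 1)) M)
     + of_nat ((k - 1) * (k - 2)) * X0 ^ 2 *
       scale (bez_const d 1 * half_polar_jet (d - 3) (k - 3)) ((dx1 ^^ (k - 3)) N))"
proof -
  have *: "diag ((pderiv ^^ j) (in_x (const c) * P)) = scale c (diag ((pderiv ^^ j) P))" for j c P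
    by (simp add: higher_pderiv_in_x_mult diag_mult diag_in_x scale_eq_const_mult)
  have 2: "diag ((pderiv ^^ j) (omega ^ 2 * P)) = of_nat (j * (j - 1)) * X0 ^ 2 * diag ((pderiv ^^ (j - 2)) P)"
    for j P
    by (simp add: power2_eq_square mult.assoc diag_higher_pderiv_mult_omega numeral_2_eq_2)
  show ?thesis
    unfolding diag_higher_pderiv_mult_omega gordan_approximation_def higher_pderiv_add diag_add
      mult.assoc * 2 jet_M jet_N
    by (simp add: scale_eq_const_mult const_mult numeral_eq_Suc algebra_simps)
qed

text \<open>
  Multiplied by \<open>\<omega>\<close>, the congruence modulo \<open>\<omega>\<^sup>4\<close> is the divisibility of a polynomial by \<open>\<omega>\<^sup>5\<close>. Its first
  five derivatives on the diagonal are forms, so the equations can be stated for polynomials in one variable.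
\<close>

lemma bezoutiant_congruence_iff:
  assumes "A \<in> forms (int d)" "B \<in> forms (int d)"
  shows "omega ^ 4 dvd bezoutiant A B - gordan_approximation \<longleftrightarrow>
    (\<forall>k<5. dehom A * (pderiv ^^ k) (dehom B) - dehom B * (pderiv ^^ k) (dehom A) =
      of_nat k * (smult (bez_const d 0 * half_polar_jet (d - 1) (k - 1)) ((pderiv ^^ (k - 1)) (dehom M))
       + of_nat ((k - 1) * (k - 2)) *
         smult (bez_const d 1 * half_polar_jet (d - 3) (k - 3)) ((pderiv ^^ (k - 3)) (dehom N))))"
proof -
  define T where "T = in_x A * in_y B - in_x B * in_y A - omega * gordan_approximation"
  have U: "y_homogeneous d (in_x A * in_y B - in_x B * in_y A)"
    using y_homogeneous_mult[OF y_homogeneous_in_x y_homogeneous_in_y] assms by (fastforce intro!: y_homogeneous_diff)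
  have T: "y_homogeneous d T" unfolding T_def by (intro y_homogeneous_diff U y_homogeneous_omega_gordan)
  have "omega ^ 4 dvd bezoutiant A B - gordan_approximation \<longleftrightarrow>
      omega * omega ^ 4 dvd omega * (bezoutiant A B - gordan_approximation)"
    using omega_nz by simp
  also have "omega * (bezoutiant A B - gordan_approximation) = T"
    unfolding T_def right_diff_distrib omega_mult_bezoutiant[OF assms] ..
  also have "omega * omega ^ 4 = omega ^ 5" by (simp add: numeral_eq_Suc)
  also have "omega ^ 5 dvd T \<longleftrightarrow> (\<forall>k<5. diag ((pderiv ^^ k) T) = 0)"
    by (rule omega_power_dvd_iff[OF T])
  also have "\<dots> \<longleftrightarrow> (\<forall>k<5. dehom A * (pderiv ^^ k) (dehom B) - dehom B * (pderiv ^^ k) (dehom A) =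
      of_nat k * (smult (bez_const d 0 * half_polar_jet (d - 1) (k - 1)) ((pderiv ^^ (k - 1)) (dehom M))
       + of_nat ((k - 1) * (k - 2)) *
         smult (bez_const d 1 * half_polar_jet (d - 3) (k - 3)) ((pderiv ^^ (k - 3)) (dehom N))))"
  proof (intro all_cong1 imp_cong refl)
    fix k
    have dx1: "dehom ((dx1 ^^ j) F) = (pderiv ^^ j) (dehom F)" for j F
      by (induction j) (simp_all add: dehom_dx1)
    have D: "diag ((pderiv ^^ k) T) = A * (dx1 ^^ k) B - B * (dx1 ^^ k) A
        - diag ((pderiv ^^ k) (omega * gordan_approximation))"
      by (simp add: T_def biform_higher_pderiv_diff higher_pderiv_in_x_mult higher_pderiv_in_y
          diag_diff diag_mult diag_in_x diag_in_y)
    have of_nat_form: "of_nat n * F \<in> forms e" if "F \<in> forms e" for n F e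
      using forms_scale[OF that, of "of_nat n"] by (simp add: scale_of_nat)
    have "A * (dx1 ^^ k) B \<in> forms (int d + (int d - int k))"
      "B * (dx1 ^^ k) A \<in> forms (int d + (int d - int k))"
      by (rule forms_mult[OF assms(1) forms_dx1_pow[OF assms(2)]],
          rule forms_mult[OF assms(2) forms_dx1_pow[OF assms(1)]])
    moreover have "diag ((pderiv ^^ k) (omega * gordan_approximation)) \<in> forms (int d + (int d - int k))"
    proof (cases "k = 0")
      case True
      then show ?thesis by (simp add: diag_mult diag_omega)
    next
      case False
      have 1: "X0 * scale c ((dx1 ^^ (k - 1)) M) \<in> forms (1 + (2 * int d - 2 - int (k - 1)))" for c
        using M by (intro forms_mult X0_forms forms_scale forms_dx1_pow)
      have 2: "of_nat ((k - 1) * (k - 2)) * (X0 ^ 3 * scale c ((dx1 ^^ (k - 3)) N))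
          \<in> forms (int d + (int d - int k))" for c
      proof (cases "3 \<le> k")
        case True
        have "X0 ^ 3 * scale c ((dx1 ^^ (k - 3)) N) \<in> forms (int 3 * 1 + (2 * int d - 6 - int (k - 3)))"
          using N by (intro forms_mult forms_power X0_forms forms_scale forms_dx1_pow)
        then show ?thesis using True by (intro of_nat_form) (simp add: of_nat_diff algebra_simps)
      next
        case 3: False
        then have z: "(k - 1) * (k - 2) = 0" by auto
        show ?thesis unfolding z by simp
      qed
      have "diag ((pderiv ^^ k) (omega * gordan_approximation)) =
         of_nat k * (X0 * scale (bez_const d 0 * half_polar_jet (d - 1) (k - 1)) ((dx1 ^^ (k - 1)) M) +
         of_nat ((k - 1) * (k - 2)) *
           (X0 ^ 3 * scale (bez_const d 1 * half_polar_jet (d - 3) (k - 3)) ((dx1 ^^ (k - 3)) N)))"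
        unfolding jet_omega_gordan by (simp add: numeral_eq_Suc algebra_simps)
      also have "\<dots> \<in> forms (int d + (int d - int k))"
      proof (rule of_nat_form, rule forms_add)
        have "1 + (2 * int d - 2 - int (k - 1)) = int d + (int d - int k)" using False by simp
        then show "X0 * scale (bez_const d 0 * half_polar_jet (d - 1) (k - 1)) ((dx1 ^^ (k - 1)) M) \<in>
            forms (int d + (int d - int k))" using 1 by metis
      qed (rule 2)
      finally show ?thesis .
    qed
    ultimately have "diag ((pderiv ^^ k) T) \<in> forms (int d + (int d - int k))"
      unfolding D by (intro forms_diff)
    from dehom_eq_0_iff[OF this, symmetric]
    show "diag ((pderiv ^^ k) T) = 0 \<longleftrightarrow> dehom A * (pderiv ^^ k) (dehom B) - dehom B * (pderiv ^^ k) (dehom A) =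
      of_nat k * (smult (bez_const d 0 * half_polar_jet (d - 1) (k - 1)) ((pderiv ^^ (k - 1)) (dehom M))
       + of_nat ((k - 1) * (k - 2)) *
         smult (bez_const d 1 * half_polar_jet (d - 3) (k - 3)) ((pderiv ^^ (k - 3)) (dehom N)))"
      unfolding D dehom_diff jet_omega_gordan
      by (simp add: dehom_mult dehom_add dehom_scale dehom_of_nat dehom_power dehom_X0 dx1 del: of_nat_mult)
  qed
  finally show ?thesis .
qed

text \<open>
  The equation of order 0 is trivial, the one of order 2 is the derivative of the one of order 1, and the
  one of order 4 follows by \<open>fourth_jet\<close>. The equations of order 1 and 3 determine \<open>M\<close> and \<open>N\<close>.
\<close>

lemma gordan_iff_transvectants:
  assumes A: "A \<in> forms (int d)" and B: "B \<in> forms (int d)"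
  shows "omega ^ 4 dvd bezoutiant A B - gordan_approximation \<longleftrightarrow>
    M = transvectant d d 1 A B \<and> N = transvectant d d 3 A B"
proof -
  let ?a = "dehom A" and ?b = "dehom B" and ?m = "dehom M" and ?n = "dehom N"
  define \<delta> where "\<delta> = complex_of_nat d"
  define \<gamma> \<kappa> where "\<gamma> = \<delta> / (2 * (2 * \<delta> - 3))" and "\<kappa> = \<delta> * (\<delta> * (\<delta> - 1) * (\<delta> - 2) / (2 * (2 * \<delta> - 3)))"
  define p q where "p = ?a * pderiv (pderiv (pderiv ?b)) - pderiv (pderiv (pderiv ?a)) * ?b"
    and "q = pderiv ?a * pderiv (pderiv ?b) - pderiv (pderiv ?a) * pderiv ?b"
  \<comment> \<open>the equation of order \<open>k\<close> on the diagonal\<close>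
  define E where "E k \<longleftrightarrow> ?a * (pderiv ^^ k) ?b - ?b * (pderiv ^^ k) ?a =
      of_nat k * (smult (bez_const d 0 * half_polar_jet (d - 1) (k - 1)) ((pderiv ^^ (k - 1)) ?m)
       + of_nat ((k - 1) * (k - 2)) *
         smult (bez_const d 1 * half_polar_jet (d - 3) (k - 3)) ((pderiv ^^ (k - 3)) ?n))" for k
  have nz: "2 * \<delta> - 3 \<noteq> 0" using double_minus_3_nonzero[of d] by (simp add: \<delta>_def)
  have d1: "complex_of_nat (d - 1) = \<delta> - 1" "1 \<le> d - 1" using d by (simp_all add: \<delta>_def of_nat_diff)
  have c0: "bez_const d 0 = \<delta>" using bez_const_0[of d] d by (simp add: \<delta>_def)
  have c1: "6 * bez_const d 1 = \<kappa>" using bez_const_1[OF d] by (simp add: \<delta>_def \<kappa>_def)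
  have num: "of_nat k * F = smult (of_nat k) F" for k and F :: "complex poly"
    by (simp add: of_nat_poly)
  have D: "(pderiv ^^ 2) f = pderiv (pderiv f)" "(pderiv ^^ 3) f = pderiv (pderiv (pderiv f))"
      "(pderiv ^^ 4) f = pderiv (pderiv (pderiv (pderiv f)))" "(pderiv ^^ 1) f = pderiv f"
    for f :: "complex poly" by (simp_all add: numeral_eq_Suc)
  have jet2: "half_polar_jet (d - 1) 2 = (\<delta> - 2) / (2 * (2 * \<delta> - 3))"
    unfolding half_polar_jet_2[OF d1(2)] d1(1) by (simp add: algebra_simps)
  have E0: "E 0" by (simp add: E_def)
  have E1: "E 1 \<longleftrightarrow> ?a * pderiv ?b - ?b * pderiv ?a = smult \<delta> ?m"
    by (simp add: E_def c0 half_polar_jet_0)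
  have E2: "E 2 \<longleftrightarrow> ?a * pderiv (pderiv ?b) - ?b * pderiv (pderiv ?a) = smult \<delta> (pderiv ?m)"
  proof -
    have "E 2 \<longleftrightarrow> ?a * pderiv (pderiv ?b) - ?b * pderiv (pderiv ?a) =
        of_nat 2 * smult (\<delta> * half_polar_jet (d - 1) 1) (pderiv ?m)"
      by (simp add: E_def D c0)
    then show ?thesis unfolding num half_polar_jet_1[OF d1(2)] by simp
  qed
  have E3: "E 3 \<longleftrightarrow> ?a * pderiv (pderiv (pderiv ?b)) - ?b * pderiv (pderiv (pderiv ?a)) =
      smult (3 * \<delta> * ((\<delta> - 2) / (2 * (2 * \<delta> - 3)))) (pderiv (pderiv ?m)) + smult \<kappa> ?n"
  proof -
    have "E 3 \<longleftrightarrow> ?a * pderiv (pderiv (pderiv ?b)) - ?b * pderiv (pderiv (pderiv ?a)) =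
        of_nat 3 * (smult (\<delta> * half_polar_jet (d - 1) 2) (pderiv (pderiv ?m)) +
          of_nat 2 * smult (bez_const d 1) ?n)"
      by (simp add: E_def D c0 half_polar_jet_0)
    also have "of_nat 3 * (smult (\<delta> * half_polar_jet (d - 1) 2) (pderiv (pderiv ?m)) +
          of_nat 2 * smult (bez_const d 1) ?n) =
        smult (3 * \<delta> * half_polar_jet (d - 1) 2) (pderiv (pderiv ?m)) + smult (6 * bez_const d 1) ?n"
      unfolding num by (simp add: smult_add_right mult.assoc)
    finally show ?thesis unfolding c1 jet2 .
  qed
  have E12: "E 2" if "E 1"
  proof -
    have "pderiv (?a * pderiv ?b - ?b * pderiv ?a) = pderiv (smult \<delta> ?m)"
      using that unfolding E1 by simp
    then show ?thesis unfolding E2 by (simp add: pderiv_diff pderiv_mult pderiv_smult algebra_simps)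
  qed
  have E134: "E 4" if "E 1" "E 3"
  proof (cases "d = 2")
    case True
    have z: "(pderiv ^^ k) (dehom F) = 0" if "F \<in> forms (int e)" "e < k" for F e k
      using degree_dehom_le[OF that(1)] that(2) by (intro higher_pderiv_eq_0) simp
    have "(pderiv ^^ 4) ?a = 0" "(pderiv ^^ 4) ?b = 0" using z[OF A, of 4] z[OF B, of 4] True by auto
    moreover have "M \<in> forms (int 2)" using M True by simp
    then have "(pderiv ^^ 3) ?m = 0" using z[of M 2 3] by simp
    ultimately show ?thesis using N_eq_0[OF True] by (simp add: E_def)
  next
    case False
    then have d3: "3 \<le> d" using d by simp
    have jet3: "half_polar_jet (d - 1) 3 = (\<delta> - 3) / (4 * (2 * \<delta> - 3))"
      using half_polar_jet_3[of "d - 1"] d3 unfolding d1(1) by (simp add: algebra_simps)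
    have n': "smult (half_polar_jet (d - 3) 1) (pderiv ?n) = smult (1 / 2) (pderiv ?n)"
    proof (cases "d = 3")
      case True
      then have "N \<in> forms (int 0)" using N by simp
      then have "degree ?n = 0" using degree_dehom_le[of N 0] by simp
      then have "pderiv ?n = 0" by (simp add: pderiv_eq_0_iff)
      then show ?thesis by simp
    next
      case False
      then have "1 \<le> d - 3" using d3 by simp
      then show ?thesis by (simp only: half_polar_jet_1)
    qed
    have "?a * pderiv (pderiv (pderiv (pderiv ?b))) - ?b * pderiv (pderiv (pderiv (pderiv ?a))) =
      smult (2 * (3 * \<delta> * ((\<delta> - 2) / (2 * (2 * \<delta> - 3)))) - \<delta>) (pderiv (pderiv (pderiv ?m)))
      + smult (2 * \<kappa>) (pderiv ?n)"
      by (rule fourth_jet[OF that(1)[unfolded E1] that(2)[unfolded E3] refl])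
    also have "2 * (3 * \<delta> * ((\<delta> - 2) / (2 * (2 * \<delta> - 3)))) - \<delta> = 4 * (\<delta> * ((\<delta> - 3) / (4 * (2 * \<delta> - 3))))"
      using nz by (simp add: divide_simps) (simp add: algebra_simps)
    also have "smult (2 * \<kappa>) (pderiv ?n) = of_nat 4 * (of_nat 6 * smult (bez_const d 1) (smult (1 / 2) (pderiv ?n)))"
      unfolding num c1[symmetric] by simp
    also have "\<dots> = of_nat 4 * (of_nat 6 * smult (bez_const d 1 * half_polar_jet (d - 3) 1) (pderiv ?n))"
      unfolding n'[symmetric] by simp
    also have "smult (4 * (\<delta> * ((\<delta> - 3) / (4 * (2 * \<delta> - 3))))) (pderiv (pderiv (pderiv ?m))) =
        of_nat 4 * smult (\<delta> * half_polar_jet (d - 1) 3) (pderiv (pderiv (pderiv ?m)))"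
      unfolding num jet3 by simp
    finally have "?a * pderiv (pderiv (pderiv (pderiv ?b))) - ?b * pderiv (pderiv (pderiv (pderiv ?a))) =
      of_nat 4 * (smult (\<delta> * half_polar_jet (d - 1) 3) (pderiv (pderiv (pderiv ?m))) +
        of_nat 6 * smult (bez_const d 1 * half_polar_jet (d - 3) 1) (pderiv ?n))"
      by (simp only: distrib_left)
    moreover have "4 - 1 = (3::nat)" "4 - 3 = (1::nat)" "(4 - 1) * (4 - 2) = (6::nat)" by simp_all
    ultimately show ?thesis unfolding E_def c0 by (simp only: D)
  qed
  have five: "(\<forall>k<5. E k) \<longleftrightarrow> E 0 \<and> E 1 \<and> E 2 \<and> E 3 \<and> E 4"
    by (auto simp: numeral_eq_Suc less_Suc_eq)
  have "omega ^ 4 dvd bezoutiant A B - gordan_approximation \<longleftrightarrow> (\<forall>k<5. E k)"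
    unfolding E_def by (rule bezoutiant_congruence_iff[OF A B])
  also have "\<dots> \<longleftrightarrow> E 1 \<and> E 3" using five E0 E12 E134 by blast
  also have "E 1 \<longleftrightarrow> M = transvectant d d 1 A B"
    unfolding E1 transvectant_1_eq_iff[OF A B] \<delta>_def by (auto simp: mult.commute)
  also have "M = transvectant d d 1 A B \<and> E 3 \<longleftrightarrow>
      M = transvectant d d 1 A B \<and> N = transvectant d d 3 A B"
  proof (rule conj_cong[OF refl])
    assume "M = transvectant d d 1 A B"
    then have w: "smult \<delta> ?m = ?a * pderiv ?b - pderiv ?a * ?b"
      unfolding transvectant_1_eq_iff[OF A B] \<delta>_def .
    have "smult \<delta> (pderiv (pderiv ?m)) = pderiv (pderiv (smult \<delta> ?m))" by (simp add: pderiv_smult)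
    also have "\<dots> = p + q" unfolding w p_def q_def by (simp add: pderiv_diff pderiv_mult pderiv_add algebra_simps)
    finally have m2: "smult \<delta> (pderiv (pderiv ?m)) = p + q" .
    \<comment> \<open>\<open>p\<close> occurs on both sides of the equation of order 3\<close>
    have coef: "1 - 3 * ((\<delta> - 2) / (2 * (2 * \<delta> - 3))) = \<gamma>" "- (3 * ((\<delta> - 2) / (2 * (2 * \<delta> - 3)))) = \<gamma> - 1"
      unfolding \<gamma>_def using nz by (simp_all add: divide_simps)
    have "E 3 \<longleftrightarrow> p = smult (3 * ((\<delta> - 2) / (2 * (2 * \<delta> - 3)))) (p + q) + smult \<kappa> ?n"
      unfolding E3 m2[symmetric] by (simp add: p_def mult_ac)
    also have "\<dots> \<longleftrightarrow> smult \<kappa> ?n = smult (\<gamma> - 1) q + smult \<gamma> p"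
      unfolding coef[symmetric] by (auto simp: algebra_simps smult_add_right smult_diff_left)
    also have "\<dots> \<longleftrightarrow> N = transvectant d d 3 A B"
      unfolding transvectant_3_eq_iff[OF A B] \<delta>_def[symmetric] \<gamma>_def \<kappa>_def p_def q_def ..
    finally show "E 3 \<longleftrightarrow> N = transvectant d d 3 A B" .
  qed
  finally show ?thesis .
qed

theorem transvectant_iff_bezoutiant: "transvectant_condition d M N \<longleftrightarrow> bezoutiant_condition d M N"
  unfolding transvectant_condition_def bezoutiant_condition_def gordan_approximation_def[symmetric]
  using gordan_iff_transvectants by blast

end

section \<open>The Clebsch-Gordan decomposition\<close>


text \<open>
  Induction on \<open>r\<close>. Let \<open>J i j = \<Sum>\<^sub>k g\<^sub>k\<^sup>(\<^sup>i\<^sup>) h\<^sub>k\<^sup>(\<^sup>j\<^sup>)\<close>. As \<open>J i j\<close> vanishes for \<open>i + j = r - 1\<close>, so does its derivative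
  \<open>J (i+1) j + J i (j+1)\<close>, hence \<open>J i (r-i) = (-1)\<^sup>i J 0 r\<close>. The signs in the \<open>r\<close>-th transvectant
  cancel these signs, and the transvectant is a positive multiple of \<open>J 0 r\<close>.
\<close>

lemma jets_vanish_if_transvectants_vanish:
  assumes G: "\<And>k. k < n \<Longrightarrow> G k \<in> forms (int a)" and H: "\<And>k. k < n \<Longrightarrow> H k \<in> forms (int b)"
    and "b \<le> a" and T: "\<And>r. r \<le> b \<Longrightarrow> (\<Sum>k<n. transvectant a b r (G k) (H k)) = 0"
  shows "r \<le> b \<Longrightarrow> i \<le> r \<Longrightarrow> (\<Sum>k<n. (pderiv ^^ i) (dehom (G k)) * (pderiv ^^ (r - i)) (dehom (H k))) = 0"
proof (induction r arbitrary: i rule: less_induct)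
  case (less r)
  define J where "J i j = (\<Sum>k<n. (pderiv ^^ i) (dehom (G k)) * (pderiv ^^ j) (dehom (H k)))" for i j
  have J': "pderiv (J i j) = J (Suc i) j + J i (Suc j)" for i j
    unfolding J_def higher_pderiv_sum[of 1, simplified] sum.distrib[symmetric]
    by (intro sum.cong refl) (simp add: pderiv_mult algebra_simps)
  have sign: "J i (r - i) = (-1) ^ i * J 0 r" if "i \<le> r" for i
    using that
  proof (induction i)
    case (Suc i)
    have "J i (r - 1 - i) = 0"
      unfolding J_def using less.IH[of "r - 1" i] Suc.prems less.prems(1) by simp
    then have "J (Suc i) (r - 1 - i) + J i (Suc (r - 1 - i)) = 0"
      using J'[of i "r - 1 - i"] by simp
    moreover have "Suc (r - 1 - i) = r - i" "r - 1 - i = r - Suc i" using Suc.prems by auto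
    ultimately have "J (Suc i) (r - Suc i) = - J i (r - i)"
      by (simp add: add_eq_0_iff)
    then show ?case using Suc by simp
  qed simp
  define w where "w i = (r choose i) * (fact (a - i) * fact (b - r + i))" for i
  have "0 = dehom (\<Sum>k<n. transvectant a b r (G k) (H k))"
    using T[OF less.prems(1)] by simp
  also have "\<dots> = (\<Sum>k<n. \<Sum>i\<le>r. smult
    ((-1) ^ i * of_nat (r choose i) * (fact (a - i) * fact (b - r + i) / (fact a * fact b)))
       ((pderiv ^^ i) (dehom (G k)) * (pderiv ^^ (r - i)) (dehom (H k))))"
    unfolding dehom_sum using less.prems(1) assms(3)
    by (intro sum.cong refl dehom_transvectant G H) auto
  also have "\<dots> = (\<Sum>i\<le>r. smult
    ((-1) ^ i * of_nat (r choose i) * (fact (a - i) * fact (b - r + i) / (fact a * fact b)))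
       (J i (r - i)))"
    unfolding J_def smult_sum_right by (rule sum.swap)
  also have "\<dots> = (\<Sum>i\<le>r. smult (of_nat (w i) / (fact a * fact b)) (J 0 r))"
  proof (intro sum.cong refl)
    fix i assume "i \<in> {..r}"
    then show "smult ((-1) ^ i * of_nat (r choose i) * (fact (a - i) * fact (b - r + i) / (fact a * fact b)))
       (J i (r - i)) = smult (of_nat (w i) / (fact a * fact b)) (J 0 r)"
      unfolding w_def by (cases "even i") (simp_all add: sign)
  qed
  also have "\<dots> = smult (of_nat (\<Sum>i\<le>r. w i) / (fact a * fact b)) (J 0 r)"
    by (simp add: smult_sum[symmetric] sum_divide_distrib)
  finally have "smult (of_nat (\<Sum>i\<le>r. w i) / (fact a * fact b)) (J 0 r) = 0" by simp
  moreover have "(\<Sum>i\<le>r. w i) > 0"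
    by (intro sum_pos) (auto simp: w_def)
  ultimately have "J 0 r = 0"
    unfolding smult_eq_0_iff by (metis divide_eq_0_iff fact_nonzero mult_eq_0_iff neq0_conv of_nat_eq_0_iff)
  then show ?case using sign[OF less.prems(2)] unfolding J_def by simp
qed

text \<open>
  Injectivity of the Clebsch-Gordan map from \<open>S\<^sub>a \<otimes> S\<^sub>b\<close> to the sum of the \<open>S\<^bsub>a+b-2r\<^esub>\<close>. The vanishing jets
  say that the \<open>g\<^sub>k\<close> form a relation between the rows of the Wronskian matrix of the \<open>h\<^sub>k\<close>, whose
  determinant is nonzero because the \<open>h\<^sub>k\<close> are independent.
\<close>

theorem clebsch_gordan_injective:
  assumes G: "\<And>k. k < Suc b \<Longrightarrow> G k \<in> forms (int a)"
    and H: "\<And>k. k < Suc b \<Longrightarrow> H k \<in> forms (int b)"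
    and "b \<le> a" and T: "\<And>r. r \<le> b \<Longrightarrow> (\<Sum>k<Suc b. transvectant a b r (G k) (H k)) = 0"
    and indep: "\<And>c. (\<Sum>k<Suc b. scale (c k) (H k)) = 0 \<Longrightarrow> \<forall>k<Suc b. c k = 0"
    and "k < Suc b"
  shows "G k = 0"
proof (rule ccontr)
  assume "G k \<noteq> 0"
  then have "dehom (G k) \<noteq> 0" using dehom_eq_0_iff[OF G[OF assms(6)]] by simp
  moreover have "(\<Sum>i<Suc b. dehom (G i) * (pderiv ^^ j) (dehom (H i))) = 0" if "j < Suc b" for j
    using jets_vanish_if_transvectants_vanish[OF G H assms(3) T, of j 0] that by simp
  ultimately have "det (mat (Suc b) (Suc b) (\<lambda>(i, j). (pderiv ^^ j) (dehom (H i)))) = 0"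
    unfolding det_eq_0_iff_row_relation using assms(6) by (intro exI[of _ "\<lambda>i. dehom (G i)"]) blast
  then obtain c where c: "\<exists>i<Suc b. c i \<noteq> 0" "(\<Sum>i<Suc b. smult (c i) (dehom (H i))) = 0"
    unfolding wronskian_poly_eq_0_iff by blast
  have "dehom (\<Sum>i<Suc b. scale (c i) (H i)) = 0"
    unfolding dehom_linear_combination by (rule c(2))
  moreover have "(\<Sum>i<Suc b. scale (c i) (H i)) \<in> forms (int b)"
    by (intro forms_sum forms_scale H) simp
  ultimately have "(\<Sum>i<Suc b. scale (c i) (H i)) = 0" using dehom_eq_0_iff by blast
  with indep c(1) show False by blast
qed

section \<open>The dual of the exterior power\<close>


lemma coeff_form_eq_coeff_dehom:
  assumes "F \<in> forms (int d)" "l \<le> d"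
  shows "coeff (coeff F l) (d - l) = coeff (dehom F) l"
  using forms_coeff_monom[OF assms(1), of l] assms(2) by (simp add: nat_diff_distrib)

lemma dehom_monomial: "dehom (X0 ^ i * X1 ^ j) = monom 1 j"
  by (simp add: dehom_mult dehom_power dehom_X0 dehom_X1 monom_altdef)

lemma monomial_forms: "l \<le> d \<Longrightarrow> X0 ^ (d - l) * X1 ^ l \<in> forms (int d)"
  using forms_mult[OF forms_power[OF X0_forms, of "d - l"] forms_power[OF X1_forms, of l]]
  by (simp add: of_nat_diff)

lemma insert_index_neq: "insert_index k i \<noteq> k"
  and insert_index_le: "i < d \<Longrightarrow> insert_index k i \<le> d"
  and insert_index_eq_iff: "insert_index k i = insert_index k j \<longleftrightarrow> i = j"
  by (auto simp: insert_index_def)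

lemma insert_index_surj:
  assumes "l \<le> d" "l \<noteq> k" "k \<le> d"
  obtains i where "i < d" "insert_index k i = l"
proof
  show "delete_index k l < d" "insert_index k (delete_index k l) = l"
    using assms by (auto simp: delete_index_def insert_index_def)
qed

lemma det_row_linear:
  fixes u v :: "nat \<Rightarrow> 'a :: comm_ring_1"
  assumes "i < n"
  shows "det (mat n n (\<lambda>(i', j). if i' = i then c * u j + v j else w i' j)) =
    c * det (mat n n (\<lambda>(i', j). if i' = i then u j else w i' j)) +
    det (mat n n (\<lambda>(i', j). if i' = i then v j else w i' j))"
proof -
  let ?M = "\<lambda>r. mat n n (\<lambda>(i', j). if i' = i then r j else w i' j)"
  have del: "mat_delete (?M r) i j = mat_delete (?M r') i j" for r r' :: "nat \<Rightarrow> 'a" and j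
    unfolding mat_delete_def by (rule eq_matI) auto
  have cof: "cofactor (?M r) i j = cofactor (?M u) i j" for r j
    unfolding cofactor_def del[of r j u] ..
  have "det (?M r) = (\<Sum>j<n. r j * cofactor (?M u) i j)" for r
  proof -
    have "det (?M r) = (\<Sum>j<n. ?M r $$ (i, j) * cofactor (?M r) i j)"
      by (rule laplace_expansion_row) (use assms in auto)
    also have "\<dots> = (\<Sum>j<n. r j * cofactor (?M u) i j)"
      using assms by (intro sum.cong refl arg_cong2[of _ _ _ _ "(*)"] cof) simp
    finally show ?thesis .
  qed
  then show ?thesis by (simp add: sum.distrib sum_distrib_left algebra_simps)
qed

lemma tuples_update: "Fs \<in> tuples q V \<Longrightarrow> F \<in> V \<Longrightarrow> Fs[i := F] \<in> tuples q V"
  by (auto simp: tuples_def dest: set_update_subset_insert[THEN subsetD])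

lemma wedge_dual_basis_ext_dual: "wedge_dual_basis d k \<in> ext_dual d (forms (int d))"
proof -
  let ?V = "forms (int d)"
  let ?e = "\<lambda>F j. let l = insert_index k j in coeff (coeff F l) (d - l) :: complex"
  have lin: "wedge_dual_basis d k (Fs[i := scale c F + G]) =
      c * wedge_dual_basis d k (Fs[i := F]) + wedge_dual_basis d k (Fs[i := G])"
    if "Fs \<in> tuples d ?V" "i < d" "F \<in> ?V" "G \<in> ?V" for Fs i F G c
  proof -
    have len: "length Fs = d" using that(1) by (simp add: tuples_def)
    have *: "wedge_dual_basis d k (Fs[i := X]) =
        det (mat d d (\<lambda>(i', j). if i' = i then ?e X j else ?e (Fs ! i') j))" if "X \<in> ?V" for X
      unfolding wedge_dual_basis_def using tuples_update[OF \<open>Fs \<in> tuples d ?V\<close> that, of i] len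
      by (auto intro!: arg_cong[of _ _ det] eq_matI simp: nth_list_update)
    have e: "?e (scale c F + G) j = c * ?e F j + ?e G j" for j
      by (simp add: Let_def scale_def)
    have "scale c F + G \<in> ?V" using that by (intro forms_add forms_scale)
    show ?thesis
      unfolding *[OF that(3)] *[OF that(4)] *[OF \<open>scale c F + G \<in> ?V\<close>] e
      by (rule det_row_linear[OF that(2)])
  qed
  have alt: "wedge_dual_basis d k Fs = 0"
    if "Fs \<in> tuples d ?V" "i < d" "j < d" "i \<noteq> j" "Fs ! i = Fs ! j" for Fs i j
  proof -
    have "det (mat d d (\<lambda>(i, j). ?e (Fs ! i) j)) = 0"
      by (rule det_identical_rows[of _ d i j]) (use that in \<open>auto intro!: eq_vecI\<close>)
    then show ?thesis by (simp add: wedge_dual_basis_def)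
  qed
  show ?thesis
    unfolding ext_dual_def using lin alt by (auto simp: wedge_dual_basis_def)
qed

lemma wedge_basis_tuples: "wedge_basis d k \<in> tuples d (forms (int d))"
  by (auto simp: tuples_def wedge_basis_def Let_def intro!: monomial_forms insert_index_le)

text \<open>
  For \<open>k \<noteq> l\<close> the minor that omits the coefficient \<open>k\<close> contains the column of the coefficient \<open>l\<close>,
  and this column is zero, because \<open>b\<^sub>l\<close> does not contain the monomial with that coefficient.
\<close>

lemma wedge_dual_basis_wedge_basis:
  assumes "k \<le> d" "l \<le> d"
  shows "wedge_dual_basis d k (wedge_basis d l) = (if k = l then 1 else 0)"
proof -
  let ?a = "\<lambda>i j. if insert_index l i = insert_index k j then 1 else 0 :: complex"
  have "wedge_dual_basis d k (wedge_basis d l) = det (mat d d (\<lambda>(i, j). ?a i j))"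
  proof -
    have "coeff (coeff (wedge_basis d l ! i) (insert_index k j)) (d - insert_index k j) = ?a i j"
      if "i < d" "j < d" for i j
    proof -
      have F: "wedge_basis d l ! i = X0 ^ (d - insert_index l i) * X1 ^ insert_index l i"
        using that by (simp add: wedge_basis_def Let_def)
      have "wedge_basis d l ! i \<in> forms (int d)"
        unfolding F using that insert_index_le by (intro monomial_forms)
      from coeff_form_eq_coeff_dehom[OF this insert_index_le[OF that(2)]] show ?thesis
        unfolding F dehom_monomial by simp
    qed
    then show ?thesis
      unfolding wedge_dual_basis_def using wedge_basis_tuples
      by (auto intro!: arg_cong[of _ _ det] eq_matI simp: Let_def)
  qed
  also have "\<dots> = (if k = l then 1 else 0)"
  proof (cases "k = l")
    case True
    then have "mat d d (\<lambda>(i, j). ?a i j) = 1\<^sub>m d"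
      by (intro eq_matI) (auto simp: insert_index_eq_iff)
    then show ?thesis using True by simp
  next
    case False
    obtain j0 where j0: "j0 < d" "insert_index k j0 = l"
      using insert_index_surj[of l d k] assms False by metis
    have "(\<Sum>j<d. ?a i j * (if j = j0 then 1 else 0)) = 0" for i
      by (intro sum.neutral ballI) (use j0 insert_index_neq in auto)
    then have "det (mat d d (\<lambda>(i, j). ?a i j)) = 0"
      unfolding det_eq_0_iff_column_relation using j0(1)
      by (intro exI[of _ "\<lambda>j. if j = j0 then 1 else 0"]) auto
    then show ?thesis using False by simp
  qed
  finally show ?thesis .
qed

lemma ext_dual_0: "(\<lambda>Fs. 0) \<in> ext_dual q V"
  by (simp add: ext_dual_def)

lemma ext_dual_combine:
  "\<alpha> \<in> ext_dual q V \<Longrightarrow> \<beta> \<in> ext_dual q V \<Longrightarrow> (\<lambda>Fs. c * \<alpha> Fs + \<beta> Fs) \<in> ext_dual q V"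
  unfolding ext_dual_def by (auto simp: algebra_simps)

lemma iso_ext_dual_combine:
  assumes "SL2_iso_ext_dual d \<phi>" "\<alpha> \<in> ext_dual d (forms (int d))" "\<beta> \<in> ext_dual d (forms (int d))"
  shows "\<phi> (\<lambda>Fs. c * \<alpha> Fs + \<beta> Fs) = scale c (\<phi> \<alpha>) + \<phi> \<beta>"
  using assms by (simp add: SL2_iso_ext_dual_def)

lemma iso_ext_dual_linear_combination:
  fixes n :: nat
  assumes "SL2_iso_ext_dual d \<phi>" "\<And>k. k < n \<Longrightarrow> \<alpha> k \<in> ext_dual d (forms (int d))"
  shows "(\<lambda>Fs. \<Sum>k<n. c k * \<alpha> k Fs) \<in> ext_dual d (forms (int d)) \<and>
    \<phi> (\<lambda>Fs. \<Sum>k<n. c k * \<alpha> k Fs) = (\<Sum>k<n. scale (c k) (\<phi> (\<alpha> k)))"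
  using assms(2)
proof (induction n)
  case 0
  let ?z = "\<lambda>Fs :: form list. 0 :: complex"
  from iso_ext_dual_combine[OF assms(1) ext_dual_0 ext_dual_0, of 1] have "\<phi> ?z = 0" by simp
  then show ?case by (simp add: ext_dual_0)
next
  case (Suc n)
  let ?s = "\<lambda>Fs. \<Sum>k<n. c k * \<alpha> k Fs"
  have s: "?s \<in> ext_dual d (forms (int d))" "\<phi> ?s = (\<Sum>k<n. scale (c k) (\<phi> (\<alpha> k)))"
    using Suc.IH Suc.prems by simp_all
  have a: "\<alpha> n \<in> ext_dual d (forms (int d))" using Suc.prems by simp
  have "\<phi> (\<lambda>Fs. c n * \<alpha> n Fs + ?s Fs) = scale (c n) (\<phi> (\<alpha> n)) + \<phi> ?s"
    by (rule iso_ext_dual_combine[OF assms(1) a s(1)])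
  then show ?case using ext_dual_combine[OF a s(1), of "c n"] s(2) by (simp add: add.commute)
qed

text \<open>
  An injective linear map preserves independence, and the functionals \<open>b\<^sub>k\<^sup>*\<close> are independent because they are
  dual to the \<open>b\<^sub>l\<close>.
\<close>

lemma iso_dual_basis_independent:
  assumes "SL2_iso_ext_dual d \<phi>" "(\<Sum>k<Suc d. scale (c k) (\<phi> (wedge_dual_basis d k))) = 0" "l < Suc d"
  shows "c l = 0"
proof -
  let ?E = "ext_dual d (forms (int d))"
  let ?s = "\<lambda>Fs. \<Sum>k<Suc d. c k * wedge_dual_basis d k Fs"
  let ?z = "\<lambda>Fs. \<Sum>k<0::nat. c k * wedge_dual_basis d k Fs"
  have s: "?s \<in> ?E" "\<phi> ?s = 0"
    using iso_ext_dual_linear_combination[OF assms(1), of "Suc d" "wedge_dual_basis d" c]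
      wedge_dual_basis_ext_dual assms(2) by auto
  have z: "?z \<in> ?E" "\<phi> ?z = 0"
    using iso_ext_dual_linear_combination[OF assms(1), of 0 "wedge_dual_basis d" c] by auto
  have "inj_on \<phi> ?E" using assms(1) by (auto simp: SL2_iso_ext_dual_def bij_betw_def)
  then have "?s = ?z" by (rule inj_onD[OF _ trans[OF s(2) z(2)[symmetric]] s(1) z(1)])
  then have "?s (wedge_basis d l) = ?z (wedge_basis d l)" by (rule fun_cong)
  then have "?s (wedge_basis d l) = 0" by simp
  moreover have "?s (wedge_basis d l) = (\<Sum>k<Suc d. if k = l then c k else 0)"
    using assms(3) by (intro sum.cong refl) (simp add: wedge_dual_basis_wedge_basis)
  ultimately show ?thesis using assms(3) by (simp add: sum.delta del: sum.lessThan_Suc)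
qed

section \<open>The covariants \<open>\<Phi>\<^sub>r\<close>\<close>


lemma transvectant_0_left: "transvectant e f r 0 F = 0"
proof -
  have "(dx1 ^^ i) 0 = 0" "(dx0 ^^ i) 0 = 0" for i by (induction i) simp_all
  then show ?thesis by (simp add: transvectant_def)
qed

lemma Phi_eq_sum: "d \<noteq> 2 \<Longrightarrow> Phi \<phi> d r M N = (\<Sum>k<Suc d. transvectant (d * (2 * d - 5)) d r
    (wronskian (map (psi d M N) (wedge_basis d k))) (\<phi> (wedge_dual_basis d k)))"
  unfolding Phi_def tau_def
  by (simp add: comp_def interv_sum_list_conv_sum_set_nat lessThan_atLeast0 del: upt_Suc)

context form_pair
begin

lemma psi_linear_combination:
  assumes "\<And>i. i < n \<Longrightarrow> F i \<in> forms (int d)"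
  shows "psi d M N (\<Sum>i<n. scale (c i) (F i)) = (\<Sum>i<n. scale (c i) (psi d M N (F i)))"
proof -
  have F: "(\<Sum>i<n. scale (c i) (F i)) \<in> forms (int d)"
    using assms by (intro forms_sum forms_scale) simp
  have p: "(\<Sum>i<n. scale (c i) (psi d M N (F i))) \<in> forms (3 * int d - 6)"
    using assms by (intro forms_sum forms_scale forms_psi d M N) simp
  have "dehom (psi d M N (\<Sum>i<n. scale (c i) (F i))) = dehom (\<Sum>i<n. scale (c i) (psi d M N (F i)))"
    using assms
    by (simp add: dehom_linear_combination dehom_psi[OF d M F] dehom_psi[OF d M] psi_ode_sum psi_ode_smult
        smult_sum_right mult.commute)
  then show ?thesis using dehom_eq_iff[OF forms_psi[OF d M N F] p] by simp
qed

text \<open>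
  The forms without the monomial \<open>x0\<^sup>d\<^sup>-\<^sup>k x1\<^sup>k\<close> are the combinations of the members of \<open>wedge_basis d k\<close>,
  so the relations between their images under \<open>\<psi>\<close> are the elements of the kernel without this monomial.
\<close>

lemma omitted_monomial_relation_iff:
  assumes "k \<le> d"
  shows "(\<exists>c. (\<exists>i<d. c i \<noteq> 0) \<and> (\<Sum>i<d. scale (c i) (psi d M N (wedge_basis d k ! i))) = 0) \<longleftrightarrow>
    (\<exists>F\<in>ker_psi d M N. F \<noteq> 0 \<and> coeff (dehom F) k = 0)"
proof -
  have w: "wedge_basis d k ! i = X0 ^ (d - insert_index k i) * X1 ^ insert_index k i"
    "wedge_basis d k ! i \<in> forms (int d)" if "i < d" for i
    using that insert_index_le by (auto simp: wedge_basis_def Let_def intro!: monomial_forms)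
  define S where "S c = (\<Sum>i<d. scale (c i) (wedge_basis d k ! i))" for c
  have S: "S c \<in> forms (int d)" for c
    unfolding S_def using w(2) by (intro forms_sum forms_scale) simp
  have co: "coeff (dehom (S c)) l = (\<Sum>i<d. if insert_index k i = l then c i else 0)" for c l
    unfolding S_def dehom_linear_combination coeff_sum
    by (intro sum.cong refl) (simp add: w(1) dehom_monomial)
  have co1: "coeff (dehom (S c)) (insert_index k j) = c j" if "j < d" for c j
    unfolding co insert_index_eq_iff using that by simp
  have co2: "coeff (dehom (S c)) k = 0" for c
    unfolding co using insert_index_neq by (intro sum.neutral ballI) auto
  have psi: "psi d M N (S c) = (\<Sum>i<d. scale (c i) (psi d M N (wedge_basis d k ! i)))" for c
    unfolding S_def by (rule psi_linear_combination) (rule w(2))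
  show ?thesis
  proof
    assume "\<exists>c. (\<exists>i<d. c i \<noteq> 0) \<and> (\<Sum>i<d. scale (c i) (psi d M N (wedge_basis d k ! i))) = 0"
    then obtain c i where c: "i < d" "c i \<noteq> 0" "psi d M N (S c) = 0" unfolding psi by blast
    have "S c \<noteq> 0" using co1[OF c(1), of c] c(2) by auto
    moreover have "S c \<in> ker_psi d M N" using S c(3) by (simp add: ker_psi_def)
    ultimately show "\<exists>F\<in>ker_psi d M N. F \<noteq> 0 \<and> coeff (dehom F) k = 0" using co2 by blast
  next
    assume "\<exists>F\<in>ker_psi d M N. F \<noteq> 0 \<and> coeff (dehom F) k = 0"
    then obtain F where F: "F \<in> forms (int d)" "psi d M N F = 0" "F \<noteq> 0" "coeff (dehom F) k = 0"
      by (auto simp: ker_psi_def)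
    define c where "c i = coeff (dehom F) (insert_index k i)" for i
    have "dehom (S c) = dehom F"
    proof (rule poly_eqI)
      fix l
      consider "l > d" | "l = k" | "l \<le> d" "l \<noteq> k" by linarith
      then show "coeff (dehom (S c)) l = coeff (dehom F) l"
      proof cases
        case 1
        then show ?thesis using degree_dehom_le[OF F(1)] degree_dehom_le[OF S[of c]] by (simp add: coeff_eq_0)
      next
        case 2
        then show ?thesis using co2 F(4) by simp
      next
        case 3
        then obtain j where j: "j < d" "insert_index k j = l"
          using insert_index_surj assms by metis
        show ?thesis using co1[OF j(1), of c] j(2) by (simp add: c_def)
      qed
    qed
    then have e: "S c = F" using dehom_eq_iff[OF S F(1)] by simp
    have "\<exists>i<d. c i \<noteq> 0"
    proof (rule ccontr)
      assume "\<not> (\<exists>i<d. c i \<noteq> 0)"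
      then have "S c = 0" by (simp add: S_def)
      with e F(3) show False by simp
    qed
    then show "\<exists>c. (\<exists>i<d. c i \<noteq> 0) \<and> (\<Sum>i<d. scale (c i) (psi d M N (wedge_basis d k ! i))) = 0"
      using psi[of c] e F(2) by auto
  qed
qed

text \<open>
  In a space of dimension 2 one coefficient can always be eliminated. Conversely, let \<open>A\<close> be a nonzero
  element of the kernel and \<open>k\<close> the index of one of its nonzero coefficients; a nonzero element without this
  coefficient is not a multiple of \<open>A\<close>.
\<close>

lemma kernel_condition_iff_omitted:
  "kernel_condition d M N \<longleftrightarrow> (\<forall>k\<le>d. \<exists>F\<in>ker_psi d M N. F \<noteq> 0 \<and> coeff (dehom F) k = 0)"
proof
  assume "kernel_condition d M N"
  then obtain A B where AB: "A \<in> ker_psi d M N" "B \<in> ker_psi d M N" "lin_indep_pair A B"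
    unfolding kernel_condition_iff by blast
  show "\<forall>k\<le>d. \<exists>F\<in>ker_psi d M N. F \<noteq> 0 \<and> coeff (dehom F) k = 0"
  proof (intro allI impI)
    fix k
    have nz: "scale \<alpha> A + scale \<beta> B \<noteq> 0" if "\<alpha> \<noteq> 0 \<or> \<beta> \<noteq> 0" for \<alpha> \<beta>
      using AB(3) that unfolding lin_indep_pair_iff by blast
    have ker: "scale \<alpha> A + scale \<beta> B \<in> ker_psi d M N" for \<alpha> \<beta>
      using AB(1,2) by (auto simp: ker_psi_iff dehom_add dehom_scale psi_ode_add psi_ode_smult
          intro!: forms_add forms_scale)
    have co: "coeff (dehom (scale \<alpha> A + scale \<beta> B)) k = \<alpha> * coeff (dehom A) k + \<beta> * coeff (dehom B) k" for \<alpha> \<beta>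
      by (simp add: dehom_add dehom_scale)
    show "\<exists>F\<in>ker_psi d M N. F \<noteq> 0 \<and> coeff (dehom F) k = 0"
    proof (cases "coeff (dehom A) k = 0")
      case True
      then show ?thesis using nz[of 1 0] ker[of 1 0] co[of 1 0] by auto
    next
      case False
      then show ?thesis
        using nz[of "coeff (dehom B) k" "- coeff (dehom A) k"] ker co[of "coeff (dehom B) k" "- coeff (dehom A) k"]
        by (metis add.commute diff_self mult.commute mult_minus_left neg_equal_0_iff_equal
            uminus_add_conv_diff)
    qed
  qed
next
  assume *: "\<forall>k\<le>d. \<exists>F\<in>ker_psi d M N. F \<noteq> 0 \<and> coeff (dehom F) k = 0"
  then obtain A where A: "A \<in> ker_psi d M N" "A \<noteq> 0" by blast
  then have fA: "A \<in> forms (int d)" by (simp add: ker_psi_iff)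
  have "dehom A \<noteq> 0" using dehom_eq_0_iff[OF fA] A(2) by simp
  define k where "k = degree (dehom A)"
  have k: "coeff (dehom A) k \<noteq> 0" "k \<le> d"
    using \<open>dehom A \<noteq> 0\<close> degree_dehom_le[OF fA] by (auto simp: k_def)
  obtain B where B: "B \<in> ker_psi d M N" "B \<noteq> 0" "coeff (dehom B) k = 0" using * k(2) by blast
  have "lin_indep_pair A B"
    unfolding lin_indep_pair_iff
  proof (intro allI impI)
    fix \<alpha> \<beta> assume z: "scale \<alpha> A + scale \<beta> B = 0"
    then have "coeff (dehom (scale \<alpha> A + scale \<beta> B)) k = 0" by simp
    then have "\<alpha> = 0" using k(1) B(3) by (simp add: dehom_add dehom_scale)
    then show "\<alpha> = 0 \<and> \<beta> = 0" using z B(2) by simp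
  qed
  then show "kernel_condition d M N" using A(1) B(1) kernel_condition_iff by blast
qed

lemma kernel_condition_iff_wronskians:
  assumes "3 \<le> d"
  shows "kernel_condition d M N \<longleftrightarrow> (\<forall>k\<le>d. wronskian (map (psi d M N) (wedge_basis d k)) = 0)"
proof -
  have "wronskian (map (psi d M N) (wedge_basis d k)) = 0 \<longleftrightarrow>
      (\<exists>F\<in>ker_psi d M N. F \<noteq> 0 \<and> coeff (dehom F) k = 0)" if "k \<le> d" for k
  proof -
    have len: "length (wedge_basis d k) = d" by (simp add: wedge_basis_def)
    have "wronskian (map (psi d M N) (wedge_basis d k)) = 0 \<longleftrightarrow>
       (\<exists>c. (\<exists>i<d. c i \<noteq> 0) \<and> (\<Sum>i<d. scale (c i) (map (psi d M N) (wedge_basis d k) ! i)) = 0)"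
    proof (rule wronskian_eq_0_iff[where p = "3 * d - 6"])
      fix i assume "i < d"
      then have "wedge_basis d k ! i \<in> forms (int d)"
        using wedge_basis_tuples[of d k] len by (auto simp: tuples_def dest: nth_mem)
      from forms_psi[OF d M N this] show "map (psi d M N) (wedge_basis d k) ! i \<in> forms (int (3 * d - 6))"
        using \<open>i < d\<close> len assms by (simp add: of_nat_diff)
    qed (use len assms in auto)
    also have "\<dots> \<longleftrightarrow> (\<exists>F\<in>ker_psi d M N. F \<noteq> 0 \<and> coeff (dehom F) k = 0)"
      unfolding omitted_monomial_relation_iff[OF that, symmetric] using len by simp
    finally show ?thesis .
  qed
  then show ?thesis unfolding kernel_condition_iff_omitted by blast
qed

text \<open>
  For \<open>d = 2\<close> the map \<open>\<psi>\<close> takes constant values, and any two constants are dependent.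
\<close>

lemma kernel_condition_quadratic:
  assumes "d = 2"
  shows "kernel_condition d M N"
  unfolding kernel_condition_iff_omitted
proof (intro allI impI)
  fix k assume "k \<le> d"
  have "\<exists>u. psi d M N (wedge_basis d k ! i) = const u" if "i < d" for i
  proof -
    have "wedge_basis d k ! i \<in> forms (int d)"
      using wedge_basis_tuples[of d k] that by (auto simp: tuples_def dest: nth_mem)
    from forms_psi[OF d M N this] assms have p: "psi d M N (wedge_basis d k ! i) \<in> forms (int 0)" by simp
    then have "degree (dehom (psi d M N (wedge_basis d k ! i))) = 0" using degree_dehom_le by force
    then obtain u where "dehom (psi d M N (wedge_basis d k ! i)) = dehom (const u)"
      unfolding dehom_const by (metis degree_eq_zeroE)
    then show ?thesis using dehom_eq_iff[OF p, of "const u"] forms_const[of u] by auto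
  qed
  then obtain u where u: "\<And>i. i < d \<Longrightarrow> psi d M N (wedge_basis d k ! i) = const (u i)" by metis
  \<comment> \<open>a nontrivial relation between the two constants \<open>u 0\<close> and \<open>u 1\<close>\<close>
  define c where "c i = (if u 0 = 0 \<and> u 1 = 0 then 1 else if i = 0 then u 1 else - u (0::nat))" for i :: nat
  have "(\<exists>i<d. c i \<noteq> 0) \<and> (\<Sum>i<d. scale (c i) (psi d M N (wedge_basis d k ! i))) = 0"
  proof
    have "c 0 \<noteq> 0 \<or> c 1 \<noteq> 0" by (auto simp: c_def)
    then show "\<exists>i<d. c i \<noteq> 0" using assms by (auto simp: numeral_2_eq_2 less_Suc_eq)
    have "(\<Sum>i<d. scale (c i) (psi d M N (wedge_basis d k ! i))) = const (c 0 * u 0 + c 1 * u 1)"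
      using u[of 0] u[of 1] assms
      by (simp add: numeral_2_eq_2 scale_eq_const_mult const_add const_mult)
    then show "(\<Sum>i<d. scale (c i) (psi d M N (wedge_basis d k ! i))) = 0"
      by (simp add: c_def const_0)
  qed
  then show "\<exists>F\<in>ker_psi d M N. F \<noteq> 0 \<and> coeff (dehom F) k = 0"
    using omitted_monomial_relation_iff[OF \<open>k \<le> d\<close>] by blast
qed

theorem kernel_iff_Phi:
  assumes iso: "SL2_iso_ext_dual d \<phi>"
  shows "kernel_condition d M N \<longleftrightarrow> (\<forall>r\<le>d. Phi \<phi> d r M N = 0)"
proof (cases "d = 2")
  case True
  then show ?thesis using kernel_condition_quadratic by (simp add: Phi_def)
next
  case False
  then have d3: "3 \<le> d" using d by simp
  define G H where "G k = wronskian (map (psi d M N) (wedge_basis d k))"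
    and "H k = \<phi> (wedge_dual_basis d k)" for k
  have Phi: "Phi \<phi> d r M N = (\<Sum>k<Suc d. transvectant (d * (2 * d - 5)) d r (G k) (H k))" for r
    unfolding Phi_eq_sum[OF False] G_def H_def ..
  have "(\<forall>r\<le>d. Phi \<phi> d r M N = 0) \<longleftrightarrow> (\<forall>k\<le>d. G k = 0)"
  proof
    assume P: "\<forall>r\<le>d. Phi \<phi> d r M N = 0"
    show "\<forall>k\<le>d. G k = 0"
    proof (intro allI impI)
      fix k assume "k \<le> d"
      show "G k = 0"
      proof (rule clebsch_gordan_injective[of d G "d * (2 * d - 5)" H])
        fix k
        have "G k \<in> forms (int d * (int (3 * d - 6) - int d + 1))"
          unfolding G_def
        proof (rule forms_wronskian)
          fix i assume i: "i < d"
          then have "wedge_basis d k ! i \<in> forms (int d)"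
            using wedge_basis_tuples[of d k] by (auto simp: tuples_def dest: nth_mem)
          from forms_psi[OF d M N this]
          show "map (psi d M N) (wedge_basis d k) ! i \<in> forms (int (3 * d - 6))"
            using i d3 by (simp add: of_nat_diff wedge_basis_def)
        qed (simp add: wedge_basis_def)
        moreover have "int d * (int (3 * d - 6) - int d + 1) = int (d * (2 * d - 5))"
          using d3 by (simp add: of_nat_diff)
        ultimately show "G k \<in> forms (int (d * (2 * d - 5)))" by simp
        show "H k \<in> forms (int d)"
          using iso wedge_dual_basis_ext_dual unfolding H_def SL2_iso_ext_dual_def bij_betw_def by blast
      next
        show "d \<le> d * (2 * d - 5)" using d3 by simp
      next
        fix r assume "r \<le> d"
        then show "(\<Sum>k<Suc d. transvectant (d * (2 * d - 5)) d r (G k) (H k)) = 0"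
          using P Phi by simp
      next
        fix c assume "(\<Sum>k<Suc d. scale (c k) (H k)) = 0"
        then show "\<forall>k<Suc d. c k = 0"
          using iso_dual_basis_independent[OF iso] unfolding H_def by blast
      qed (use \<open>k \<le> d\<close> in simp)
    qed
  next
    assume "\<forall>k\<le>d. G k = 0"
    then show "\<forall>r\<le>d. Phi \<phi> d r M N = 0"
      unfolding Phi by (simp add: transvectant_0_left)
  qed
  then show ?thesis unfolding kernel_condition_iff_wronskians[OF d3] G_def by simp
qed

end


section \<open>Equivalence of the conditions\<close>

theorem theorem3p5:
  fixes d :: nat and M N :: form and \<phi> :: "(form list \<Rightarrow> complex) \<Rightarrow> form"
  assumes "d \<ge> 2"
    and "M \<in> forms (2 * int d - 2)" and "N \<in> forms (2 * int d - 6)" and "M \<noteq> 0"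
    and "SL2_iso_ext_dual d \<phi>"
  shows "(transvectant_condition d M N \<longleftrightarrow> bezoutiant_condition d M N) \<and>
         (bezoutiant_condition d M N \<longleftrightarrow> kernel_condition d M N) \<and>
         (kernel_condition d M N \<longrightarrow> form.dim (ker_psi d M N) = 2) \<and>
         (transvectant_condition d M N \<longleftrightarrow> (\<forall>r\<le>d. Phi \<phi> d r M N = 0))"
proof -
  interpret form_pair d M N
    by unfold_locales (use assms in auto)
  show ?thesis
    using transvectant_iff_bezoutiant transvectant_iff_kernel kernel_condition_dim
      kernel_iff_Phi[OF assms(5)] by blast
qed

end
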